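(* Let $\mathcal{H}$ be a complex Hilbert space and let $T\in\mathcal{B}(\mathcal{H})$ be a concave operator. Then: (i) $T$ has a $2$-isometric lifting $S$ on a Hilbert space $\mathcal{K}=\mathcal{H}^{\perp}\oplus\mathcal{H}$ with covariance ${\rm cov}(S)=\sqrt{2}\,\max\{1,\|\Delta_T\|^{1/2}\}$ and having a block matrix of the form $$S=\begin{pmatrix} W & X\\ 0 & T\end{pmatrix}\ \text{on}\ \begin{bmatrix}\mathcal{H}^{\perp}\\ \mathcal{H}\end{bmatrix},\qquad W=\begin{pmatrix} S_+^1 & \sqrt{2}E_0\\ 0 & S_+^0\end{pmatrix}\ \text{on}\ \begin{bmatrix}\mathcal{H}_1\\ \mathcal{H}_0\end{bmatrix},\qquad W^*X=0,$$ where $W$ is a $2$-isometry on a nontrivial decomposition $\mathcal{H}^{\perp}=\mathcal{H}_1\oplus\mathcal{H}_0$, $S_+^1$ and $S_+^0$ are unilateral shifts (on $\mathcal{H}_1$ and $\mathcal{H}_0$ respectively), $E_0:\mathcal{H}_0\to\mathcal{H}_1$ is an isometry, and $X:\mathcal{H}\to\mathcal{H}^\perp$ is a bounded operator. (ii) $T$ has a minimal $2$-isometric lifting $S$ on some $\mathcal{K}=\mathcal{H}^\perp\oplus\mathcal{H}$, of the form $S=\begin{pmatrix} W & X\\ 0 & T\end{pmatrix}$ on $\mathcal{H}^\perp\oplus\mathcal{H}$, where $W=S|_{\mathcal{H}^{\perp}}$ is an isometry, $W^*X=0$, and ${\rm cov}(S)=\|\Delta_T\|^{1/2}$.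
   Context: For $T\in\mathcal{B}(\mathcal{H})$ put $\Delta_T=T^*T-I$. $T$ is concave if $T^{*2}T^2-2T^*T+I\le 0$, and a $2$-isometry if $T^{*2}T^2-2T^*T+I=0$. For a $2$-isometry $S$, the covariance is ${\rm cov}(S)=\|\Delta_S\|^{1/2}$. If $\mathcal{H}$ is a closed subspace of $\mathcal{K}$, an operator $S\in\mathcal{B}(\mathcal{K})$ is a lifting of $T$ if $P_{\mathcal{H}}S=TP_{\mathcal{H}}$ (equivalently $\mathcal{H}$ is invariant for $S^*$ and $S^*|_{\mathcal{H}}=T^*$). A lifting $S$ is minimal if $\mathcal{K}=\bigvee_{n\ge0}S^n\mathcal{H}$ (closed linear span). *)

theory Defs
  imports Complex_Main
begin

text \<open>Abstract complex inner product spaces, given by a carrier set together with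
  the vector space operations and a complex inner product (linear in the first
  argument). Operators are functions; only their values on carriers matter.\<close>

record 'v cips =
  hcar   :: "'v set"
  hadd   :: "'v \<Rightarrow> 'v \<Rightarrow> 'v"
  hscale :: "complex \<Rightarrow> 'v \<Rightarrow> 'v"
  hzero  :: "'v"
  hinner :: "'v \<Rightarrow> 'v \<Rightarrow> complex"

definition hsub :: "'v cips \<Rightarrow> 'v \<Rightarrow> 'v \<Rightarrow> 'v" where
  "hsub V x y = hadd V x (hscale V (-1) y)"

definition hnorm :: "'v cips \<Rightarrow> 'v \<Rightarrow> real" where
  "hnorm V x = sqrt (Re (hinner V x x))"

definition hilbert_space :: "'v cips \<Rightarrow> bool" where
  "hilbert_space V \<longleftrightarrow>
     (let C = hcar V in
      hzero V \<in> C \<and>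
      (\<forall>x\<in>C. \<forall>y\<in>C. hadd V x y \<in> C) \<and>
      (\<forall>a. \<forall>x\<in>C. hscale V a x \<in> C) \<and>
      (\<forall>x\<in>C. \<forall>y\<in>C. \<forall>z\<in>C. hadd V (hadd V x y) z = hadd V x (hadd V y z)) \<and>
      (\<forall>x\<in>C. \<forall>y\<in>C. hadd V x y = hadd V y x) \<and>
      (\<forall>x\<in>C. hadd V x (hzero V) = x) \<and>
      (\<forall>x\<in>C. hadd V x (hscale V (-1) x) = hzero V) \<and>
      (\<forall>a b. \<forall>x\<in>C. hscale V a (hscale V b x) = hscale V (a * b) x) \<and>
      (\<forall>x\<in>C. hscale V 1 x = x) \<and>
      (\<forall>a. \<forall>x\<in>C. \<forall>y\<in>C. hscale V a (hadd V x y) = hadd V (hscale V a x) (hscale V a y)) \<and>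
      (\<forall>a b. \<forall>x\<in>C. hscale V (a + b) x = hadd V (hscale V a x) (hscale V b x)) \<and>
      (\<forall>x\<in>C. \<forall>y\<in>C. hinner V y x = cnj (hinner V x y)) \<and>
      (\<forall>x\<in>C. \<forall>y\<in>C. \<forall>z\<in>C. hinner V (hadd V x y) z = hinner V x z + hinner V y z) \<and>
      (\<forall>a. \<forall>x\<in>C. \<forall>y\<in>C. hinner V (hscale V a x) y = a * hinner V x y) \<and>
      (\<forall>x\<in>C. 0 \<le> Re (hinner V x x)) \<and>
      (\<forall>x\<in>C. hinner V x x = 0 \<longrightarrow> x = hzero V) \<and>
      (\<forall>f. (\<forall>n. f n \<in> C) \<and>
           (\<forall>e>0. \<exists>N. \<forall>m\<ge>N. \<forall>n\<ge>N. hnorm V (hsub V (f m) (f n)) < e)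
           \<longrightarrow> (\<exists>l\<in>C. (\<lambda>n. hnorm V (hsub V (f n) l)) \<longlonglongrightarrow> 0)))"

definition bop :: "'v cips \<Rightarrow> 'w cips \<Rightarrow> ('v \<Rightarrow> 'w) \<Rightarrow> bool" where
  "bop V W A \<longleftrightarrow>
     (\<forall>x\<in>hcar V. A x \<in> hcar W) \<and>
     (\<forall>x\<in>hcar V. \<forall>y\<in>hcar V. A (hadd V x y) = hadd W (A x) (A y)) \<and>
     (\<forall>a. \<forall>x\<in>hcar V. A (hscale V a x) = hscale W a (A x)) \<and>
     (\<exists>c. \<forall>x\<in>hcar V. hnorm W (A x) \<le> c * hnorm V x)"

definition opnorm :: "'v cips \<Rightarrow> 'w cips \<Rightarrow> ('v \<Rightarrow> 'w) \<Rightarrow> real" where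
  "opnorm V W A = Sup ((\<lambda>x. hnorm W (A x)) ` {x \<in> hcar V. hnorm V x \<le> 1})"

text \<open>Hilbert space adjoint (unique on the carrier for bounded operators between
  Hilbert spaces).\<close>
definition hadj :: "'v cips \<Rightarrow> 'w cips \<Rightarrow> ('v \<Rightarrow> 'w) \<Rightarrow> ('w \<Rightarrow> 'v)" where
  "hadj V W A = (SOME B. bop W V B \<and>
      (\<forall>x\<in>hcar V. \<forall>y\<in>hcar W. hinner W (A x) y = hinner V x (B y)))"

definition isometry :: "'v cips \<Rightarrow> 'w cips \<Rightarrow> ('v \<Rightarrow> 'w) \<Rightarrow> bool" where
  "isometry V W A \<longleftrightarrow> bop V W A \<and> (\<forall>x\<in>hcar V. hnorm W (A x) = hnorm V x)"

definition twoiso_op :: "'v cips \<Rightarrow> ('v \<Rightarrow> 'v) \<Rightarrow> 'v \<Rightarrow> 'v" where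
  "twoiso_op V T x =
     hadd V (hsub V (hadj V V T (hadj V V T (T (T x))))
                    (hscale V 2 (hadj V V T (T x)))) x"

definition op_nonpos :: "'v cips \<Rightarrow> ('v \<Rightarrow> 'v) \<Rightarrow> bool" where
  "op_nonpos V A \<longleftrightarrow> (\<forall>x\<in>hcar V. Im (hinner V (A x) x) = 0 \<and> Re (hinner V (A x) x) \<le> 0)"

definition concave_op :: "'v cips \<Rightarrow> ('v \<Rightarrow> 'v) \<Rightarrow> bool" where
  "concave_op V T \<longleftrightarrow> bop V V T \<and> op_nonpos V (twoiso_op V T)"

definition two_isometry :: "'v cips \<Rightarrow> ('v \<Rightarrow> 'v) \<Rightarrow> bool" where
  "two_isometry V S \<longleftrightarrow> bop V V S \<and> (\<forall>x\<in>hcar V. twoiso_op V S x = hzero V)"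

definition Delta :: "'v cips \<Rightarrow> ('v \<Rightarrow> 'v) \<Rightarrow> 'v \<Rightarrow> 'v" where
  "Delta V T x = hsub V (hadj V V T (T x)) x"

definition cov :: "'v cips \<Rightarrow> ('v \<Rightarrow> 'v) \<Rightarrow> real" where
  "cov V S = sqrt (opnorm V V (Delta V S))"

definition closed_subspace :: "'v cips \<Rightarrow> 'v set \<Rightarrow> bool" where
  "closed_subspace V L \<longleftrightarrow> L \<subseteq> hcar V \<and> hzero V \<in> L \<and>
     (\<forall>x\<in>L. \<forall>y\<in>L. hadd V x y \<in> L) \<and> (\<forall>a. \<forall>x\<in>L. hscale V a x \<in> L) \<and>
     (\<forall>f l. (\<forall>n. f n \<in> L) \<and> l \<in> hcar V \<and> (\<lambda>n. hnorm V (hsub V (f n) l)) \<longlonglongrightarrow> 0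
            \<longrightarrow> l \<in> L)"

definition closed_span :: "'v cips \<Rightarrow> 'v set \<Rightarrow> 'v set" where
  "closed_span V M = \<Inter> {L. closed_subspace V L \<and> M \<subseteq> L}"

text \<open>Unilateral shift (Halmos): an isometry S for which there is a wandering
  subspace L, i.e. the spaces \<open>S^n L\<close> are mutually orthogonal and V is their
  orthogonal sum \<open>\<Oplus>_{n\<ge>0} S^n L\<close>.\<close>
definition unilateral_shift :: "'v cips \<Rightarrow> ('v \<Rightarrow> 'v) \<Rightarrow> bool" where
  "unilateral_shift V S \<longleftrightarrow> isometry V V S \<and>
     (\<exists>L. closed_subspace V L \<and>
          (\<forall>m n. m \<noteq> n \<longrightarrow> (\<forall>x\<in>L. \<forall>y\<in>L. hinner V ((S^^m) x) ((S^^n) y) = 0)) \<and>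
          closed_span V (\<Union>n. (S^^n) ` L) = hcar V)"

definition dsum :: "'a cips \<Rightarrow> 'b cips \<Rightarrow> ('a \<times> 'b) cips" where
  "dsum A B = \<lparr> hcar = hcar A \<times> hcar B,
      hadd = (\<lambda>(a, b) (c, d). (hadd A a c, hadd B b d)),
      hscale = (\<lambda>s (a, b). (hscale A s a, hscale B s b)),
      hzero = (hzero A, hzero B),
      hinner = (\<lambda>(a, b) (c, d). hinner A a c + hinner B b d) \<rparr>"

definition upper_blk :: "'a cips \<Rightarrow> ('a \<Rightarrow> 'a) \<Rightarrow> ('b \<Rightarrow> 'a) \<Rightarrow> ('b \<Rightarrow> 'b) \<Rightarrow> 'a \<times> 'b \<Rightarrow> 'a \<times> 'b" where
  "upper_blk A P Q R = (\<lambda>(x, y). (hadd A (P x) (Q y), R y))"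

text \<open>S on \<open>K = G \<oplus> H\<close> (H identified with \<open>{0} \<times> H\<close>, G = \<open>H\<^sup>\<perp>\<close>) is a lifting of T:
  \<open>P_H S = T P_H\<close>.\<close>
definition is_lifting :: "'g cips \<Rightarrow> 'h cips \<Rightarrow> ('g \<times> 'h \<Rightarrow> 'g \<times> 'h) \<Rightarrow> ('h \<Rightarrow> 'h) \<Rightarrow> bool" where
  "is_lifting G H S T \<longleftrightarrow>
     (\<forall>g\<in>hcar G. \<forall>h\<in>hcar H. (hzero G, snd (S (g, h))) = (hzero G, T h))"

definition minimal_lifting :: "'g cips \<Rightarrow> 'h cips \<Rightarrow> ('g \<times> 'h \<Rightarrow> 'g \<times> 'h) \<Rightarrow> ('h \<Rightarrow> 'h) \<Rightarrow> bool" where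
  "minimal_lifting G H S T \<longleftrightarrow> is_lifting G H S T \<and>
     closed_span (dsum G H) (\<Union>n. (S^^n) ` ({hzero G} \<times> hcar H)) = hcar (dsum G H)"

text \<open>Fixed carrier type for the auxiliary spaces (large enough for all
  countable constructions over H, e.g. \<open>\<ell>\<^sup>2_+(D)\<close> with D built from H).\<close>
type_synonym 'a bigT = "nat \<Rightarrow> 'a \<times> complex"

end

theory Submission
  imports Defs
begin

text \<open>Write \<open>\<Delta> x y = \<langle>T x, T y\<rangle> - \<langle>x, y\<rangle>\<close>. Concavity makes \<open>n \<mapsto> \<parallel>T\<^sup>n x\<parallel>\<^sup>2\<close> a concave nonnegative
  sequence, hence increasing, so \<open>\<Delta> \<ge> 0\<close>, and \<open>\<Delta> \<circ> T \<le> \<Delta>\<close>. All auxiliary spaces live in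
  \<open>E = \<ell>\<^sup>2 (H \<oplus> \<complex>)\<close>: every bounded positive form on \<open>H\<close> is \<open>\<langle>R x, R y\<rangle>\<close> for some bounded
  \<open>R : H \<rightarrow> E\<close>, and moving coordinates along disjoint arithmetic progressions gives shifts and
  isometries of \<open>E\<close> with orthogonal ranges.

  For (i), \<open>X = (X\<^sub>1, X\<^sub>0)\<close> with \<open>\<parallel>X\<^sub>1 h\<parallel>\<^sup>2 = \<Delta> (T h)\<close> and \<open>\<parallel>X\<^sub>0 h\<parallel>\<^sup>2 = \<Delta> h - \<Delta> (T h)\<close>, all ranges being
  orthogonal; then \<open>\<Delta>\<^sub>S = 0 \<oplus> 2 I \<oplus> 2 \<Delta>\<close> is invariant under \<open>S\<close>.

  For (ii), if \<open>W\<close> is an isometry and \<open>W\<^sup>* X = 0\<close>, then \<open>\<Delta>\<^sub>S = 0 \<oplus> q\<close> with \<open>q = \<Delta> + X\<^sup>* X\<close>, so one needs a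
  form \<open>q\<close> with \<open>\<Delta> \<le> q \<le> c = \<parallel>\<Delta>\<parallel>\<close> and \<open>q \<circ> T = q\<close>. It is the increasing limit of forms with \<open>q\<^sub>0 = \<Delta>\<close> and
  \<open>q\<^sub>n\<^sub>+\<^sub>1 \<circ> T = q\<^sub>n\<close>, where \<open>c - q\<^sub>n\<^sub>+\<^sub>1\<close> is obtained by extending the form \<open>T x \<mapsto> c \<parallel>T x\<parallel>\<^sup>2 - q\<^sub>n x\<close> from the
  range of \<open>T\<close> to \<open>H\<close> below \<open>c - q\<^sub>n\<close>.\<close>

section \<open>Inner product spaces and forms\<close>

text \<open>Part (i): with W as prescribed, \<Delta> of W is 0 \<oplus> 2, the 2 being the square of
  the coefficient of \<open>E0\<close>. If r denotes \<Delta> plus the form of \<open>X^* X\<close>,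
  then \<Delta> of S is 0 \<oplus> 2 \<oplus> r, and its invariance asks that r - r \<circ> T be
  twice the form of X0. The solution r = 2 \<Delta> dictates both norms in the overview and is the
  source of the factor sqrt 2 in front of the norm of \<Delta>. Part (ii): the forms \<Delta>
  \<circ> T^n also converge to an invariant form, but that limit lies below \<Delta>, whereas q -
  \<Delta> has to be the positive form of X. So q must grow, that is, it has to be carried backwards
  from the range of T. Extending c - q_n instead of q_n lets a single extension result do both jobs:
  domination by c - q_n becomes q_{n+1} \<ge> q_n, and positivity becomes q_{n+1} \<le> c. The lower
  bound q \<ge> \<Delta> then makes the covariance equal to the square root of c.\<close>

definition hsq :: "'v cips \<Rightarrow> 'v \<Rightarrow> real" where
  "hsq V x = Re (hinner V x x)"

text \<open>Completeness is split off into \<open>complete_space\<close> because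
  \<open>positive_form_extension\<close> treats an arbitrary linear subspace as a space of its own,
  and because direct sums and \<open>ell2\<close> become inner product spaces before their limits
  are studied.\<close>

locale inner_space =
  fixes V :: "'v cips"
  assumes zero_closed [simp, intro]: "hzero V \<in> hcar V"
    and add_closed [simp, intro]: "x \<in> hcar V \<Longrightarrow> y \<in> hcar V \<Longrightarrow> hadd V x y \<in> hcar V"
    and scale_closed [simp, intro]: "x \<in> hcar V \<Longrightarrow> hscale V a x \<in> hcar V"
    and add_assoc: "x \<in> hcar V \<Longrightarrow> y \<in> hcar V \<Longrightarrow> z \<in> hcar V \<Longrightarrow>
        hadd V (hadd V x y) z = hadd V x (hadd V y z)"
    and add_comm: "x \<in> hcar V \<Longrightarrow> y \<in> hcar V \<Longrightarrow> hadd V x y = hadd V y x"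
    and add_zero [simp]: "x \<in> hcar V \<Longrightarrow> hadd V x (hzero V) = x"
    and add_neg: "x \<in> hcar V \<Longrightarrow> hadd V x (hscale V (-1) x) = hzero V"
    and scale_scale: "x \<in> hcar V \<Longrightarrow> hscale V a (hscale V b x) = hscale V (a * b) x"
    and scale_one: "x \<in> hcar V \<Longrightarrow> hscale V 1 x = x"
    and scale_add_right: "x \<in> hcar V \<Longrightarrow> y \<in> hcar V \<Longrightarrow>
        hscale V a (hadd V x y) = hadd V (hscale V a x) (hscale V a y)"
    and scale_add_left: "x \<in> hcar V \<Longrightarrow> hscale V (a + b) x = hadd V (hscale V a x) (hscale V b x)"
    and inner_cnj: "x \<in> hcar V \<Longrightarrow> y \<in> hcar V \<Longrightarrow> hinner V y x = cnj (hinner V x y)"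
    and inner_add_left [simp]: "x \<in> hcar V \<Longrightarrow> y \<in> hcar V \<Longrightarrow> z \<in> hcar V \<Longrightarrow>
        hinner V (hadd V x y) z = hinner V x z + hinner V y z"
    and inner_scale_left [simp]: "x \<in> hcar V \<Longrightarrow> y \<in> hcar V \<Longrightarrow>
        hinner V (hscale V a x) y = a * hinner V x y"
    and inner_nonneg: "x \<in> hcar V \<Longrightarrow> 0 \<le> Re (hinner V x x)"
    and inner_definite: "x \<in> hcar V \<Longrightarrow> hinner V x x = 0 \<Longrightarrow> x = hzero V"

locale complete_space = inner_space +
  assumes complete: "(\<And>n. f n \<in> hcar V) \<Longrightarrow>
     (\<And>e. e > 0 \<Longrightarrow> \<exists>N. \<forall>m\<ge>N. \<forall>n\<ge>N. hnorm V (hsub V (f m) (f n)) < e) \<Longrightarrow>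
     \<exists>l\<in>hcar V. (\<lambda>n. hnorm V (hsub V (f n) l)) \<longlonglongrightarrow> 0"

lemma hilbert_space_iff: "hilbert_space V \<longleftrightarrow> complete_space V"
proof
  assume "hilbert_space V"
  note c0 = this[unfolded hilbert_space_def Let_def]
  note c1 = c0[THEN conjunct2]
  note c2 = c1[THEN conjunct2]
  note c3 = c2[THEN conjunct2]
  note c4 = c3[THEN conjunct2]
  note c5 = c4[THEN conjunct2]
  note c6 = c5[THEN conjunct2]
  note c7 = c6[THEN conjunct2]
  note c8 = c7[THEN conjunct2]
  note c9 = c8[THEN conjunct2]
  note c10 = c9[THEN conjunct2]
  note c11 = c10[THEN conjunct2]
  note c12 = c11[THEN conjunct2]
  note c13 = c12[THEN conjunct2]
  note c14 = c13[THEN conjunct2]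
  note c15 = c14[THEN conjunct2]
  note c16 = c15[THEN conjunct2]
  show "complete_space V"
    apply unfold_locales
    subgoal by (rule c0[THEN conjunct1, rule_format])
    subgoal by (rule c1[THEN conjunct1, rule_format])
    subgoal by (rule c2[THEN conjunct1, rule_format])
    subgoal by (rule c3[THEN conjunct1, rule_format])
    subgoal by (rule c4[THEN conjunct1, rule_format])
    subgoal by (rule c5[THEN conjunct1, rule_format])
    subgoal by (rule c6[THEN conjunct1, rule_format])
    subgoal by (rule c7[THEN conjunct1, rule_format])
    subgoal by (rule c8[THEN conjunct1, rule_format])
    subgoal by (rule c9[THEN conjunct1, rule_format])
    subgoal by (rule c10[THEN conjunct1, rule_format])
    subgoal by (rule c11[THEN conjunct1, rule_format])
    subgoal by (rule c12[THEN conjunct1, rule_format])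
    subgoal by (rule c13[THEN conjunct1, rule_format])
    subgoal by (rule c14[THEN conjunct1, rule_format])
    subgoal by (rule c15[THEN conjunct1, rule_format])
    subgoal by (rule c16[rule_format]) blast
    done
next
  assume "complete_space V"
  then interpret complete_space V .
  show "hilbert_space V"
    unfolding hilbert_space_def Let_def
    apply (intro conjI)
    subgoal by simp
    subgoal by simp
    subgoal by simp
    subgoal by (simp add: add_assoc)
    subgoal by (simp add: add_comm)
    subgoal by simp
    subgoal by (simp add: add_neg)
    subgoal by (simp add: scale_scale)
    subgoal by (simp add: scale_one)
    subgoal by (simp add: scale_add_right)
    subgoal by (simp add: scale_add_left)
    subgoal using inner_cnj by blast
    subgoal by simp
    subgoal by simp
    subgoal by (simp add: inner_nonneg)
    subgoal by (simp add: inner_definite)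
    subgoal using complete by blast
    done
qed

text \<open>Forms stand in for self-adjoint operators: sums, limits and composition with T are
  pointwise, order is a comparison of diagonals, and no adjoint has to be chosen. Conjugate
  linearity in the second argument comes from symmetry, in \<open>form_expand\<close>.\<close>

definition hermitian_form :: "'v cips \<Rightarrow> ('v \<Rightarrow> 'v \<Rightarrow> complex) \<Rightarrow> bool" where
  "hermitian_form V a \<longleftrightarrow>
     (\<forall>x\<in>hcar V. \<forall>y\<in>hcar V. \<forall>z\<in>hcar V. a (hadd V x y) z = a x z + a y z) \<and>
     (\<forall>s. \<forall>x\<in>hcar V. \<forall>y\<in>hcar V. a (hscale V s x) y = s * a x y) \<and>
     (\<forall>x\<in>hcar V. \<forall>y\<in>hcar V. a y x = cnj (a x y))"

definition positive_form :: "'v cips \<Rightarrow> ('v \<Rightarrow> 'v \<Rightarrow> complex) \<Rightarrow> bool" where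
  "positive_form V a \<longleftrightarrow> hermitian_form V a \<and> (\<forall>x\<in>hcar V. 0 \<le> Re (a x x))"

definition linear_subspace :: "'v cips \<Rightarrow> 'v set \<Rightarrow> bool" where
  "linear_subspace V L \<longleftrightarrow> L \<subseteq> hcar V \<and> hzero V \<in> L \<and>
     (\<forall>x\<in>L. \<forall>y\<in>L. hadd V x y \<in> L) \<and> (\<forall>a. \<forall>x\<in>L. hscale V a x \<in> L)"

text \<open>For B > 0 the quadratic is evaluated at its minimum s = 1/B; for B = 0 it is affine with
  slope -2w and would become negative unless w = 0. The factor w also sits in the quadratic
  coefficient because the test vectors below move by s times a number of squared modulus w.\<close>

lemma quadratic_discriminant:
  fixes w B d :: real
  assumes "w \<ge> 0" "B \<ge> 0" and q: "\<And>s. 0 \<le> d - 2 * s * w + s\<^sup>2 * w * B"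
  shows "w \<le> d * B"
proof (cases "w = 0")
  case True
  then show ?thesis using q[of 0] \<open>B \<ge> 0\<close> by simp
next
  case w: False
  show ?thesis
  proof (cases "B = 0")
    case True
    then show ?thesis using q[of "(d + 1) / (2 * w)"] w by (simp add: field_simps)
  next
    case False
    then have "d - 2 * (1/B) * w + (1/B)\<^sup>2 * w * B = d - w / B"
      by (simp add: field_simps power2_eq_square)
    then have "w / B \<le> d" using q[of "1/B"] by linarith
    then show ?thesis using False \<open>B \<ge> 0\<close> by (simp add: pos_divide_le_eq)
  qed
qed

lemma tendsto_zero_comparison:
  fixes f :: "nat \<Rightarrow> 'a::real_normed_vector"
  assumes "\<And>n. norm (f n) \<le> g n" "g \<longlonglongrightarrow> 0"
  shows "f \<longlonglongrightarrow> 0"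
  by (rule tendsto_norm_zero_cancel, rule tendsto_sandwich[OF _ _ tendsto_const assms(2)])
     (use assms(1) in auto)

section \<open>Geometry of an inner product space and of positive forms on it\<close>

context inner_space
begin

lemma inner_add_right [simp]:
  "x \<in> hcar V \<Longrightarrow> y \<in> hcar V \<Longrightarrow> z \<in> hcar V \<Longrightarrow>
     hinner V z (hadd V x y) = hinner V z x + hinner V z y"
  using inner_cnj[of "hadd V x y" z] inner_cnj[of x z] inner_cnj[of y z] by simp

lemma inner_scale_right [simp]:
  "x \<in> hcar V \<Longrightarrow> y \<in> hcar V \<Longrightarrow> hinner V y (hscale V a x) = cnj a * hinner V y x"
  using inner_cnj[of "hscale V a x" y] inner_cnj[of x y] by simp

lemma sub_closed [simp, intro]: "x \<in> hcar V \<Longrightarrow> y \<in> hcar V \<Longrightarrow> hsub V x y \<in> hcar V"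
  by (simp add: hsub_def)

lemma inner_sub_left [simp]:
  "x \<in> hcar V \<Longrightarrow> y \<in> hcar V \<Longrightarrow> z \<in> hcar V \<Longrightarrow>
     hinner V (hsub V x y) z = hinner V x z - hinner V y z"
  by (simp add: hsub_def)

lemma inner_sub_right [simp]:
  "x \<in> hcar V \<Longrightarrow> y \<in> hcar V \<Longrightarrow> z \<in> hcar V \<Longrightarrow>
     hinner V z (hsub V x y) = hinner V z x - hinner V z y"
  by (simp add: hsub_def)

lemma inner_zero_left [simp]: "x \<in> hcar V \<Longrightarrow> hinner V (hzero V) x = 0"
  using inner_add_left[of "hzero V" "hzero V" x] by simp

lemma inner_zero_right [simp]: "x \<in> hcar V \<Longrightarrow> hinner V x (hzero V) = 0"
  using inner_cnj[of "hzero V" x] by simp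

lemma Im_inner_self [simp]: "x \<in> hcar V \<Longrightarrow> Im (hinner V x x) = 0"
  using arg_cong[OF inner_cnj[of x x], of Im] by simp

lemma inner_self: "x \<in> hcar V \<Longrightarrow> hinner V x x = complex_of_real (hsq V x)"
  by (simp add: hsq_def complex_eq_iff)

lemma hsq_nonneg [simp]: "x \<in> hcar V \<Longrightarrow> 0 \<le> hsq V x"
  by (simp add: hsq_def inner_nonneg)

lemma hnorm_sq: "x \<in> hcar V \<Longrightarrow> (hnorm V x)\<^sup>2 = hsq V x"
  by (simp add: hnorm_def hsq_def inner_nonneg)

lemma hnorm_nonneg [simp]: "x \<in> hcar V \<Longrightarrow> 0 \<le> hnorm V x"
  by (simp add: hnorm_def inner_nonneg)

text \<open>Reduces equations between vectors to equations between complex numbers, which simp can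
  normalise; many vector identities below are proved this way.\<close>

lemma vector_eqI:
  assumes x: "x \<in> hcar V" and y: "y \<in> hcar V"
    and eq: "\<And>z. z \<in> hcar V \<Longrightarrow> hinner V x z = hinner V y z"
  shows "x = y"
proof -
  have "hinner V (hsub V x y) (hsub V x y) = 0"
    using x y eq[of "hsub V x y"] by (simp del: inner_sub_right)
  then have "hsub V x y = hzero V" using x y by (intro inner_definite) auto
  then have z: "hadd V x (hscale V (-1) y) = hzero V" by (simp add: hsub_def)
  have "x = hadd V x (hadd V (hscale V (-1) y) y)"
    using x y add_neg[of y] add_comm[of y "hscale V (-1) y"] by simp
  also have "\<dots> = hadd V (hzero V) y"
    using x y z add_assoc[of x "hscale V (-1) y" y] by simp
  also have "\<dots> = y" using y add_comm[of y "hzero V"] by simp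
  finally show ?thesis .
qed

lemma hsq_eq_0: "x \<in> hcar V \<Longrightarrow> hsq V x = 0 \<Longrightarrow> x = hzero V"
  by (rule inner_definite) (simp_all add: inner_self)

lemma hsq_zero [simp]: "hsq V (hzero V) = 0"
  by (simp add: hsq_def)

lemma hnorm_zero [simp]: "hnorm V (hzero V) = 0"
  by (simp add: hnorm_def)

lemma hsq_scale:
  assumes "x \<in> hcar V"
  shows "hsq V (hscale V a x) = (cmod a)\<^sup>2 * hsq V x"
proof -
  have "hinner V (hscale V a x) (hscale V a x) = (a * cnj a) * of_real (hsq V x)"
    using assms inner_self[of x] by simp
  also have "\<dots> = of_real ((cmod a)\<^sup>2 * hsq V x)"
    by (simp only: of_real_mult complex_norm_square)
  finally show ?thesis by (simp only: hsq_def Re_complex_of_real)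
qed

lemma hsq_sub_commute: "x \<in> hcar V \<Longrightarrow> y \<in> hcar V \<Longrightarrow> hsq V (hsub V x y) = hsq V (hsub V y x)"
  by (simp add: hsq_def)

lemma hnorm_sub_commute: "x \<in> hcar V \<Longrightarrow> y \<in> hcar V \<Longrightarrow> hnorm V (hsub V x y) = hnorm V (hsub V y x)"
  using hsq_sub_commute by (simp add: hnorm_def hsq_def)

lemma positive_form_inner: "positive_form V (hinner V)"
  unfolding positive_form_def hermitian_form_def
  by (intro conjI ballI allI inner_cnj inner_nonneg) auto

lemma form_expand:
  assumes "hermitian_form V a" "x \<in> hcar V" "y \<in> hcar V" "z \<in> hcar V"
  shows "a (hadd V x y) z = a x z + a y z"
    and "a z (hadd V x y) = a z x + a z y"
    and "a (hscale V s x) y = s * a x y"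
    and "a y (hscale V s x) = cnj s * a y x"
    and "a (hsub V x y) z = a x z - a y z"
    and "a z (hsub V x y) = a z x - a z y"
    and "a x y = cnj (a y x)"
    and "Im (a x x) = 0"
proof -
  have add: "a (hadd V u v) w = a u w + a v w" if "u \<in> hcar V" "v \<in> hcar V" "w \<in> hcar V" for u v w
    using assms(1) that unfolding hermitian_form_def by blast
  have scale: "a (hscale V s u) w = s * a u w" if "u \<in> hcar V" "w \<in> hcar V" for u w s
    using assms(1) that unfolding hermitian_form_def by blast
  have cnj: "a u w = cnj (a w u)" if "u \<in> hcar V" "w \<in> hcar V" for u w
    using assms(1) that unfolding hermitian_form_def by blast
  have addr: "a w (hadd V u v) = a w u + a w v" if "u \<in> hcar V" "v \<in> hcar V" "w \<in> hcar V" for u v w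
    using cnj[of w "hadd V u v"] cnj[of w u] cnj[of w v] add that by simp
  have scaler: "a w (hscale V s u) = cnj s * a w u" if "u \<in> hcar V" "w \<in> hcar V" for u w s
    using cnj[of w "hscale V s u"] cnj[of w u] scale that by simp
  show "a (hadd V x y) z = a x z + a y z" "a z (hadd V x y) = a z x + a z y"
    "a (hscale V s x) y = s * a x y" "a y (hscale V s x) = cnj s * a y x"
    using assms add addr scale scaler by auto
  show "a (hsub V x y) z = a x z - a y z" "a z (hsub V x y) = a z x - a z y"
    unfolding hsub_def using assms add addr scale scaler by auto
  show "a x y = cnj (a y x)" using assms cnj by blast
  show "Im (a x x) = 0" using arg_cong[OF cnj[of x x], of Im] assms(2) by simp
qed

text \<open>Positivity is used at x - s a(x,y) y for real s; the factor a(x,y) turns the linear term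
  into the real number -2 s |a(x,y)|^2. The case a(y,y) = 0, possible for y nonzero, is absorbed by
  \<open>quadratic_discriminant\<close>.\<close>

lemma form_cauchy_schwarz:
  assumes a: "positive_form V a" and x: "x \<in> hcar V" and y: "y \<in> hcar V"
  shows "(cmod (a x y))\<^sup>2 \<le> Re (a x x) * Re (a y y)"
proof (rule quadratic_discriminant)
  have h: "hermitian_form V a" using a by (simp add: positive_form_def)
  show "0 \<le> Re (a y y)" using a y by (simp add: positive_form_def)
  fix s :: real
  let ?w = "a x y"
  let ?z = "hsub V x (hscale V (complex_of_real s * ?w) y)"
  have "a ?z ?z = a x x - cnj (complex_of_real s * ?w) * ?w - complex_of_real s * ?w * cnj ?w
      + (complex_of_real s)\<^sup>2 * (?w * cnj ?w) * a y y"
    using x y form_expand(7)[OF h y x y]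
    by (simp add: form_expand(1-6)[OF h] algebra_simps power2_eq_square)
  also have "\<dots> = a x x - 2 * complex_of_real s * (?w * cnj ?w) + (complex_of_real s)\<^sup>2 * (?w * cnj ?w) * a y y"
    by (simp add: algebra_simps)
  also have "\<dots> = a x x - of_real (2 * s * (cmod ?w)\<^sup>2) + of_real (s\<^sup>2 * (cmod ?w)\<^sup>2) * a y y"
    by (simp only: of_real_mult complex_norm_square of_real_numeral) simp
  finally have "Re (a ?z ?z) = Re (a x x) - 2 * s * (cmod ?w)\<^sup>2 + s\<^sup>2 * (cmod ?w)\<^sup>2 * Re (a y y)"
    by simp
  moreover have "0 \<le> Re (a ?z ?z)" using a x y by (simp add: positive_form_def)
  ultimately show "0 \<le> Re (a x x) - 2 * s * (cmod ?w)\<^sup>2 + s\<^sup>2 * (cmod ?w)\<^sup>2 * Re (a y y)" by simp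
qed simp

lemma cauchy_schwarz_sq:
  "x \<in> hcar V \<Longrightarrow> y \<in> hcar V \<Longrightarrow> (cmod (hinner V x y))\<^sup>2 \<le> hsq V x * hsq V y"
  unfolding hsq_def by (rule form_cauchy_schwarz[OF positive_form_inner])

lemma cauchy_schwarz:
  "x \<in> hcar V \<Longrightarrow> y \<in> hcar V \<Longrightarrow> cmod (hinner V x y) \<le> hnorm V x * hnorm V y"
  by (rule power2_le_imp_le) (simp_all add: power_mult_distrib hnorm_sq cauchy_schwarz_sq)

lemma hsq_add:
  "x \<in> hcar V \<Longrightarrow> y \<in> hcar V \<Longrightarrow> hsq V (hadd V x y) = hsq V x + 2 * Re (hinner V x y) + hsq V y"
  using inner_cnj[of x y] by (simp add: hsq_def)

lemma hnorm_triangle: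
  assumes "x \<in> hcar V" "y \<in> hcar V"
  shows "hnorm V (hadd V x y) \<le> hnorm V x + hnorm V y"
proof (rule power2_le_imp_le)
  have "Re (hinner V x y) \<le> hnorm V x * hnorm V y"
    using cauchy_schwarz[OF assms] complex_Re_le_cmod order_trans by blast
  then show "(hnorm V (hadd V x y))\<^sup>2 \<le> (hnorm V x + hnorm V y)\<^sup>2"
    using assms by (simp add: hnorm_sq hsq_add power2_sum)
qed (use assms in simp)

lemma hnorm_sub_triangle:
  assumes "x \<in> hcar V" "y \<in> hcar V" "z \<in> hcar V"
  shows "hnorm V (hsub V x z) \<le> hnorm V (hsub V x y) + hnorm V (hsub V y z)"
proof -
  have "hsub V x z = hadd V (hsub V x y) (hsub V y z)"
    using assms by (intro vector_eqI) auto
  then show ?thesis using hnorm_triangle[of "hsub V x y" "hsub V y z"] assms by simp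
qed

lemma hnorm_tendsto_0_iff:
  assumes "\<And>n. f n \<in> hcar V"
  shows "(\<lambda>n. hnorm V (f n)) \<longlonglongrightarrow> 0 \<longleftrightarrow> (\<lambda>n. hsq V (f n)) \<longlonglongrightarrow> 0"
proof
  assume "(\<lambda>n. hnorm V (f n)) \<longlonglongrightarrow> 0"
  from tendsto_power[OF this, of 2] show "(\<lambda>n. hsq V (f n)) \<longlonglongrightarrow> 0"
    using assms by (simp add: hnorm_sq)
next
  assume "(\<lambda>n. hsq V (f n)) \<longlonglongrightarrow> 0"
  from tendsto_real_sqrt[OF this] show "(\<lambda>n. hnorm V (f n)) \<longlonglongrightarrow> 0"
    by (simp add: hnorm_def hsq_def)
qed

lemma inner_tendsto_left:
  assumes "\<And>n. f n \<in> hcar V" "l \<in> hcar V" "x \<in> hcar V"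
    and lim: "(\<lambda>n. hnorm V (hsub V (f n) l)) \<longlonglongrightarrow> 0"
  shows "(\<lambda>n. hinner V (f n) x) \<longlonglongrightarrow> hinner V l x"
proof -
  have "(\<lambda>n. hinner V (f n) x - hinner V l x) \<longlonglongrightarrow> 0"
  proof (rule tendsto_zero_comparison)
    show "norm (hinner V (f n) x - hinner V l x) \<le> hnorm V (hsub V (f n) l) * hnorm V x" for n
      using cauchy_schwarz[of "hsub V (f n) l" x] assms by simp
    show "(\<lambda>n. hnorm V (hsub V (f n) l) * hnorm V x) \<longlonglongrightarrow> 0"
      using tendsto_mult_left_zero[OF lim] by simp
  qed
  then show ?thesis by (simp add: LIM_zero_iff)
qed

text \<open>The Riesz vector of \<phi> would minimise J(x) = a(x,x) - 2 Re \<phi>(x) on L. Since a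
  may be degenerate and L incomplete, only near-minimisers \<open>l n\<close> with J within 1/(n+1)
  of the infimum are taken; varying them in a direction x bounds the error of \<phi> x against a(x,
  l n).\<close>

lemma approximate_riesz:
  assumes a: "positive_form V a" and L: "linear_subspace V L"
    and add: "\<And>x y. x \<in> L \<Longrightarrow> y \<in> L \<Longrightarrow> \<phi> (hadd V x y) = \<phi> x + \<phi> y"
    and scale: "\<And>s x. x \<in> L \<Longrightarrow> \<phi> (hscale V s x) = s * \<phi> x"
    and bound: "\<And>x. x \<in> L \<Longrightarrow> (cmod (\<phi> x))\<^sup>2 \<le> C * Re (a x x)" and C: "C \<ge> 0"
  shows "\<exists>l. \<forall>n. l n \<in> L \<and> (\<forall>x\<in>L. (cmod (\<phi> x - a x (l n)))\<^sup>2 \<le> 1 / real (Suc n) * Re (a x x))"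
proof -
  have h: "hermitian_form V a" using a by (simp add: positive_form_def)
  have LV: "L \<subseteq> hcar V" and Lz: "hzero V \<in> L" using L by (auto simp: linear_subspace_def)
  have La: "hadd V x y \<in> L" if "x \<in> L" "y \<in> L" for x y using L that by (auto simp: linear_subspace_def)
  have Ls: "hscale V s x \<in> L" if "x \<in> L" for x s using L that by (auto simp: linear_subspace_def)
  have pos: "0 \<le> Re (a x x)" if "x \<in> L" for x
    using a that LV by (auto simp: positive_form_def)
  define J where "J = (\<lambda>x. Re (a x x) - 2 * Re (\<phi> x))"
  \<comment> \<open>2 Re \<phi>(x) is at most twice the geometric mean of C and a(x,x), hence at
    most their sum.\<close>
  have lower: "- C \<le> J x" if x: "x \<in> L" for x
  proof -
    have "(2 * Re (\<phi> x))\<^sup>2 \<le> 4 * (C * Re (a x x))"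
    proof -
      have "(Re (\<phi> x))\<^sup>2 \<le> (cmod (\<phi> x))\<^sup>2"
        by (rule abs_le_square_iff[THEN iffD1]) (simp add: abs_Re_le_cmod)
      then show ?thesis using bound[OF x] by (simp add: power_mult_distrib)
    qed
    also have "\<dots> \<le> (C + Re (a x x))\<^sup>2"
      using zero_le_power2[of "C - Re (a x x)"] by (simp add: power2_eq_square algebra_simps)
    finally have "2 * Re (\<phi> x) \<le> C + Re (a x x)"
      using C pos[OF x] by (meson abs_le_square_iff abs_le_D1 abs_of_nonneg add_nonneg_nonneg power2_le_imp_le)
    then show ?thesis by (simp add: J_def)
  qed
  define d where "d = Inf (J ` L)"
  have bdd: "bdd_below (J ` L)" using lower by (rule bdd_belowI2)
  have dle: "d \<le> J x" if "x \<in> L" for x unfolding d_def using that bdd by (simp add: cINF_lower)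
  have "\<exists>x\<in>L. J x < d + 1 / real (Suc n)" for n
    using cInf_lessD[of "J ` L" "d + 1 / real (Suc n)"] Lz by (auto simp: d_def)
  then obtain l where l: "\<And>n. l n \<in> L" "\<And>n. J (l n) < d + 1 / real (Suc n)" by metis
  have "(cmod (\<phi> x - a x (l n)))\<^sup>2 \<le> 1 / real (Suc n) * Re (a x x)" if x: "x \<in> L" for x n
  proof (rule quadratic_discriminant)
    show "0 \<le> Re (a x x)" using pos x .
    fix s :: real
    let ?w = "\<phi> x - a x (l n)"
    \<comment> \<open>This phase makes \<open>?t * ?w\<close> the real number s |w|^2, so comparing
      J at \<open>l n\<close> and at \<open>l n\<close> + t x yields exactly the quadratic of
      \<open>quadratic_discriminant\<close>.\<close>
    let ?t = "of_real s * cnj ?w"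
    have xV: "x \<in> hcar V" "l n \<in> hcar V" using x l LV by auto
    have "d \<le> J (hadd V (l n) (hscale V ?t x))" by (intro dle La Ls l x)
    also have "\<dots> = Re (a (l n) (l n) + ?t * a x (l n) + cnj ?t * cnj (a x (l n)) + ?t * cnj ?t * a x x)
        - 2 * Re (\<phi> (l n)) - 2 * Re (?t * \<phi> x)"
      unfolding J_def using xV x l form_expand(7)[OF h xV(2,1,1)]
      by (simp add: form_expand(1-4)[OF h] add scale Ls del: complex_cnj_mult complex_cnj_diff)
         (simp add: algebra_simps)
    also have "?t * cnj ?t = of_real (s\<^sup>2 * (cmod ?w)\<^sup>2)"
      by (simp only: of_real_mult complex_norm_square) (simp add: power2_eq_square)
    also have "Re (a (l n) (l n) + ?t * a x (l n) + cnj ?t * cnj (a x (l n)) + of_real (s\<^sup>2 * (cmod ?w)\<^sup>2) * a x x)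
        - 2 * Re (\<phi> (l n)) - 2 * Re (?t * \<phi> x)
      = J (l n) - 2 * Re (?t * ?w) + s\<^sup>2 * (cmod ?w)\<^sup>2 * Re (a x x)"
      by (simp add: J_def algebra_simps)
    also have "?t * ?w = of_real (s * (cmod ?w)\<^sup>2)"
      by (simp only: of_real_mult complex_norm_square) simp
    finally show "0 \<le> 1 / real (Suc n) - 2 * s * (cmod ?w)\<^sup>2 + s\<^sup>2 * (cmod ?w)\<^sup>2 * Re (a x x)"
      using l(2)[of n] by simp
  qed simp
  then show ?thesis using l by blast
qed

lemma linear_subspace_carrier: "linear_subspace V (hcar V)"
  by (simp add: linear_subspace_def)

end

context complete_space
begin

text \<open>The approximate Riesz vectors form a Cauchy sequence: for d = l_m - l_n, the square of
  ||d|| is the difference of the two errors of \<phi> at d, hence at most (\<epsilon>_m +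
  \<epsilon>_n) ||d||. Completeness supplies the limit.\<close>

lemma riesz:
  assumes add: "\<And>x y. x \<in> hcar V \<Longrightarrow> y \<in> hcar V \<Longrightarrow> \<phi> (hadd V x y) = \<phi> x + \<phi> y"
    and scale: "\<And>s x. x \<in> hcar V \<Longrightarrow> \<phi> (hscale V s x) = s * \<phi> x"
    and bound: "\<And>x. x \<in> hcar V \<Longrightarrow> cmod (\<phi> x) \<le> C * hnorm V x"
  shows "\<exists>u\<in>hcar V. \<forall>x\<in>hcar V. \<phi> x = hinner V x u"
proof -
  have "(cmod (\<phi> x))\<^sup>2 \<le> C\<^sup>2 * Re (hinner V x x)" if "x \<in> hcar V" for x
    using power_mono[OF bound[OF that], of 2] that hnorm_sq[OF that] by (simp add: power_mult_distrib hsq_def)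
  then obtain l where l: "\<And>n. l n \<in> hcar V"
    and b: "\<And>n x. x \<in> hcar V \<Longrightarrow> (cmod (\<phi> x - hinner V x (l n)))\<^sup>2 \<le> 1 / real (Suc n) * hsq V x"
    using approximate_riesz[OF positive_form_inner linear_subspace_carrier add scale, of "C\<^sup>2"]
    by (auto simp: hsq_def)
  define \<epsilon> where "\<epsilon> = (\<lambda>n. sqrt (1 / real (Suc n)))"
  have \<epsilon>0: "\<epsilon> \<longlonglongrightarrow> 0"
    using tendsto_real_sqrt[OF LIMSEQ_inverse_real_of_nat] by (simp add: \<epsilon>_def divide_inverse)
  have b': "cmod (\<phi> x - hinner V x (l n)) \<le> \<epsilon> n * hnorm V x" if "x \<in> hcar V" for n x
    using real_sqrt_le_mono[OF b[OF that, of n]] that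
    by (simp add: \<epsilon>_def real_sqrt_mult real_sqrt_divide hnorm_def hsq_def)
  have dist: "hnorm V (hsub V (l m) (l n)) \<le> \<epsilon> m + \<epsilon> n" for m n
  proof -
    let ?d = "hsub V (l m) (l n)"
    have d: "?d \<in> hcar V" using l by simp
    have "(hnorm V ?d)\<^sup>2 = cmod (hinner V ?d ?d)" using d by (simp add: hnorm_sq inner_self)
    also have "hinner V ?d ?d = (\<phi> ?d - hinner V ?d (l n)) - (\<phi> ?d - hinner V ?d (l m))"
      using l d by (simp del: inner_sub_left)
    also have "cmod \<dots> \<le> \<epsilon> n * hnorm V ?d + \<epsilon> m * hnorm V ?d"
      using norm_triangle_ineq4 b'[OF d, of n] b'[OF d, of m] by (smt (verit))
    finally have "hnorm V ?d * hnorm V ?d \<le> (\<epsilon> m + \<epsilon> n) * hnorm V ?d"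
      by (simp add: power2_eq_square algebra_simps)
    moreover have "0 \<le> \<epsilon> m + \<epsilon> n" by (simp add: \<epsilon>_def)
    ultimately show ?thesis
      using hnorm_nonneg[OF d] by (cases "hnorm V ?d = 0") auto
  qed
  have "\<exists>N. \<forall>m\<ge>N. \<forall>n\<ge>N. hnorm V (hsub V (l m) (l n)) < e" if "e > 0" for e
  proof -
    obtain N where "\<forall>n\<ge>N. \<epsilon> n < e / 2"
      using order_tendstoD(2)[OF \<epsilon>0, of "e/2"] \<open>e > 0\<close> by (auto simp: eventually_sequentially)
    then show ?thesis using dist by (intro exI[of _ N]) (smt (verit) field_sum_of_halves)
  qed
  then obtain u where u: "u \<in> hcar V" "(\<lambda>n. hnorm V (hsub V (l n) u)) \<longlonglongrightarrow> 0"
    using complete[of l] l by blast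
  have "\<phi> x = hinner V x u" if x: "x \<in> hcar V" for x
  proof -
    have "(\<lambda>n. hinner V x (l n)) \<longlonglongrightarrow> hinner V x u"
      using tendsto_cnj[OF inner_tendsto_left[OF l u(1) x u(2)]] l u x
      by (simp flip: inner_cnj)
    moreover have "(\<lambda>n. hinner V x (l n)) \<longlonglongrightarrow> \<phi> x"
    proof -
      have "(\<lambda>n. \<phi> x - hinner V x (l n)) \<longlonglongrightarrow> 0"
        using b'[OF x] tendsto_mult_left_zero[OF \<epsilon>0] by (rule tendsto_zero_comparison)
      from tendsto_diff[OF tendsto_const[of "\<phi> x"] this] show ?thesis by simp
    qed
    ultimately show ?thesis using LIMSEQ_unique by blast
  qed
  then show ?thesis using u by blast
qed

end

section \<open>Bounded operators and adjoints\<close>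

lemma bopD:
  assumes "bop V W A" "x \<in> hcar V"
  shows "A x \<in> hcar W" and "y \<in> hcar V \<Longrightarrow> A (hadd V x y) = hadd W (A x) (A y)"
    and "A (hscale V s x) = hscale W s (A x)"
  using assms by (auto simp: bop_def)

lemma bop_sub:
  assumes "bop V W A" "inner_space V" "x \<in> hcar V" "y \<in> hcar V"
  shows "A (hsub V x y) = hsub W (A x) (A y)"
  using assms by (simp add: hsub_def bopD inner_space.scale_closed)

lemma bop_zero:
  assumes "bop V W A" "inner_space V" "inner_space W"
  shows "A (hzero V) = hzero W"
proof -
  interpret V: inner_space V by fact
  interpret W: inner_space W by fact
  have "hsub V (hzero V) (hzero V) = hzero V" by (intro V.vector_eqI) auto
  then have "A (hzero V) = hsub W (A (hzero V)) (A (hzero V))"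
    using bop_sub[OF assms(1,2), of "hzero V" "hzero V"] by simp
  also have "\<dots> = hzero W" using bopD(1)[OF assms(1), of "hzero V"] by (intro W.vector_eqI) auto
  finally show ?thesis .
qed

text \<open>The bound is required for squared norms, which add up in direct sums and come straight
  from form inequalities; the square root is taken once, here.\<close>

lemma bopI:
  assumes "inner_space V" "inner_space W"
    and "\<And>x. x \<in> hcar V \<Longrightarrow> A x \<in> hcar W"
    and "\<And>x y. x \<in> hcar V \<Longrightarrow> y \<in> hcar V \<Longrightarrow> A (hadd V x y) = hadd W (A x) (A y)"
    and "\<And>s x. x \<in> hcar V \<Longrightarrow> A (hscale V s x) = hscale W s (A x)"
    and "\<And>x. x \<in> hcar V \<Longrightarrow> hsq W (A x) \<le> c * hsq V x"
  shows "bop V W A"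
proof -
  have "hnorm W (A x) \<le> sqrt c * hnorm V x" if "x \<in> hcar V" for x
    using real_sqrt_le_mono[OF assms(6)[OF that]] by (simp add: hnorm_def hsq_def real_sqrt_mult)
  then show ?thesis unfolding bop_def using assms(3-5) by blast
qed

lemma bop_bound:
  assumes "bop V W A" "inner_space V"
  obtains c where "c \<ge> 0" "\<And>x. x \<in> hcar V \<Longrightarrow> hnorm W (A x) \<le> c * hnorm V x"
proof -
  obtain c where c: "\<And>x. x \<in> hcar V \<Longrightarrow> hnorm W (A x) \<le> c * hnorm V x"
    using assms(1) unfolding bop_def by blast
  have "hnorm W (A x) \<le> max c 0 * hnorm V x" if "x \<in> hcar V" for x
    using c[OF that] inner_space.hnorm_nonneg[OF assms(2) that]
    by (meson max.cobounded1 mult_right_mono order_trans)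
  then show ?thesis using that[of "max c 0"] by simp
qed

lemma bop_bound_sq:
  assumes "bop V W A" "inner_space V" "inner_space W"
  obtains c where "c \<ge> 0" "\<And>x. x \<in> hcar V \<Longrightarrow> hsq W (A x) \<le> c * hsq V x"
proof -
  obtain c where c: "c \<ge> 0" "\<And>x. x \<in> hcar V \<Longrightarrow> hnorm W (A x) \<le> c * hnorm V x"
    using bop_bound[OF assms(1,2)] by blast
  have "hsq W (A x) \<le> c\<^sup>2 * hsq V x" if "x \<in> hcar V" for x
  proof -
    have "A x \<in> hcar W" using assms(1) that by (rule bopD)
    then show ?thesis
      using power_mono[OF c(2)[OF that], of 2] that
        inner_space.hnorm_sq[OF assms(2) that] inner_space.hnorm_sq[OF assms(3), of "A x"]
        inner_space.hnorm_nonneg[OF assms(3), of "A x"] by (simp add: power_mult_distrib)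
  qed
  then show ?thesis using that[of "c\<^sup>2"] by simp
qed

lemma bop_compose:
  assumes "bop U V A" "bop V W B" "inner_space U" "inner_space V" "inner_space W"
  shows "bop U W (\<lambda>x. B (A x))"
proof -
  obtain c where c: "c \<ge> 0" "\<And>x. x \<in> hcar U \<Longrightarrow> hsq V (A x) \<le> c * hsq U x"
    using bop_bound_sq[OF assms(1,3,4)] by blast
  obtain d where d: "d \<ge> 0" "\<And>x. x \<in> hcar V \<Longrightarrow> hsq W (B x) \<le> d * hsq V x"
    using bop_bound_sq[OF assms(2,4,5)] by blast
  show ?thesis
  proof (rule bopI[OF assms(3,5), where c = "d * c"])
    fix x assume x: "x \<in> hcar U"
    have "hsq W (B (A x)) \<le> d * hsq V (A x)" using d x assms(1) by (simp add: bopD)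
    also have "\<dots> \<le> d * (c * hsq U x)" using c x d by (intro mult_left_mono) auto
    finally show "hsq W (B (A x)) \<le> d * c * hsq U x" by (simp add: mult.assoc)
  qed (use assms in \<open>auto simp: bopD\<close>)
qed

text \<open>Riesz is applied in the first variable for each fixed y. Uniqueness of the representing
  vector makes B linear, and testing with x = B y gives the bound. Adjoints and operators of bounded
  forms are both instances.\<close>

lemma sesquilinear_representation:
  assumes "complete_space V" "inner_space W"
    and addl: "\<And>x y z. x \<in> hcar V \<Longrightarrow> y \<in> hcar V \<Longrightarrow> z \<in> hcar W \<Longrightarrow> b (hadd V x y) z = b x z + b y z"
    and scalel: "\<And>s x z. x \<in> hcar V \<Longrightarrow> z \<in> hcar W \<Longrightarrow> b (hscale V s x) z = s * b x z"
    and addr: "\<And>x y z. x \<in> hcar V \<Longrightarrow> y \<in> hcar W \<Longrightarrow> z \<in> hcar W \<Longrightarrow> b x (hadd W y z) = b x y + b x z"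
    and scaler: "\<And>s x z. x \<in> hcar V \<Longrightarrow> z \<in> hcar W \<Longrightarrow> b x (hscale W s z) = cnj s * b x z"
    and bound: "\<And>x y. x \<in> hcar V \<Longrightarrow> y \<in> hcar W \<Longrightarrow> cmod (b x y) \<le> c * hnorm V x * hnorm W y"
  shows "\<exists>B. bop W V B \<and> (\<forall>x\<in>hcar V. \<forall>y\<in>hcar W. b x y = hinner V x (B y))"
proof -
  interpret V: complete_space V by fact
  interpret W: inner_space W by fact
  have "\<exists>u\<in>hcar V. \<forall>x\<in>hcar V. b x y = hinner V x u" if "y \<in> hcar W" for y
    using that bound[OF _ that]
    by (intro V.riesz[where \<phi> = "\<lambda>x. b x y" and C = "c * hnorm W y"]) (auto simp: addl scalel mult_ac)
  then obtain B where B: "\<And>y. y \<in> hcar W \<Longrightarrow> B y \<in> hcar V"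
    "\<And>x y. x \<in> hcar V \<Longrightarrow> y \<in> hcar W \<Longrightarrow> b x y = hinner V x (B y)" by metis
  have eq: "u = v" if "u \<in> hcar V" "v \<in> hcar V" "\<And>x. x \<in> hcar V \<Longrightarrow> hinner V x u = hinner V x v" for u v
    using that V.inner_cnj[of _ u] V.inner_cnj[of _ v] by (intro V.vector_eqI) auto
  have "bop W V B"
    unfolding bop_def
  proof (intro conjI ballI allI)
    show "B y \<in> hcar V" if "y \<in> hcar W" for y using B that by simp
    show "B (hadd W y z) = hadd V (B y) (B z)" if "y \<in> hcar W" "z \<in> hcar W" for y z
      using that B addr by (intro eq) (auto simp flip: B(2))
    show "B (hscale W s z) = hscale V s (B z)" if "z \<in> hcar W" for s z
      using that B scaler by (intro eq) (auto simp flip: B(2))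
    show "\<exists>c. \<forall>y\<in>hcar W. hnorm V (B y) \<le> c * hnorm W y"
    proof (intro exI[of _ "\<bar>c\<bar>"] ballI)
      fix y assume y: "y \<in> hcar W"
      have By: "B y \<in> hcar V" using B y by simp
      have "hnorm V (B y) * hnorm V (B y) = cmod (b (B y) y)"
        using B(2)[OF By y] By V.hnorm_sq[OF By] by (simp add: V.inner_self power2_eq_square)
      also have "\<dots> \<le> c * hnorm V (B y) * hnorm W y" using bound[OF By y] .
      also have "\<dots> \<le> \<bar>c\<bar> * hnorm V (B y) * hnorm W y"
        using By y by (intro mult_right_mono) auto
      finally have "hnorm V (B y) * hnorm V (B y) \<le> (\<bar>c\<bar> * hnorm W y) * hnorm V (B y)"
        by (simp add: mult_ac)
      moreover have "0 \<le> \<bar>c\<bar> * hnorm W y" using y by simp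
      ultimately show "hnorm V (B y) \<le> \<bar>c\<bar> * hnorm W y"
        using V.hnorm_nonneg[OF By] by (cases "hnorm V (B y) = 0") auto
    qed
  qed
  then show ?thesis using B(2) by blast
qed

text \<open>Shows that the choice in \<open>hadj\<close> is made from a nonempty set. Everything
  later about adjoints rests on these two properties alone.\<close>

lemma hadj_properties:
  assumes V: "complete_space V" and W: "inner_space W" and A: "bop V W A"
  shows "bop W V (hadj V W A)"
    and "x \<in> hcar V \<Longrightarrow> y \<in> hcar W \<Longrightarrow> hinner W (A x) y = hinner V x (hadj V W A y)"
proof -
  interpret V: complete_space V by fact
  interpret W: inner_space W by fact
  obtain c where c: "\<And>x. x \<in> hcar V \<Longrightarrow> hnorm W (A x) \<le> c * hnorm V x"
    using bop_bound[OF A V.inner_space_axioms] by blast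
  have "\<exists>B. bop W V B \<and> (\<forall>x\<in>hcar V. \<forall>y\<in>hcar W. hinner W (A x) y = hinner V x (B y))"
  proof (rule sesquilinear_representation[OF V W])
    fix x y assume xy: "x \<in> hcar V" "y \<in> hcar W"
    have "cmod (hinner W (A x) y) \<le> hnorm W (A x) * hnorm W y"
      using xy A by (intro W.cauchy_schwarz) (auto simp: bopD)
    also have "\<dots> \<le> c * hnorm V x * hnorm W y" using c xy by (intro mult_right_mono) auto
    finally show "cmod (hinner W (A x) y) \<le> c * hnorm V x * hnorm W y" .
  qed (use A in \<open>auto simp: bopD\<close>)
  from someI_ex[OF this, folded hadj_def]
  show "bop W V (hadj V W A)"
    and "x \<in> hcar V \<Longrightarrow> y \<in> hcar W \<Longrightarrow> hinner W (A x) y = hinner V x (hadj V W A y)"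
    by blast+
qed

text \<open>Turns \<open>W^* X = 0\<close> into orthogonality of the ranges of W and X: pairing the
  adjoint vector with itself moves it into the range of A.\<close>

lemma hadj_eq_zero:
  assumes V: "complete_space V" and W: "inner_space W" and A: "bop V W A" and y: "y \<in> hcar W"
    and orth: "\<And>x. x \<in> hcar V \<Longrightarrow> hinner W (A x) y = 0"
  shows "hadj V W A y = hzero V"
proof -
  interpret V: complete_space V by fact
  have h: "hadj V W A y \<in> hcar V" using hadj_properties(1)[OF V W A] y by (rule bopD)
  then have "hinner V (hadj V W A y) (hadj V W A y) = 0"
    using hadj_properties(2)[OF V W A h y] orth[OF h] by simp
  then show ?thesis using h by (intro V.inner_definite)
qed

section \<open>2-isometries, concavity and covariance in terms of inner products\<close>

context complete_space
begin

lemma hadj_closed: "bop V V T \<Longrightarrow> y \<in> hcar V \<Longrightarrow> hadj V V T y \<in> hcar V"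
  using hadj_properties(1)[OF complete_space_axioms inner_space_axioms] by (rule bopD)

lemma inner_hadj_left:
  assumes "bop V V T" "x \<in> hcar V" "y \<in> hcar V"
  shows "hinner V (hadj V V T y) x = hinner V y (T x)"
proof -
  have "hinner V (hadj V V T y) x = cnj (hinner V x (hadj V V T y))"
    using assms hadj_closed by (intro inner_cnj) auto
  also have "\<dots> = cnj (hinner V (T x) y)"
    using hadj_properties(2)[OF complete_space_axioms inner_space_axioms assms] by simp
  also have "\<dots> = hinner V y (T x)" using assms by (intro inner_cnj[symmetric]) (auto simp: bopD)
  finally show ?thesis .
qed

lemma Delta_closed: "bop V V T \<Longrightarrow> x \<in> hcar V \<Longrightarrow> Delta V T x \<in> hcar V"
  by (simp add: Delta_def hadj_closed bopD)

lemma inner_Delta: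
  "bop V V T \<Longrightarrow> x \<in> hcar V \<Longrightarrow> y \<in> hcar V \<Longrightarrow>
    hinner V (Delta V T x) y = hinner V (T x) (T y) - hinner V x y"
  by (simp add: Delta_def hadj_closed bopD inner_hadj_left)

lemma bop_Delta:
  assumes "bop V V T"
  shows "bop V V (Delta V T)"
proof -
  have hb: "bop V V (hadj V V T)"
    using assms by (rule hadj_properties[OF complete_space_axioms inner_space_axioms])
  have TT: "bop V V (\<lambda>x. hadj V V T (T x))"
    by (rule bop_compose[OF assms hb]) (rule inner_space_axioms)+
  obtain c where c: "c \<ge> 0" "\<And>x. x \<in> hcar V \<Longrightarrow> hnorm V (hadj V V T (T x)) \<le> c * hnorm V x"
    using bop_bound[OF TT inner_space_axioms] by blast
  show ?thesis
    unfolding bop_def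
  proof (intro conjI ballI allI)
    fix x y s assume x: "x \<in> hcar V" and y: "y \<in> hcar V"
    show "Delta V T x \<in> hcar V" using assms x by (rule Delta_closed)
    show "Delta V T (hadd V x y) = hadd V (Delta V T x) (Delta V T y)"
      using assms x y by (intro vector_eqI) (auto simp: Delta_closed inner_Delta bopD)
    show "Delta V T (hscale V s x) = hscale V s (Delta V T x)"
      using assms x by (intro vector_eqI) (auto simp: Delta_closed inner_Delta bopD algebra_simps)
  next
    show "\<exists>c. \<forall>x\<in>hcar V. hnorm V (Delta V T x) \<le> c * hnorm V x"
    proof (intro exI[of _ "c + 1"] ballI)
      fix x assume x: "x \<in> hcar V"
      have "hnorm V (Delta V T x) \<le> hnorm V (hadj V V T (T x)) + hnorm V (hscale V (-1) x)"
        unfolding Delta_def hsub_def using x bopD(1)[OF TT x] by (intro hnorm_triangle) auto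
      moreover have "hnorm V (hscale V (-1) x) = hnorm V x"
        using x by (simp add: hnorm_def)
      ultimately show "hnorm V (Delta V T x) \<le> (c + 1) * hnorm V x"
        using c(2)[OF x] by (simp add: algebra_simps)
    qed
  qed
qed

lemma inner_twoiso_op:
  assumes T: "bop V V T" and "x \<in> hcar V" "y \<in> hcar V"
  shows "hinner V (twoiso_op V T x) y =
    hinner V (T (T x)) (T (T y)) - 2 * hinner V (T x) (T y) + hinner V x y"
  using assms by (simp add: twoiso_op_def hadj_closed bopD inner_hadj_left)

lemma two_isometryI:
  assumes T: "bop V V T"
    and eq: "\<And>x y. x \<in> hcar V \<Longrightarrow> y \<in> hcar V \<Longrightarrow>
      hinner V (T (T x)) (T (T y)) - 2 * hinner V (T x) (T y) + hinner V x y = 0"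
  shows "two_isometry V T"
  unfolding two_isometry_def
proof (intro conjI ballI T)
  fix x assume x: "x \<in> hcar V"
  have "twoiso_op V T x \<in> hcar V" using T x by (simp add: twoiso_op_def hadj_closed bopD)
  then show "twoiso_op V T x = hzero V"
    using T x eq by (intro vector_eqI) (auto simp: inner_twoiso_op)
qed

lemma concave_op_hsq:
  assumes T: "concave_op V T" and x: "x \<in> hcar V"
  shows "hsq V (T (T x)) - 2 * hsq V (T x) + hsq V x \<le> 0"
  using assms inner_twoiso_op[of T x x] by (auto simp: concave_op_def op_nonpos_def hsq_def)

lemma concave_op_expansive:
  assumes T: "concave_op V T" and x: "x \<in> hcar V"
  shows "hsq V x \<le> hsq V (T x)"
proof (rule ccontr)
  assume neg: "\<not> hsq V x \<le> hsq V (T x)"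
  define u where "u = (\<lambda>n. hsq V ((T ^^ n) x))"
  have B: "bop V V T" using T by (simp add: concave_op_def)
  have it: "(T ^^ n) x \<in> hcar V" for n
    by (induction n) (use x B in \<open>auto simp: bopD\<close>)
  have conc: "u (Suc (Suc n)) - u (Suc n) \<le> u (Suc n) - u n" for n
    using concave_op_hsq[OF T it[of n]] by (simp add: u_def)
  have incr: "u (Suc n) - u n \<le> u 1 - u 0" for n
  proof (induction n)
    case (Suc n)
    then show ?case using conc[of n] by linarith
  qed simp
  have bound: "u n \<le> u 0 - real n * (u 0 - u 1)" for n
  proof (induction n)
    case (Suc n)
    then show ?case using incr[of n] by (simp add: algebra_simps)
  qed simp
  have "u 0 - u 1 > 0" using neg by (simp add: u_def)
  then obtain n where "u 0 < real n * (u 0 - u 1)"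
    using reals_Archimedean3 by blast
  then have "u n < 0" using bound[of n] by simp
  moreover have "u n \<ge> 0" using it by (simp add: u_def)
  ultimately show False by simp
qed

text \<open>Identifies the norm of a positive operator with the least M bounding its form, so that
  covariances can be computed from quadratic inequalities. For the last claim Cauchy-Schwarz is
  applied to the form a at x and B x: ||B x||^4 = |a(x, B x)|^2 \<le> a(x,x) a(B x, B x), and the
  right side is at most M^2 ||x||^2 ||B x||^2.\<close>

lemma opnorm_least_bound:
  assumes B: "bop V V B" and a: "positive_form V a"
    and eq: "\<And>x y. x \<in> hcar V \<Longrightarrow> y \<in> hcar V \<Longrightarrow> hinner V (B x) y = a x y"
  shows "0 \<le> opnorm V V B"
    and "x \<in> hcar V \<Longrightarrow> Re (a x x) \<le> opnorm V V B * hsq V x"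
    and "(\<And>x. x \<in> hcar V \<Longrightarrow> Re (a x x) \<le> M * hsq V x) \<Longrightarrow> 0 \<le> M \<Longrightarrow> opnorm V V B \<le> M"
proof -
  let ?X = "(\<lambda>x. hnorm V (B x)) ` {x \<in> hcar V. hnorm V x \<le> 1}"
  have Bc: "B x \<in> hcar V" if "x \<in> hcar V" for x using B that by (rule bopD)
  obtain c where c: "c \<ge> 0" "\<And>x. x \<in> hcar V \<Longrightarrow> hnorm V (B x) \<le> c * hnorm V x"
    using bop_bound[OF B inner_space_axioms] by blast
  have bdd: "bdd_above ?X"
  proof (rule bdd_aboveI2)
    fix x assume "x \<in> {x \<in> hcar V. hnorm V x \<le> 1}"
    then show "hnorm V (B x) \<le> c"
      using c(2)[of x] c(1) mult_left_le[of "hnorm V x" c] by (auto intro: order_trans)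
  qed
  have ne: "0 \<in> ?X"
    using bop_zero[OF B inner_space_axioms inner_space_axioms]
    by (intro image_eqI[of _ _ "hzero V"]) auto
  show nonneg: "0 \<le> opnorm V V B"
    unfolding opnorm_def using bdd ne by (rule cSup_upper[rotated])
  have op: "hnorm V (B x) \<le> opnorm V V B * hnorm V x" if x: "x \<in> hcar V" for x
  proof (cases "hnorm V x = 0")
    case True
    then show ?thesis using c(2)[OF x] by simp
  next
    case False
    then have pos: "hnorm V x > 0" using x hnorm_nonneg[of x] by linarith
    let ?y = "hscale V (of_real (1 / hnorm V x)) x"
    have norm_scale: "hnorm V (hscale V (of_real r) z) = r * hnorm V z" if "r \<ge> 0" "z \<in> hcar V" for r z
      using hsq_scale[OF that(2), of "of_real r"] that
      by (simp add: hnorm_def hsq_def[symmetric] real_sqrt_mult)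
    have "hnorm V ?y = 1" using norm_scale[of "1 / hnorm V x" x] pos x by simp
    then have "hnorm V (B ?y) \<le> opnorm V V B"
      unfolding opnorm_def using bdd x by (intro cSup_upper) auto
    moreover have "hnorm V (B ?y) = 1 / hnorm V x * hnorm V (B x)"
      using norm_scale[of "1 / hnorm V x" "B x"] pos x Bc B by (simp add: bopD)
    ultimately have "1 / hnorm V x * hnorm V (B x) \<le> opnorm V V B" by simp
    then show ?thesis using pos by (simp add: pos_divide_le_eq)
  qed
  show "Re (a x x) \<le> opnorm V V B * hsq V x" if x: "x \<in> hcar V"
  proof -
    have "Re (a x x) \<le> cmod (hinner V (B x) x)" using eq[OF x x] complex_Re_le_cmod[of "a x x"] by simp
    also have "\<dots> \<le> hnorm V (B x) * hnorm V x" using x Bc by (intro cauchy_schwarz) auto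
    also have "\<dots> \<le> opnorm V V B * hnorm V x * hnorm V x" using op x by (intro mult_right_mono) auto
    finally show ?thesis using hnorm_sq[OF x] by (simp add: power2_eq_square mult.assoc)
  qed
  show "opnorm V V B \<le> M" if M: "\<And>x. x \<in> hcar V \<Longrightarrow> Re (a x x) \<le> M * hsq V x" "0 \<le> M"
    unfolding opnorm_def
  proof (rule cSup_least)
    show "?X \<noteq> {}" using ne by blast
    fix r assume "r \<in> ?X"
    then obtain x where x: "x \<in> hcar V" "hnorm V x \<le> 1" "r = hnorm V (B x)" by auto
    have "hsq V (B x) * hsq V (B x) = (cmod (a x (B x)))\<^sup>2"
      unfolding eq[OF x(1) Bc[OF x(1)], symmetric] inner_self[OF Bc[OF x(1)]] by (simp add: power2_eq_square)
    also have "\<dots> \<le> Re (a x x) * Re (a (B x) (B x))"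
      using a x Bc by (intro form_cauchy_schwarz) auto
    also have "\<dots> \<le> (M * hsq V x) * (M * hsq V (B x))"
      using a x Bc M by (intro mult_mono) (auto simp: positive_form_def)
    finally have "hsq V (B x) * hsq V (B x) \<le> (M\<^sup>2 * hsq V x) * hsq V (B x)"
      by (simp add: power2_eq_square mult_ac)
    then have "hsq V (B x) \<le> M\<^sup>2 * hsq V x"
    proof (cases "hsq V (B x) = 0")
      case True
      then show ?thesis using hsq_nonneg[OF x(1)] by simp
    next
      case False
      then have "0 < hsq V (B x)" using hsq_nonneg[OF Bc[OF x(1)]] by linarith
      with \<open>hsq V (B x) * hsq V (B x) \<le> (M\<^sup>2 * hsq V x) * hsq V (B x)\<close>
      show ?thesis by (rule mult_right_le_imp_le)
    qed
    also have "\<dots> \<le> M\<^sup>2"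
    proof -
      have "hsq V x \<le> 1" using x(1,2) hnorm_sq[of x] power_mono[of "hnorm V x" 1 2] hnorm_nonneg[of x] by simp
      then show ?thesis by (simp add: mult_left_le)
    qed
    finally have "(hnorm V (B x))\<^sup>2 \<le> M\<^sup>2" using hnorm_sq[OF Bc[OF x(1)]] by simp
    then show "r \<le> M" unfolding x(3) using M(2) by (rule power2_le_imp_le)
  qed
qed

end

section \<open>Direct sums, subspaces and square-summable sequences\<close>

text \<open>The extra summand that keeps the coordinate space nonzero when H is zero, as the
  nontrivial decomposition in (i) requires. It accounts for the factor \<open>complex\<close> in
  \<open>bigT\<close>.\<close>

definition complex_line :: "complex cips" where
  "complex_line = \<lparr> hcar = UNIV, hadd = (+), hscale = (*), hzero = 0, hinner = (\<lambda>x y. x * cnj y) \<rparr>"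

lemma complex_line_simps [simp]:
  "hcar complex_line = UNIV" "hadd complex_line = (+)" "hscale complex_line = (*)"
  "hzero complex_line = 0" "hinner complex_line x y = x * cnj y"
  by (simp_all add: complex_line_def)

lemma complete_space_complex_line: "complete_space complex_line"
proof -
  have norm: "hnorm complex_line x = cmod x" for x
    by (simp add: hnorm_def cmod_def power2_eq_square)
  show ?thesis
  proof unfold_locales
    fix f :: "nat \<Rightarrow> complex"
    assume c: "\<exists>N. \<forall>m\<ge>N. \<forall>n\<ge>N. hnorm complex_line (hsub complex_line (f m) (f n)) < e" if "e > 0" for e
    have "Cauchy f" using c by (intro metric_CauchyI) (simp add: norm hsub_def dist_norm)
    then obtain l where "f \<longlonglongrightarrow> l" using Cauchy_convergent convergent_def by blast
    then have "(\<lambda>n. cmod (f n - l)) \<longlonglongrightarrow> 0" by (simp add: LIM_zero tendsto_norm_zero)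
    then show "\<exists>l\<in>hcar complex_line. (\<lambda>n. hnorm complex_line (hsub complex_line (f n) l)) \<longlonglongrightarrow> 0"
      by (auto simp: norm hsub_def)
  qed (auto simp: algebra_simps)
qed

lemma dsum_simps [simp]:
  "hcar (dsum A B) = hcar A \<times> hcar B"
  "hadd (dsum A B) (a, b) (c, d) = (hadd A a c, hadd B b d)"
  "hscale (dsum A B) s (a, b) = (hscale A s a, hscale B s b)"
  "hzero (dsum A B) = (hzero A, hzero B)"
  "hinner (dsum A B) (a, b) (c, d) = hinner A a c + hinner B b d"
  by (simp_all add: dsum_def)

lemma hsub_dsum [simp]: "hsub (dsum A B) (a, b) (c, d) = (hsub A a c, hsub B b d)"
  by (simp add: hsub_def)

lemma hsq_dsum [simp]: "hsq (dsum A B) (a, b) = hsq A a + hsq B b"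
  by (simp add: hsq_def)

lemma inner_space_dsum:
  assumes "inner_space A" "inner_space B"
  shows "inner_space (dsum A B)"
proof -
  interpret A: inner_space A by fact
  interpret B: inner_space B by fact
  show ?thesis
    apply unfold_locales
    subgoal by simp
    subgoal by auto
    subgoal by auto
    subgoal by (auto simp: A.add_assoc B.add_assoc)
    subgoal by (auto simp: A.add_comm B.add_comm)
    subgoal by auto
    subgoal by (auto simp: A.add_neg B.add_neg)
    subgoal by (auto simp: A.scale_scale B.scale_scale)
    subgoal by (auto simp: A.scale_one B.scale_one)
    subgoal by (auto simp: A.scale_add_right B.scale_add_right)
    subgoal by (auto simp: A.scale_add_left B.scale_add_left)
    subgoal for x y
      using A.inner_cnj[of "fst x" "fst y"] B.inner_cnj[of "snd x" "snd y"] by (cases x; cases y) simp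
    subgoal by auto
    subgoal by (auto simp: algebra_simps)
    subgoal by (auto simp: A.inner_nonneg B.inner_nonneg)
    subgoal for x
    proof -
      assume x: "x \<in> hcar (dsum A B)" and z: "hinner (dsum A B) x x = 0"
      obtain a b where ab: "x = (a, b)" by (cases x)
      have "complex_of_real (hsq A a + hsq B b) = 0"
        using x z by (simp add: ab A.inner_self B.inner_self)
      then have "hsq A a + hsq B b = 0" by (simp only: of_real_eq_0_iff)
      then have "hsq A a = 0" "hsq B b = 0"
        using x A.hsq_nonneg[of a] B.hsq_nonneg[of b] by (simp_all add: ab add_nonneg_eq_0_iff)
      then show ?thesis using x by (auto simp: ab A.hsq_eq_0 B.hsq_eq_0)
    qed
    done
qed

lemma hnorm_dsum_ge:
  assumes "inner_space A" "inner_space B" "a \<in> hcar A" "b \<in> hcar B"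
  shows "hnorm A a \<le> hnorm (dsum A B) (a, b)" "hnorm B b \<le> hnorm (dsum A B) (a, b)"
  using assms inner_space.inner_nonneg[of A a] inner_space.inner_nonneg[of B b]
  by (auto simp: hnorm_def)

lemma complete_space_dsum:
  assumes "complete_space A" "complete_space B"
  shows "complete_space (dsum A B)"
proof -
  interpret A: complete_space A by fact
  interpret B: complete_space B by fact
  interpret D: inner_space "dsum A B"
    by (rule inner_space_dsum) (rule A.inner_space_axioms B.inner_space_axioms)+
  show ?thesis
  proof unfold_locales
    fix f :: "nat \<Rightarrow> 'a \<times> 'b"
    assume f: "f n \<in> hcar (dsum A B)" for n
    assume c: "\<exists>N. \<forall>m\<ge>N. \<forall>n\<ge>N. hnorm (dsum A B) (hsub (dsum A B) (f m) (f n)) < e" if "e > 0" for e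
    define g h where "g = (\<lambda>n. fst (f n))" and "h = (\<lambda>n. snd (f n))"
    have gh: "g n \<in> hcar A" "h n \<in> hcar B" "f n = (g n, h n)" for n
      using f[of n] by (auto simp: g_def h_def mem_Times_iff)
    have le: "hnorm A (hsub A (g m) (g n)) \<le> hnorm (dsum A B) (hsub (dsum A B) (f m) (f n))"
      "hnorm B (hsub B (h m) (h n)) \<le> hnorm (dsum A B) (hsub (dsum A B) (f m) (f n))" for m n
      using hnorm_dsum_ge[OF A.inner_space_axioms B.inner_space_axioms,
          of "hsub A (g m) (g n)" "hsub B (h m) (h n)"] gh by auto
    have "\<exists>l\<in>hcar A. (\<lambda>n. hnorm A (hsub A (g n) l)) \<longlonglongrightarrow> 0"
      by (rule A.complete) (use gh c le in \<open>meson order_le_less_trans\<close>)+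
    then obtain l where l: "l \<in> hcar A" "(\<lambda>n. hsq A (hsub A (g n) l)) \<longlonglongrightarrow> 0"
      using A.hnorm_tendsto_0_iff gh by auto
    have "\<exists>l\<in>hcar B. (\<lambda>n. hnorm B (hsub B (h n) l)) \<longlonglongrightarrow> 0"
      by (rule B.complete) (use gh c le in \<open>meson order_le_less_trans\<close>)+
    then obtain k where k: "k \<in> hcar B" "(\<lambda>n. hsq B (hsub B (h n) k)) \<longlonglongrightarrow> 0"
      using B.hnorm_tendsto_0_iff gh by auto
    have "(\<lambda>n. hsq (dsum A B) (hsub (dsum A B) (f n) (l, k))) \<longlonglongrightarrow> 0"
      using tendsto_add[OF l(2) k(2)] by (simp add: gh)
    then show "\<exists>l\<in>hcar (dsum A B). (\<lambda>n. hnorm (dsum A B) (hsub (dsum A B) (f n) l)) \<longlonglongrightarrow> 0"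
      using l k f by (intro bexI[of _ "(l, k)"] D.hnorm_tendsto_0_iff[THEN iffD2] D.sub_closed) auto
  qed
qed

text \<open>Only the carrier shrinks; type and operations stay. The space of the minimal lifting is
  cut out of E in this way and so remains a space over \<open>bigT\<close>.\<close>

definition restrict_space :: "'v cips \<Rightarrow> 'v set \<Rightarrow> 'v cips" where
  "restrict_space V L = V\<lparr>hcar := L\<rparr>"

lemma restrict_space_simps [simp]:
  "hcar (restrict_space V L) = L" "hadd (restrict_space V L) = hadd V"
  "hscale (restrict_space V L) = hscale V" "hzero (restrict_space V L) = hzero V"
  "hinner (restrict_space V L) = hinner V" "hsub (restrict_space V L) = hsub V"
  "hnorm (restrict_space V L) = hnorm V" "hsq (restrict_space V L) = hsq V"
  by (simp_all add: restrict_space_def hsub_def hnorm_def hsq_def fun_eq_iff)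

lemma inner_space_restrict:
  assumes "inner_space V" "linear_subspace V L"
  shows "inner_space (restrict_space V L)"
proof -
  interpret inner_space V by fact
  have L: "L \<subseteq> hcar V" "hzero V \<in> L" "\<And>x y. x \<in> L \<Longrightarrow> y \<in> L \<Longrightarrow> hadd V x y \<in> L"
    "\<And>a x. x \<in> L \<Longrightarrow> hscale V a x \<in> L"
    using assms(2) unfolding linear_subspace_def by blast+
  have c: "x \<in> hcar V" if "x \<in> L" for x using L(1) that by blast
  show ?thesis
    apply unfold_locales
    subgoal using L by simp
    subgoal using L by simp
    subgoal using L by simp
    subgoal by (simp add: c add_assoc)
    subgoal by (simp add: c add_comm)
    subgoal by (simp add: c)
    subgoal by (simp add: c add_neg)
    subgoal by (simp add: c scale_scale)
    subgoal by (simp add: c scale_one)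
    subgoal by (simp add: c scale_add_right)
    subgoal by (simp add: c scale_add_left)
    subgoal for x y using inner_cnj[of x y] by (simp add: c)
    subgoal by (simp add: c)
    subgoal by (simp add: c)
    subgoal by (simp add: c inner_nonneg)
    subgoal by (simp add: c inner_definite)
    done
qed

lemma complete_space_restrict:
  assumes "complete_space V" "closed_subspace V L"
  shows "complete_space (restrict_space V L)"
proof -
  interpret complete_space V by fact
  have "linear_subspace V L" using assms(2) by (simp add: closed_subspace_def linear_subspace_def)
  with inner_space_axioms interpret L: inner_space "restrict_space V L" by (rule inner_space_restrict)
  have c: "x \<in> hcar V" if "x \<in> L" for x using assms(2) that unfolding closed_subspace_def by blast
  have cl: "\<And>f l. (\<And>n. f n \<in> L) \<Longrightarrow> l \<in> hcar V \<Longrightarrow> (\<lambda>n. hnorm V (hsub V (f n) l)) \<longlonglongrightarrow> 0 \<Longrightarrow> l \<in> L"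
    using assms(2) unfolding closed_subspace_def by blast
  show ?thesis
  proof
    fix f :: "nat \<Rightarrow> 'a"
    assume f: "\<And>n. f n \<in> hcar (restrict_space V L)"
      and cauchy: "\<And>e. e > 0 \<Longrightarrow>
        \<exists>N. \<forall>m\<ge>N. \<forall>n\<ge>N. hnorm (restrict_space V L) (hsub (restrict_space V L) (f m) (f n)) < e"
    have fL: "f n \<in> L" for n using f by simp
    have "\<exists>l\<in>hcar V. (\<lambda>n. hnorm V (hsub V (f n) l)) \<longlonglongrightarrow> 0"
      using cauchy by (intro complete c fL) simp
    then show "\<exists>l\<in>hcar (restrict_space V L).
        (\<lambda>n. hnorm (restrict_space V L) (hsub (restrict_space V L) (f n) l)) \<longlonglongrightarrow> 0"
      using cl[OF fL] by auto
  qed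
qed

text \<open>For V = H \<oplus> \<complex> the elements have exactly the type \<open>bigT\<close>.
  The inner product is an infinite sum that is meaningful only on the carrier, where
  \<open>summable_inner\<close> gives convergence.\<close>

definition ell2 :: "'v cips \<Rightarrow> (nat \<Rightarrow> 'v) cips" where
  "ell2 V = \<lparr> hcar = {f. (\<forall>n. f n \<in> hcar V) \<and> summable (\<lambda>n. hsq V (f n))},
     hadd = (\<lambda>f g n. hadd V (f n) (g n)), hscale = (\<lambda>s f n. hscale V s (f n)),
     hzero = (\<lambda>n. hzero V), hinner = (\<lambda>f g. \<Sum>n. hinner V (f n) (g n)) \<rparr>"

lemma ell2_simps [simp]:
  "hadd (ell2 V) f g = (\<lambda>n. hadd V (f n) (g n))"
  "hscale (ell2 V) s f = (\<lambda>n. hscale V s (f n))"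
  "hzero (ell2 V) = (\<lambda>n. hzero V)"
  "hsub (ell2 V) f g = (\<lambda>n. hsub V (f n) (g n))"
  by (simp_all add: ell2_def hsub_def)

lemma hinner_ell2: "hinner (ell2 V) f g = (\<Sum>n. hinner V (f n) (g n))"
  by (simp add: ell2_def)

lemma mem_ell2: "f \<in> hcar (ell2 V) \<longleftrightarrow> (\<forall>n. f n \<in> hcar V) \<and> summable (\<lambda>n. hsq V (f n))"
  by (simp add: ell2_def)

context inner_space
begin

lemma hsq_add_le:
  assumes "x \<in> hcar V" "y \<in> hcar V"
  shows "hsq V (hadd V x y) \<le> 2 * hsq V x + 2 * hsq V y"
proof -
  have "0 \<le> hsq V (hsub V x y)" using assms by simp
  also have "\<dots> = 2 * hsq V x + 2 * hsq V y - hsq V (hadd V x y)"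
    using assms by (simp add: hsq_def)
  finally show ?thesis by simp
qed

lemma cmod_inner_le:
  assumes "x \<in> hcar V" "y \<in> hcar V"
  shows "cmod (hinner V x y) \<le> hsq V x + hsq V y"
proof -
  have "cmod (hinner V x y) \<le> hnorm V x * hnorm V y" using assms by (rule cauchy_schwarz)
  also have "\<dots> \<le> (hnorm V x)\<^sup>2 + (hnorm V y)\<^sup>2"
    using sum_squares_bound[of "hnorm V x" "hnorm V y"]
      mult_nonneg_nonneg[OF hnorm_nonneg[OF assms(1)] hnorm_nonneg[OF assms(2)]] by linarith
  finally show ?thesis using assms by (simp add: hnorm_sq)
qed

lemma summable_inner:
  assumes "f \<in> hcar (ell2 V)" "g \<in> hcar (ell2 V)"
  shows "summable (\<lambda>n. hinner V (f n) (g n))"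
proof (rule summable_comparison_test')
  show "summable (\<lambda>n. hsq V (f n) + hsq V (g n))"
    using assms by (intro summable_add) (auto simp: mem_ell2)
  show "norm (hinner V (f n) (g n)) \<le> hsq V (f n) + hsq V (g n)" if "n \<ge> 0" for n
    using assms by (intro cmod_inner_le) (auto simp: mem_ell2)
qed

lemma hsq_ell2:
  assumes "f \<in> hcar (ell2 V)"
  shows "hsq (ell2 V) f = (\<Sum>n. hsq V (f n))"
proof -
  have "Re (\<Sum>n. hinner V (f n) (f n)) = (\<Sum>n. Re (hinner V (f n) (f n)))"
    by (intro Re_suminf summable_inner assms)
  then show ?thesis by (simp add: hsq_def hinner_ell2)
qed

lemma inner_space_ell2: "inner_space (ell2 V)"
proof -
  have c: "f n \<in> hcar V" if "f \<in> hcar (ell2 V)" for f n using that by (simp add: mem_ell2)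
  show ?thesis
    apply unfold_locales
    subgoal by (simp add: mem_ell2)
    subgoal for f g
    proof -
      assume f: "f \<in> hcar (ell2 V)" and g: "g \<in> hcar (ell2 V)"
      have "summable (\<lambda>n. hsq V (hadd V (f n) (g n)))"
      proof (rule summable_comparison_test')
        show "summable (\<lambda>n. 2 * hsq V (f n) + 2 * hsq V (g n))"
          using f g by (intro summable_add summable_mult) (auto simp: mem_ell2)
        show "norm (hsq V (hadd V (f n) (g n))) \<le> 2 * hsq V (f n) + 2 * hsq V (g n)" if "n \<ge> 0" for n
          using f g by (simp add: c hsq_add_le)
      qed
      then show ?thesis using f g by (simp add: mem_ell2)
    qed
    subgoal by (auto simp: mem_ell2 hsq_scale intro: summable_mult)
    subgoal by (simp add: c add_assoc)
    subgoal by (simp add: c add_comm)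
    subgoal by (simp add: c)
    subgoal by (simp add: c add_neg)
    subgoal by (simp add: c scale_scale)
    subgoal by (simp add: c scale_one)
    subgoal by (simp add: c scale_add_right)
    subgoal by (simp add: c scale_add_left)
    subgoal for f g
    proof -
      assume f: "f \<in> hcar (ell2 V)" and g: "g \<in> hcar (ell2 V)"
      have "cnj (\<Sum>n. hinner V (f n) (g n)) = (\<Sum>n. cnj (hinner V (f n) (g n)))"
        using bounded_linear.suminf[OF bounded_linear_cnj summable_inner[OF f g]] .
      also have "\<dots> = (\<Sum>n. hinner V (g n) (f n))"
        using f g by (intro suminf_cong inner_cnj[symmetric]) (auto simp: c)
      finally show ?thesis by (simp add: hinner_ell2)
    qed
    subgoal by (simp add: hinner_ell2 c suminf_add summable_inner)
    subgoal by (simp add: hinner_ell2 c suminf_mult summable_inner)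
    subgoal for f using hsq_ell2[of f] suminf_nonneg[of "\<lambda>n. hsq V (f n)"]
      by (simp add: hsq_def mem_ell2 inner_nonneg)
    subgoal for f
    proof -
      assume f: "f \<in> hcar (ell2 V)" and z: "hinner (ell2 V) f f = 0"
      have "(\<Sum>n. hsq V (f n)) = 0" using z hsq_ell2[OF f] by (simp add: hsq_def)
      then have "\<forall>n. hsq V (f n) = 0" using f
        by (subst suminf_eq_zero_iff[symmetric]) (auto simp: mem_ell2)
      then show ?thesis using f by (auto simp: fun_eq_iff c intro: hsq_eq_0)
    qed
    done
qed

end

text \<open>The limit is formed coordinate by coordinate. Norm convergence follows by bounding
  partial sums over k < K, letting the second index tend to infinity for fixed K, and only then
  using that the bound does not depend on K.\<close>

lemma complete_space_ell2:
  assumes "complete_space V"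
  shows "complete_space (ell2 V)"
proof -
  interpret complete_space V by fact
  interpret E: inner_space "ell2 V" by (rule inner_space_ell2)
  show ?thesis
  proof unfold_locales
    fix f :: "nat \<Rightarrow> nat \<Rightarrow> 'a"
    assume f: "f m \<in> hcar (ell2 V)" for m
    assume cauchy: "\<exists>N. \<forall>m\<ge>N. \<forall>n\<ge>N. hnorm (ell2 V) (hsub (ell2 V) (f m) (f n)) < e" if "e > 0" for e
    have fc: "f m k \<in> hcar V" for m k using f by (simp add: mem_ell2)
    have d: "(\<lambda>k. hsub V (f m k) (f n k)) \<in> hcar (ell2 V)" for m n
      using E.sub_closed[OF f f, of m n] by simp
    have part: "(\<Sum>k<K. hsq V (hsub V (f m k) (f n k))) \<le> hsq (ell2 V) (hsub (ell2 V) (f m) (f n))" for K m n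
      using d[of m n] by (simp add: hsq_ell2 mem_ell2 sum_le_suminf fc)
    have coord: "hnorm V (hsub V (f m k) (f n k)) \<le> hnorm (ell2 V) (hsub (ell2 V) (f m) (f n))" for m n k
    proof -
      have "hsq V (hsub V (f m k) (f n k)) \<le> (\<Sum>k<Suc k. hsq V (hsub V (f m k) (f n k)))"
        by (simp add: sum_nonneg fc)
      then have "hsq V (hsub V (f m k) (f n k)) \<le> hsq (ell2 V) (hsub (ell2 V) (f m) (f n))"
        using part[of m n "Suc k"] by linarith
      then show ?thesis by (simp add: hnorm_def hsq_def)
    qed
    have "\<exists>l\<in>hcar V. (\<lambda>m. hnorm V (hsub V (f m k) l)) \<longlonglongrightarrow> 0" for k
      by (rule complete) (use fc cauchy coord in \<open>meson order_le_less_trans\<close>)+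
    then obtain g where g: "\<And>k. g k \<in> hcar V" "\<And>k. (\<lambda>m. hnorm V (hsub V (f m k) (g k))) \<longlonglongrightarrow> 0"
      by metis
    have tail: "\<exists>N. \<forall>m\<ge>N. \<forall>K. (\<Sum>k<K. hsq V (hsub V (f m k) (g k))) \<le> e\<^sup>2" if "e > 0" for e
    proof -
      obtain N where N: "\<And>m n. m \<ge> N \<Longrightarrow> n \<ge> N \<Longrightarrow> hnorm (ell2 V) (hsub (ell2 V) (f m) (f n)) < e"
        using cauchy[OF \<open>e > 0\<close>] by blast
      have "(\<Sum>k<K. hsq V (hsub V (f m k) (g k))) \<le> e\<^sup>2" if m: "m \<ge> N" for m K
      proof (rule LIMSEQ_le_const2)
        have "(\<lambda>n. hsq V (hsub V (f m k) (f n k))) \<longlonglongrightarrow> hsq V (hsub V (f m k) (g k))" for k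
        proof -
          have "(\<lambda>n. hnorm V (hsub V (f m k) (f n k)) - hnorm V (hsub V (f m k) (g k))) \<longlonglongrightarrow> 0"
          proof (rule tendsto_zero_comparison[OF _ g(2)[of k]])
            fix n
            show "norm (hnorm V (hsub V (f m k) (f n k)) - hnorm V (hsub V (f m k) (g k)))
                \<le> hnorm V (hsub V (f n k) (g k))"
              using hnorm_sub_triangle[OF fc[of m k] fc[of n k] g(1)[of k]]
                hnorm_sub_triangle[OF fc[of m k] g(1)[of k] fc[of n k]]
                hnorm_sub_commute[OF fc[of n k] g(1)[of k]] by (simp add: abs_le_iff)
          qed
          then have "(\<lambda>n. hnorm V (hsub V (f m k) (f n k))) \<longlonglongrightarrow> hnorm V (hsub V (f m k) (g k))"
            by (simp add: LIM_zero_iff)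
          from tendsto_power[OF this, of 2] show ?thesis by (simp add: hnorm_sq fc g)
        qed
        then show "(\<lambda>n. \<Sum>k<K. hsq V (hsub V (f m k) (f n k))) \<longlonglongrightarrow> (\<Sum>k<K. hsq V (hsub V (f m k) (g k)))"
          by (intro tendsto_sum)
        have "(\<Sum>k<K. hsq V (hsub V (f m k) (f n k))) \<le> e\<^sup>2" if n: "n \<ge> N" for n
        proof -
          have "hsq (ell2 V) (hsub (ell2 V) (f m) (f n)) = (hnorm (ell2 V) (hsub (ell2 V) (f m) (f n)))\<^sup>2"
            by (rule E.hnorm_sq[symmetric]) (rule E.sub_closed f)+
          also have "\<dots> \<le> e\<^sup>2"
            by (intro power_mono less_imp_le N m n E.hnorm_nonneg E.sub_closed f)
          finally show ?thesis using part[of m n K] by linarith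
        qed
        then show "\<exists>N. \<forall>n\<ge>N. (\<Sum>k<K. hsq V (hsub V (f m k) (f n k))) \<le> e\<^sup>2" by blast
      qed
      then show ?thesis by blast
    qed
    have sm: "summable (\<lambda>k. hsq V (hsub V (f m k) (g k)))"
      if "\<forall>K. (\<Sum>k<K. hsq V (hsub V (f m k) (g k))) \<le> B" for m B
      using that by (intro bounded_imp_summable[where B = B]) (auto simp: fc g lessThan_Suc_atMost[symmetric] simp del: sum.lessThan_Suc)
    \<comment> \<open>The coordinatewise limit g is square-summable because g = f N0 - (f N0 - g)
      with both terms square-summable.\<close>
    obtain N0 where "\<And>m K. m \<ge> N0 \<Longrightarrow> (\<Sum>k<K. hsq V (hsub V (f m k) (g k))) \<le> 1\<^sup>2"
      using tail[of 1] by auto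
    then have "(\<lambda>k. hsub V (f N0 k) (g k)) \<in> hcar (ell2 V)"
      using sm[of N0 "1\<^sup>2"] by (simp add: mem_ell2 fc g)
    then have "hsub (ell2 V) (f N0) (\<lambda>k. hsub V (f N0 k) (g k)) \<in> hcar (ell2 V)"
      using f by (intro E.sub_closed)
    moreover have "hsub (ell2 V) (f N0) (\<lambda>k. hsub V (f N0 k) (g k)) = g"
      by (auto simp: fun_eq_iff fc g intro!: vector_eqI)
    ultimately have gE: "g \<in> hcar (ell2 V)" by simp
    have "(\<lambda>m. hnorm (ell2 V) (hsub (ell2 V) (f m) g)) \<longlonglongrightarrow> 0"
    proof (rule LIMSEQ_I)
      fix e :: real assume "e > 0"
      then have e2: "e/2 > 0" by simp
      obtain N where N: "\<And>m K. m \<ge> N \<Longrightarrow> (\<Sum>k<K. hsq V (hsub V (f m k) (g k))) \<le> (e/2)\<^sup>2"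
        using tail[OF e2] by blast
      have "norm (hnorm (ell2 V) (hsub (ell2 V) (f m) g) - 0) < e" if m: "m \<ge> N" for m
      proof -
        have c: "hsub (ell2 V) (f m) g \<in> hcar (ell2 V)" using f gE by (rule E.sub_closed)
        then have "(\<Sum>k. hsq V (hsub V (f m k) (g k))) \<le> (e/2)\<^sup>2"
          using N[OF m] by (intro suminf_le_const) (auto simp: mem_ell2)
        then have "(hnorm (ell2 V) (hsub (ell2 V) (f m) g))\<^sup>2 \<le> (e/2)\<^sup>2"
          using c hsq_ell2[OF c] by (simp only: E.hnorm_sq ell2_simps)
        then have "hnorm (ell2 V) (hsub (ell2 V) (f m) g) \<le> e/2"
          using less_imp_le[OF e2] by (rule power2_le_imp_le)
        then show ?thesis using \<open>e > 0\<close> E.hnorm_nonneg[OF c] by simp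
      qed
      then show "\<exists>N. \<forall>m\<ge>N. norm (hnorm (ell2 V) (hsub (ell2 V) (f m) g) - 0) < e" by blast
    qed
    then show "\<exists>l\<in>hcar (ell2 V). (\<lambda>m. hnorm (ell2 V) (hsub (ell2 V) (f m) l)) \<longlonglongrightarrow> 0"
      using gE by blast
  qed
qed

section \<open>Factorization of bounded positive forms\<close>

context complete_space
begin

lemma form_operator:
  assumes a: "positive_form V a" and bound: "\<And>x. x \<in> hcar V \<Longrightarrow> Re (a x x) \<le> c * hsq V x" and c: "c \<ge> 0"
  shows "\<exists>A. bop V V A \<and> (\<forall>x\<in>hcar V. \<forall>y\<in>hcar V. hinner V (A x) y = a x y)"
proof -
  have h: "hermitian_form V a" using a by (simp add: positive_form_def)
  have "\<exists>B. bop V V B \<and> (\<forall>x\<in>hcar V. \<forall>y\<in>hcar V. a x y = hinner V x (B y))"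
  proof (rule sesquilinear_representation[OF complete_space_axioms inner_space_axioms])
    fix x y assume x: "x \<in> hcar V" and y: "y \<in> hcar V"
    show "cmod (a x y) \<le> c * hnorm V x * hnorm V y"
    proof (rule power2_le_imp_le)
      have "(cmod (a x y))\<^sup>2 \<le> Re (a x x) * Re (a y y)" using a x y by (rule form_cauchy_schwarz)
      also have "\<dots> \<le> (c * hsq V x) * (c * hsq V y)"
        using a bound x y c by (intro mult_mono) (auto simp: positive_form_def)
      also have "\<dots> = (c * hnorm V x * hnorm V y)\<^sup>2"
        using x y by (simp add: power_mult_distrib hnorm_sq) (simp add: power2_eq_square)
      finally show "(cmod (a x y))\<^sup>2 \<le> (c * hnorm V x * hnorm V y)\<^sup>2" .
    qed (use x y c in simp)
  qed (use form_expand(1-4)[OF h] in auto)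
  then obtain B where B: "bop V V B" "\<And>x y. x \<in> hcar V \<Longrightarrow> y \<in> hcar V \<Longrightarrow> a x y = hinner V x (B y)"
    by blast
  have "hinner V (B x) y = a x y" if x: "x \<in> hcar V" and y: "y \<in> hcar V" for x y
  proof -
    have "hinner V (B x) y = cnj (hinner V y (B x))"
      by (rule inner_cnj) (use y bopD(1)[OF B(1) x] in auto)
    also have "\<dots> = cnj (a y x)" using B(2)[OF y x] by simp
    also have "\<dots> = a x y" using form_expand(7)[OF h x y y] by simp
    finally show ?thesis .
  qed
  then show ?thesis using B(1) by blast
qed

text \<open>With \<open>0 \<le> A \<le> 1\<close> and \<open>A\<^sub>n\<^sub>+\<^sub>1 = A\<^sub>n - A\<^sub>n\<^sup>2\<close>, the sum of the \<open>A\<^sub>n\<^sup>2\<close> telescopes to \<open>A\<close>,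
  so the sequence \<open>(A\<^sub>n x)\<close> replaces the square root of \<open>A\<close>.\<close>

lemma form_square_expansion:
  assumes a: "positive_form V a" and bound: "\<And>x. x \<in> hcar V \<Longrightarrow> Re (a x x) \<le> c * hsq V x" and c: "c \<ge> 0"
  shows "\<exists>R. (\<forall>n. \<forall>x\<in>hcar V. R x n \<in> hcar V) \<and>
    (\<forall>n. \<forall>x\<in>hcar V. \<forall>y\<in>hcar V. R (hadd V x y) n = hadd V (R x n) (R y n)) \<and>
    (\<forall>n s. \<forall>x\<in>hcar V. R (hscale V s x) n = hscale V s (R x n)) \<and>
    (\<forall>x\<in>hcar V. \<forall>y\<in>hcar V. (\<lambda>n. hinner V (R x n) (R y n)) sums a x y)"
proof -
  \<comment> \<open>The form is divided by k to bring its operator between 0 and 1. Taking c + 1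
    rather than c keeps the divisor positive when c = 0.\<close>
  define k where "k = c + 1"
  have k: "k > 0" using c by (simp add: k_def)
  have h: "hermitian_form V a" using a by (simp add: positive_form_def)
  define good where "good = (\<lambda>A. (\<forall>x\<in>hcar V. A x \<in> hcar V) \<and>
    (\<forall>x\<in>hcar V. \<forall>y\<in>hcar V. A (hadd V x y) = hadd V (A x) (A y)) \<and>
    (\<forall>s. \<forall>x\<in>hcar V. A (hscale V s x) = hscale V s (A x)) \<and>
    (\<forall>x\<in>hcar V. \<forall>y\<in>hcar V. hinner V (A x) y = hinner V x (A y)) \<and>
    (\<forall>x\<in>hcar V. 0 \<le> Re (hinner V (A x) x) \<and> Re (hinner V (A x) x) \<le> hsq V x))"
  obtain A0 where A0: "bop V V A0"
    "\<And>x y. x \<in> hcar V \<Longrightarrow> y \<in> hcar V \<Longrightarrow> hinner V (A0 x) y = a x y"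
    using form_operator[OF a bound c] by blast
  define A1 where "A1 = (\<lambda>x. hscale V (of_real (1 / k)) (A0 x))"
  have A0c: "A0 x \<in> hcar V" if "x \<in> hcar V" for x using A0(1) that by (rule bopD)
  have A1i: "hinner V (A1 x) y = of_real (1 / k) * a x y" if "x \<in> hcar V" "y \<in> hcar V" for x y
    using that A0 A0c by (simp add: A1_def)
  have A1r: "hinner V x (A1 y) = of_real (1 / k) * a x y" if "x \<in> hcar V" "y \<in> hcar V" for x y
  proof -
    have "hinner V x (A1 y) = cnj (hinner V (A1 y) x)"
      by (rule inner_cnj) (use that A0c in \<open>auto simp: A1_def\<close>)
    also have "\<dots> = of_real (1 / k) * cnj (a y x)" using A1i[OF that(2,1)] by simp
    also have "cnj (a y x) = a x y" using form_expand(7)[OF h that that(2)] by simp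
    finally show ?thesis .
  qed
  have A1: "good A1"
    unfolding good_def
  proof (intro conjI ballI allI)
    fix x y s assume x: "x \<in> hcar V" and y: "y \<in> hcar V"
    show "A1 x \<in> hcar V" using x A0c by (simp add: A1_def)
    show "A1 (hadd V x y) = hadd V (A1 x) (A1 y)"
      using x y A0(1) A0c by (simp add: A1_def bopD scale_add_right)
    show "A1 (hscale V s x) = hscale V s (A1 x)"
      using x A0(1) A0c by (simp add: A1_def bopD scale_scale mult.commute)
    show "hinner V (A1 x) y = hinner V x (A1 y)" using A1i A1r x y by simp
    show "0 \<le> Re (hinner V (A1 x) x)"
      unfolding A1i[OF x x] using a x k by (simp add: positive_form_def)
    have "Re (a x x) \<le> k * hsq V x" using bound[OF x] hsq_nonneg[OF x] by (simp add: k_def algebra_simps)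
    then show "Re (hinner V (A1 x) x) \<le> hsq V x"
      unfolding A1i[OF x x] using k by (simp add: pos_divide_le_eq mult.commute)
  qed
  define step where "step = (\<lambda>A x. hsub V (A x) (A (A x)))"
  define A where "A = (\<lambda>n. (step ^^ n) A1)"
  have good_step: "good (step B)" if B: "good B" for B
  proof -
    have Bc: "\<And>x. x \<in> hcar V \<Longrightarrow> B x \<in> hcar V"
      and Ba: "\<And>x y. x \<in> hcar V \<Longrightarrow> y \<in> hcar V \<Longrightarrow> B (hadd V x y) = hadd V (B x) (B y)"
      and Bs: "\<And>s x. x \<in> hcar V \<Longrightarrow> B (hscale V s x) = hscale V s (B x)"
      and Bsym: "\<And>x y. x \<in> hcar V \<Longrightarrow> y \<in> hcar V \<Longrightarrow> hinner V (B x) y = hinner V x (B y)"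
      and Bpos: "\<And>x. x \<in> hcar V \<Longrightarrow> 0 \<le> Re (hinner V (B x) x)"
      and Ble: "\<And>x. x \<in> hcar V \<Longrightarrow> Re (hinner V (B x) x) \<le> hsq V x"
      using B unfolding good_def by blast+
    have pf: "positive_form V (\<lambda>x y. hinner V (B x) y)"
      unfolding positive_form_def hermitian_form_def
    proof (intro conjI ballI allI)
      fix x y assume x: "x \<in> hcar V" and y: "y \<in> hcar V"
      show "hinner V (B y) x = cnj (hinner V (B x) y)"
        unfolding Bsym[OF y x] by (rule inner_cnj) (use x y Bc in auto)
    qed (auto simp: Ba Bs Bc Bpos)
    \<comment> \<open>This is \<open>B^2\<close> \<le> B for 0 \<le> B \<le> 1. Cauchy-Schwarz for
      the form of B, at x and B x, bounds ||B x||^4 by the product of the form at x and the form at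
      B x, and the latter is at most ||B x||^2. Hence B - \<open>B^2\<close> is again positive and
      below 1.\<close>
    have key: "hsq V (B x) \<le> Re (hinner V (B x) x)" if x: "x \<in> hcar V" for x
    proof -
      note Bx = Bc[OF x]
      have "hsq V (B x) * hsq V (B x) = (cmod (hinner V (B x) (B x)))\<^sup>2"
        unfolding inner_self[OF Bx] by (simp add: power2_eq_square)
      also have "\<dots> \<le> Re (hinner V (B x) x) * Re (hinner V (B (B x)) (B x))"
        using form_cauchy_schwarz[OF pf x Bx] .
      also have "\<dots> \<le> Re (hinner V (B x) x) * hsq V (B x)"
        using Ble[OF Bx] Bpos[OF x] by (rule mult_left_mono)
      finally have le: "hsq V (B x) * hsq V (B x) \<le> Re (hinner V (B x) x) * hsq V (B x)" .
      show ?thesis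
      proof (cases "hsq V (B x) = 0")
        case True
        then show ?thesis using Bpos[OF x] by simp
      next
        case False
        then have "0 < hsq V (B x)" using hsq_nonneg[OF Bx] by linarith
        with le show ?thesis by (rule mult_right_le_imp_le)
      qed
    qed
    have form: "hinner V (step B x) y = hinner V (B x) y - hinner V (B x) (B y)"
      if "x \<in> hcar V" "y \<in> hcar V" for x y
      using that Bc Bsym[of "B x" y] by (simp add: step_def)
    show ?thesis
      unfolding good_def
    proof (intro conjI ballI allI)
      fix x y s assume x: "x \<in> hcar V" and y: "y \<in> hcar V"
      show "step B x \<in> hcar V" using x Bc by (simp add: step_def)
      show "step B (hadd V x y) = hadd V (step B x) (step B y)"
        using x y by (intro vector_eqI) (auto simp: step_def Ba Bc)
      show "step B (hscale V s x) = hscale V s (step B x)"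
        using x by (intro vector_eqI) (auto simp: step_def Bs Bc algebra_simps)
      show "hinner V (step B x) y = hinner V x (step B y)"
        using x y Bc Bsym[OF x y] Bsym[OF x Bc[OF y]] by (simp add: form) (simp add: step_def)
      have "Re (hinner V (step B x) x) = Re (hinner V (B x) x) - hsq V (B x)"
        using form[OF x x] by (simp add: hsq_def)
      then show "0 \<le> Re (hinner V (step B x) x)" "Re (hinner V (step B x) x) \<le> hsq V x"
        using key[OF x] Ble[OF x] hsq_nonneg[OF Bc[OF x]] by linarith+
    qed
  qed
  have goodA: "good (A n)" for n
    by (induction n) (use A1 good_step in \<open>auto simp: A_def\<close>)
  have Ac: "\<And>n x. x \<in> hcar V \<Longrightarrow> A n x \<in> hcar V"
    and Aa: "\<And>n x y. x \<in> hcar V \<Longrightarrow> y \<in> hcar V \<Longrightarrow> A n (hadd V x y) = hadd V (A n x) (A n y)"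
    and As: "\<And>n s x. x \<in> hcar V \<Longrightarrow> A n (hscale V s x) = hscale V s (A n x)"
    and Asym: "\<And>n x y. x \<in> hcar V \<Longrightarrow> y \<in> hcar V \<Longrightarrow> hinner V (A n x) y = hinner V x (A n y)"
    and Apos: "\<And>n x. x \<in> hcar V \<Longrightarrow> 0 \<le> Re (hinner V (A n x) x)"
    using goodA unfolding good_def by blast+
  have telescope: "(\<Sum>j<n. hinner V (A j x) (A j y)) = hinner V (A1 x) y - hinner V (A n x) y"
    if x: "x \<in> hcar V" and y: "y \<in> hcar V" for x y n
  proof (induction n)
    case (Suc n)
    have "A (Suc n) x = hsub V (A n x) (A n (A n x))" by (simp add: A_def step_def)
    then have "hinner V (A (Suc n) x) y = hinner V (A n x) y - hinner V (A n x) (A n y)"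
      using x y Ac Asym[OF Ac[OF x] y] by simp
    then show ?case using Suc by simp
  qed (simp add: A_def)
  \<comment> \<open>The telescoped diagonal sums are bounded, so the terms ||A n x||^2 are summable
    and tend to 0; this removes the remainder in \<open>telescope\<close>.\<close>
  have null: "(\<lambda>n. hnorm V (A n x)) \<longlonglongrightarrow> 0" if x: "x \<in> hcar V" for x
  proof -
    have "(\<Sum>j<n. hsq V (A j x)) \<le> Re (hinner V (A1 x) x)" for n
    proof -
      have "(\<Sum>j<n. hsq V (A j x)) = Re (\<Sum>j<n. hinner V (A j x) (A j x))" by (simp add: hsq_def)
      then show ?thesis using telescope[OF x x, of n] Apos[OF x, of n] by simp
    qed
    then have "summable (\<lambda>j. hsq V (A j x))"
      by (intro bounded_imp_summable[where B = "Re (hinner V (A1 x) x)"])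
         (auto simp: Ac x lessThan_Suc_atMost[symmetric] simp del: sum.lessThan_Suc)
    from summable_LIMSEQ_zero[OF this] show ?thesis
      using Ac[OF x] hnorm_tendsto_0_iff[of "\<lambda>n. A n x"] by simp
  qed
  have sums1: "(\<lambda>n. hinner V (A n x) (A n y)) sums (of_real (1 / k) * a x y)"
    if x: "x \<in> hcar V" and y: "y \<in> hcar V" for x y
  proof -
    have "(\<lambda>n. hinner V (A n x) y) \<longlonglongrightarrow> 0"
    proof (rule tendsto_zero_comparison)
      show "norm (hinner V (A n x) y) \<le> hnorm V (A n x) * hnorm V y" for n
        using cauchy_schwarz[OF Ac[OF x] y] by simp
      show "(\<lambda>n. hnorm V (A n x) * hnorm V y) \<longlonglongrightarrow> 0"
        using tendsto_mult_left_zero[OF null[OF x]] .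
    qed
    from tendsto_diff[OF tendsto_const[of "hinner V (A1 x) y"] this]
    show ?thesis unfolding sums_def telescope[OF x y] A1i[OF x y] by simp
  qed
  \<comment> \<open>The factor sqrt k undoes the normalisation, since it enters both arguments of
    the inner product.\<close>
  define R where "R = (\<lambda>x n. hscale V (of_real (sqrt k)) (A n x))"
  have "(\<lambda>n. hinner V (R x n) (R y n)) sums a x y" if x: "x \<in> hcar V" and y: "y \<in> hcar V" for x y
  proof -
    have "hinner V (R x n) (R y n) = of_real k * hinner V (A n x) (A n y)" for n
    proof -
      have "complex_of_real (sqrt k) * of_real (sqrt k) = of_real k"
        using k by (simp flip: of_real_mult)
      then show ?thesis using Ac x y by (simp add: R_def mult.assoc[symmetric])
    qed
    then show ?thesis
      using sums_mult[OF sums1[OF x y], of "of_real k"] k by simp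
  qed
  moreover have "R (hscale V s x) n = hscale V s (R x n)" if "x \<in> hcar V" for s x n
    using that by (simp add: R_def As Ac scale_scale mult.commute)
  ultimately show ?thesis
    by (intro exI[of _ R]) (auto simp: R_def Ac Aa scale_add_right)
qed

text \<open>The square expansion is collected into one vector of E. The complex coordinate is set to
  0, as it only serves to enlarge the target.\<close>

lemma form_factorization:
  assumes "positive_form V a" and "\<And>x. x \<in> hcar V \<Longrightarrow> Re (a x x) \<le> c * hsq V x" and "c \<ge> 0"
  shows "\<exists>R. bop V (ell2 (dsum V complex_line)) R \<and>
    (\<forall>x\<in>hcar V. \<forall>y\<in>hcar V. hinner (ell2 (dsum V complex_line)) (R x) (R y) = a x y)"
proof -
  interpret D: complete_space "dsum V complex_line"
    by (intro complete_space_dsum complete_space_axioms complete_space_complex_line)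
  have "\<exists>R. (\<forall>n. \<forall>x\<in>hcar V. R x n \<in> hcar V) \<and>
    (\<forall>n. \<forall>x\<in>hcar V. \<forall>y\<in>hcar V. R (hadd V x y) n = hadd V (R x n) (R y n)) \<and>
    (\<forall>n s. \<forall>x\<in>hcar V. R (hscale V s x) n = hscale V s (R x n)) \<and>
    (\<forall>x\<in>hcar V. \<forall>y\<in>hcar V. (\<lambda>n. hinner V (R x n) (R y n)) sums a x y)" (is "\<exists>R. ?P R")
    by (rule form_square_expansion[OF assms])
  then obtain R where R0: "?P R" ..
  have R: "\<And>n x. x \<in> hcar V \<Longrightarrow> R x n \<in> hcar V"
    "\<And>n x y. x \<in> hcar V \<Longrightarrow> y \<in> hcar V \<Longrightarrow> R (hadd V x y) n = hadd V (R x n) (R y n)"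
    "\<And>n s x. x \<in> hcar V \<Longrightarrow> R (hscale V s x) n = hscale V s (R x n)"
    "\<And>x y. x \<in> hcar V \<Longrightarrow> y \<in> hcar V \<Longrightarrow> (\<lambda>n. hinner V (R x n) (R y n)) sums a x y"
    using R0 by auto
  define Q where "Q = (\<lambda>x n. (R x n, 0::complex))"
  have Qc: "Q x \<in> hcar (ell2 (dsum V complex_line))" if x: "x \<in> hcar V" for x
  proof -
    have "summable (\<lambda>n. Re (hinner V (R x n) (R x n)))"
      using R(4)[OF x x] sums_Re sums_summable by blast
    then show ?thesis using R(1)[OF x] by (simp add: mem_ell2 Q_def hsq_def)
  qed
  have Qi: "hinner (ell2 (dsum V complex_line)) (Q x) (Q y) = a x y"
    if "x \<in> hcar V" "y \<in> hcar V" for x y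
    using R(4)[OF that] by (simp add: hinner_ell2 Q_def sums_iff)
  have "bop V (ell2 (dsum V complex_line)) Q"
  proof (rule bopI[OF inner_space_axioms D.inner_space_ell2 Qc])
    fix x assume x: "x \<in> hcar V"
    then show "hsq (ell2 (dsum V complex_line)) (Q x) \<le> c * hsq V x"
      unfolding hsq_def[of "ell2 _"] Qi[OF x x] by (rule assms(2))
  qed (auto simp: Q_def R)
  then show ?thesis using Qi by blast
qed

end

section \<open>Positive forms\<close>

lemma positive_formI:
  assumes "\<And>x y z. x \<in> hcar V \<Longrightarrow> y \<in> hcar V \<Longrightarrow> z \<in> hcar V \<Longrightarrow> a (hadd V x y) z = a x z + a y z"
    and "\<And>s x y. x \<in> hcar V \<Longrightarrow> y \<in> hcar V \<Longrightarrow> a (hscale V s x) y = s * a x y"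
    and "\<And>x y. x \<in> hcar V \<Longrightarrow> y \<in> hcar V \<Longrightarrow> a y x = cnj (a x y)"
    and "\<And>x. x \<in> hcar V \<Longrightarrow> 0 \<le> Re (a x x)"
  shows "positive_form V a"
  unfolding positive_form_def hermitian_form_def using assms by (intro conjI ballI allI)

lemma hermitian_formD:
  assumes "hermitian_form V a"
  shows "x \<in> hcar V \<Longrightarrow> y \<in> hcar V \<Longrightarrow> z \<in> hcar V \<Longrightarrow> a (hadd V x y) z = a x z + a y z"
    and "x \<in> hcar V \<Longrightarrow> y \<in> hcar V \<Longrightarrow> a (hscale V s x) y = s * a x y"
    and "x \<in> hcar V \<Longrightarrow> y \<in> hcar V \<Longrightarrow> a y x = cnj (a x y)"
  using assms unfolding hermitian_form_def by blast+

lemma positive_formD: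
  assumes "positive_form V a"
  shows "hermitian_form V a" and "x \<in> hcar V \<Longrightarrow> 0 \<le> Re (a x x)"
  using assms unfolding positive_form_def by blast+

lemma positive_form_diff:
  assumes a: "hermitian_form V a" and b: "hermitian_form V b"
    and le: "\<And>x. x \<in> hcar V \<Longrightarrow> Re (b x x) \<le> Re (a x x)"
  shows "positive_form V (\<lambda>x y. a x y - b x y)"
proof (rule positive_formI)
  fix x y assume x: "x \<in> hcar V" and y: "y \<in> hcar V"
  show "a y x - b y x = cnj (a x y - b x y)"
    unfolding hermitian_formD(3)[OF a x y] hermitian_formD(3)[OF b x y] by simp
qed (use le in \<open>simp_all add: hermitian_formD(1,2)[OF a] hermitian_formD(1,2)[OF b] algebra_simps\<close>)

lemma positive_form_scale:
  assumes a: "positive_form V a" and c: "c \<ge> 0"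
  shows "positive_form V (\<lambda>x y. of_real c * a x y)"
proof (rule positive_formI)
  note h = positive_formD(1)[OF a]
  fix x y assume x: "x \<in> hcar V" and y: "y \<in> hcar V"
  show "of_real c * a y x = cnj (of_real c * a x y)"
    unfolding hermitian_formD(3)[OF h x y] by simp
qed (use positive_formD(2)[OF a] c in
    \<open>simp_all add: hermitian_formD(1,2)[OF positive_formD(1)[OF a]] algebra_simps\<close>)

lemma positive_form_compose:
  assumes a: "positive_form W a" and T: "bop V W T"
  shows "positive_form V (\<lambda>x y. a (T x) (T y))"
proof (rule positive_formI)
  note h = positive_formD(1)[OF a]
  fix x y assume x: "x \<in> hcar V" and y: "y \<in> hcar V"
  show "a (T y) (T x) = cnj (a (T x) (T y))"
    by (rule hermitian_formD(3)[OF h bopD(1)[OF T x] bopD(1)[OF T y]])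
qed (simp_all add: hermitian_formD(1,2)[OF positive_formD(1)[OF a]] positive_formD(2)[OF a] bopD[OF T])

context inner_space
begin

lemma form_cauchy_schwarz_sqrt:
  assumes "positive_form V a" "x \<in> hcar V" "y \<in> hcar V"
  shows "cmod (a x y) \<le> sqrt (Re (a x x)) * sqrt (Re (a y y))"
  using form_cauchy_schwarz[OF assms] by (simp add: real_le_rsqrt flip: real_sqrt_mult)

text \<open>The extension is \<open>p\<close> composed with the \<open>f\<close>-orthogonal projection onto \<open>L\<close>. As \<open>f\<close> may be
  degenerate and \<open>L\<close> need not be complete for it, the projection of a vector exists only as an
  \<open>f\<close>-Cauchy sequence in \<open>L\<close>.\<close>

lemma positive_form_extension:
  assumes f: "positive_form V f" and L: "linear_subspace V L"
    and p: "positive_form (restrict_space V L) p"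
    and pf: "\<And>x. x \<in> L \<Longrightarrow> Re (p x x) \<le> Re (f x x)"
  shows "\<exists>q. positive_form V q \<and> (\<forall>x\<in>hcar V. Re (q x x) \<le> Re (f x x)) \<and> (\<forall>x\<in>L. \<forall>y\<in>L. q x y = p x y)"
proof -
  interpret L: inner_space "restrict_space V L"
    using inner_space_axioms L by (rule inner_space_restrict)
  have fh: "hermitian_form V f" and ph: "hermitian_form (restrict_space V L) p"
    using f p by (auto simp: positive_form_def)
  have LV: "x \<in> hcar V" if "x \<in> L" for x using L that by (auto simp: linear_subspace_def)
  have Lsub: "hsub V x y \<in> L" if "x \<in> L" "y \<in> L" for x y using L.sub_closed[of x y] that by simp
  have Ladd: "hadd V x y \<in> L" if "x \<in> L" "y \<in> L" for x y using L.add_closed[of x y] that by simp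
  have Lscale: "hscale V s x \<in> L" if "x \<in> L" for s x using L.scale_closed[of x s] that by simp
  note p_expand = L.form_expand[OF ph, simplified]
  define s where "s = (\<lambda>x. sqrt (Re (f x x)))"
  have fpos: "0 \<le> Re (f x x)" if "x \<in> hcar V" for x using f that by (simp add: positive_form_def)
  have s_nonneg: "0 \<le> s x" if "x \<in> hcar V" for x using fpos[OF that] by (simp add: s_def)
  have s_sq: "s x * s x = Re (f x x)" if "x \<in> hcar V" for x using fpos[OF that] by (simp add: s_def)
  have f_self: "cmod (f x x) = s x * s x" if "x \<in> hcar V" for x
  proof -
    have "f x x = of_real (Re (f x x))" using form_expand(8)[OF fh that that that] by (simp add: complex_eq_iff)
    then have "cmod (f x x) = \<bar>Re (f x x)\<bar>" by (metis norm_of_real)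
    then show ?thesis using fpos[OF that] s_sq[OF that] by simp
  qed
  have p_le: "cmod (p x y) \<le> s x * s y" if x: "x \<in> L" and y: "y \<in> L" for x y
  proof -
    have "cmod (p x y) \<le> sqrt (Re (p x x)) * sqrt (Re (p y y))"
      using L.form_cauchy_schwarz_sqrt[OF p] x y by simp
    also have "\<dots> \<le> s x * s y"
      unfolding s_def using p pf[OF x] pf[OF y] x y fpos[OF LV[OF x]]
      by (intro mult_mono real_sqrt_le_mono) (auto simp: positive_form_def)
    finally show ?thesis .
  qed
  define e where "e = (\<lambda>n. sqrt (1 / real (Suc n)))"
  have e0: "e \<longlonglongrightarrow> 0"
    using tendsto_real_sqrt[OF LIMSEQ_inverse_real_of_nat] by (simp add: e_def divide_inverse)
  have e_nonneg: "0 \<le> e n" and e_le: "e n \<le> 1" for n by (simp_all add: e_def)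
  \<comment> \<open>\<open>app K y l\<close> says that l approximates the f-projection of y onto L,
    tested against vectors of L, with error K e_n. The constant K is kept variable because sums and
    multiples of such sequences have larger errors, while vectors of L itself admit K = 0.\<close>
  define app where "app = (\<lambda>K y l. (\<forall>n. l n \<in> L) \<and> (\<forall>n. \<forall>x\<in>L. cmod (f x y - f x (l n)) \<le> K * e n * s x))"
  have appL: "l n \<in> L" if "app K y l" for K y l n using that by (simp add: app_def)
  have appD: "cmod (f x y - f x (l n)) \<le> K * e n * s x" if "app K y l" "x \<in> L" for K y l n x
    using that by (simp add: app_def)
  have app_mono: "app K' y l" if "app K y l" "K \<le> K'" for K K' y l
    unfolding app_def
  proof (intro conjI allI ballI)
    show "l n \<in> L" for n using that by (simp add: app_def)
    fix n x assume x: "x \<in> L"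
    have "cmod (f x y - f x (l n)) \<le> K * e n * s x" using that x by (simp add: app_def)
    also have "\<dots> \<le> K' * e n * s x"
      using that(2) e_nonneg s_nonneg[OF LV[OF x]] by (intro mult_right_mono) auto
    finally show "cmod (f x y - f x (l n)) \<le> K' * e n * s x" .
  qed
  have app_ex: "\<exists>l. app 1 y l" if y: "y \<in> hcar V" for y
  proof -
    have "\<exists>l. \<forall>n. l n \<in> L \<and> (\<forall>x\<in>L. (cmod (f x y - f x (l n)))\<^sup>2 \<le> 1 / real (Suc n) * Re (f x x))"
    proof (rule approximate_riesz[OF f L, where \<phi> = "\<lambda>x. f x y" and C = "Re (f y y)"])
      fix x assume x: "x \<in> L"
      show "(cmod (f x y))\<^sup>2 \<le> Re (f y y) * Re (f x x)"
        using form_cauchy_schwarz[OF f LV[OF x] y] by (simp add: mult.commute)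
    qed (use y LV form_expand(1,3)[OF fh] fpos in auto)
    then obtain l where l: "\<And>n. l n \<in> L"
      "\<And>n x. x \<in> L \<Longrightarrow> (cmod (f x y - f x (l n)))\<^sup>2 \<le> 1 / real (Suc n) * Re (f x x)" by blast
    have "cmod (f x y - f x (l n)) \<le> 1 * e n * s x" if "x \<in> L" for n x
      using real_sqrt_le_mono[OF l(2)[OF that, of n]] by (simp add: e_def s_def real_sqrt_mult real_sqrt_divide)
    then show ?thesis using l(1) by (auto simp: app_def)
  qed
  \<comment> \<open>Up to the error, a projection does not increase the f-norm; the test vector is
    \<open>l n\<close> itself.\<close>
  have app_norm: "s (l n) \<le> s y + K * e n" if a: "app K y l" and y: "y \<in> hcar V" and K: "K \<ge> 0" for K y l n
  proof -
    have l: "l n \<in> L" using a by (rule appL)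
    note lV = LV[OF l]
    have "s (l n) * s (l n) = cmod (f (l n) (l n))" using f_self[OF lV] by simp
    also have "\<dots> \<le> cmod (f (l n) y) + cmod (f (l n) y - f (l n) (l n))"
      using norm_triangle_ineq4[of "f (l n) y" "f (l n) y - f (l n) (l n)"] by simp
    also have "\<dots> \<le> s (l n) * s y + K * e n * s (l n)"
      using form_cauchy_schwarz_sqrt[OF f lV y] appD[OF a l, of n] unfolding s_def by (rule add_mono)
    also have "\<dots> = (s y + K * e n) * s (l n)" by (simp add: algebra_simps)
    finally have le: "s (l n) * s (l n) \<le> (s y + K * e n) * s (l n)" .
    show ?thesis
    proof (cases "s (l n) = 0")
      case True
      then show ?thesis using s_nonneg[OF y] K e_nonneg[of n] by simp
    next
      case False
      then have "0 < s (l n)" using s_nonneg[OF lV] by linarith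
      with le show ?thesis by (rule mult_right_le_imp_le)
    qed
  qed
  \<comment> \<open>Testing both approximations with their own difference shows that they are
    f-close, whichever sequences were chosen for y.\<close>
  have app_diff: "s (hsub V (l n) (l' k)) \<le> K * (e n + e k)"
    if a: "app K y l" "app K y l'" and y: "y \<in> hcar V" and K: "K \<ge> 0" for K y l l' n k
  proof -
    let ?d = "hsub V (l n) (l' k)"
    have lL: "l n \<in> L" "l' k \<in> L" using a appL by auto
    have dL: "?d \<in> L" using lL by (rule Lsub)
    note dV = LV[OF dL]
    have "f ?d ?d = (f ?d y - f ?d (l' k)) - (f ?d y - f ?d (l n))"
      using form_expand(6)[OF fh LV[OF lL(1)] LV[OF lL(2)] dV] by simp
    then have "s ?d * s ?d \<le> cmod (f ?d y - f ?d (l' k)) + cmod (f ?d y - f ?d (l n))"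
      using norm_triangle_ineq4[of "f ?d y - f ?d (l' k)" "f ?d y - f ?d (l n)"] f_self[OF dV] by simp
    also have "\<dots> \<le> K * e k * s ?d + K * e n * s ?d"
      using appD[OF a(2) dL] appD[OF a(1) dL] by (rule add_mono)
    also have "\<dots> = (K * (e n + e k)) * s ?d" by (simp add: algebra_simps)
    finally have le: "s ?d * s ?d \<le> (K * (e n + e k)) * s ?d" .
    show ?thesis
    proof (cases "s ?d = 0")
      case True
      then show ?thesis using K e_nonneg[of n] e_nonneg[of k] by simp
    next
      case False
      then have "0 < s ?d" using s_nonneg[OF dV] by linarith
      with le show ?thesis by (rule mult_right_le_imp_le)
    qed
  qed
  \<comment> \<open>Since p is dominated by f on L, f-closeness of the arguments gives closeness of
    the values of p. This single estimate yields both existence of the limit and its independence of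
    the sequences.\<close>
  have app_compare: "cmod (p (l n) (m n) - p (l' k) (m' k)) \<le> (K * (s z + K) + (s y + K) * K) * (e n + e k)"
    if a: "app K y l" "app K y l'" "app K z m" "app K z m'" and y: "y \<in> hcar V" and z: "z \<in> hcar V"
      and K: "K \<ge> 0" for K y z l l' m m' n k
  proof -
    have LL: "l n \<in> L" "l' k \<in> L" "m n \<in> L" "m' k \<in> L" using a appL by auto
    let ?d = "hsub V (l n) (l' k)" and ?d' = "hsub V (m n) (m' k)"
    have dL: "?d \<in> L" "?d' \<in> L" using LL Lsub by auto
    have ee: "0 \<le> e n + e k" using e_nonneg[of n] e_nonneg[of k] by linarith
    have sm: "s (m n) \<le> s z + K"
      using app_norm[OF a(3) z K, of n] mult_left_mono[OF e_le[of n] K] by simp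
    have sl: "s (l' k) \<le> s y + K"
      using app_norm[OF a(2) y K, of k] mult_left_mono[OF e_le[of k] K] by simp
    have "p (l n) (m n) - p (l' k) (m' k) = p ?d (m n) + p (l' k) ?d'"
      using LL p_expand(5)[of "l n" "l' k" "m n"] p_expand(6)[of "m n" "m' k" "l' k"] by simp
    then have "cmod (p (l n) (m n) - p (l' k) (m' k)) \<le> cmod (p ?d (m n)) + cmod (p (l' k) ?d')"
      by (simp add: norm_triangle_ineq)
    also have "\<dots> \<le> s ?d * s (m n) + s (l' k) * s ?d'"
      using p_le dL LL by (intro add_mono) auto
    also have "\<dots> \<le> (K * (e n + e k)) * (s z + K) + (s y + K) * (K * (e n + e k))"
      using app_diff[OF a(1,2) y K, of n k] app_diff[OF a(3,4) z K, of n k] sm sl K ee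
        s_nonneg[OF LV[OF LL(3)]] s_nonneg[OF y] s_nonneg[OF LV[OF dL(2)]]
      by (intro add_mono mult_mono) auto
    also have "\<dots> = (K * (s z + K) + (s y + K) * K) * (e n + e k)" by (simp add: algebra_simps)
    finally show ?thesis .
  qed
  define P where "P = (\<lambda>y. SOME l. app 1 y l)"
  have P: "app 1 y (P y)" if "y \<in> hcar V" for y
    unfolding P_def using app_ex[OF that] by (rule someI_ex)
  define q where "q = (\<lambda>y z. lim (\<lambda>n. p (P y n) (P z n)))"
  have q_lim: "(\<lambda>n. p (l n) (m n)) \<longlonglongrightarrow> q y z"
    if a: "app K y l" "app K' z m" and y: "y \<in> hcar V" and z: "z \<in> hcar V" for K K' y z l m
  proof -
    \<comment> \<open>One constant above K, K' and the 1 used for \<open>P\<close>, so that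
      \<open>app_compare\<close> applies to the given and to the chosen sequences at once.\<close>
    define M where "M = max 1 (max K K')"
    have M: "M \<ge> 0" by (simp add: M_def)
    have A: "app M y l" "app M z m" "app M y (P y)" "app M z (P z)"
      using app_mono[OF a(1)] app_mono[OF a(2)] app_mono[OF P[OF y]] app_mono[OF P[OF z]]
      by (auto simp: M_def)
    define C where "C = M * (s z + M) + (s y + M) * M"
    have C: "C \<ge> 0" using M s_nonneg[OF y] s_nonneg[OF z] by (simp add: C_def)
    have "Cauchy (\<lambda>n. p (P y n) (P z n))"
    proof (rule metric_CauchyI)
      fix r :: real assume r: "r > 0"
      have "(\<lambda>n. C * e n) \<longlonglongrightarrow> 0" using tendsto_mult_right_zero[OF e0] .
      then obtain N where N: "\<And>n. n \<ge> N \<Longrightarrow> C * e n < r / 2"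
        using order_tendstoD(2)[of _ 0 sequentially "r/2"] r by (auto simp: eventually_sequentially)
      have "dist (p (P y n) (P z n)) (p (P y k) (P z k)) < r" if "n \<ge> N" "k \<ge> N" for n k
        using app_compare[OF A(3,3,4,4) y z M, of n k] N[OF that(1)] N[OF that(2)]
        unfolding C_def[symmetric] dist_norm by (simp add: distrib_left)
      then show "\<exists>N. \<forall>n\<ge>N. \<forall>k\<ge>N. dist (p (P y n) (P z n)) (p (P y k) (P z k)) < r" by blast
    qed
    then have lim: "(\<lambda>n. p (P y n) (P z n)) \<longlonglongrightarrow> q y z"
      unfolding q_def using Cauchy_convergent convergent_LIMSEQ_iff by blast
    have "(\<lambda>n. p (l n) (m n) - p (P y n) (P z n)) \<longlonglongrightarrow> 0"
    proof (rule tendsto_zero_comparison)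
      show "norm (p (l n) (m n) - p (P y n) (P z n)) \<le> C * (e n + e n)" for n
        using app_compare[OF A(1,3,2,4) y z M, of n n] unfolding C_def .
      show "(\<lambda>n. C * (e n + e n)) \<longlonglongrightarrow> 0"
        using tendsto_mult_right_zero[OF tendsto_add_zero[OF e0 e0]] .
    qed
    from tendsto_add[OF this lim] show ?thesis by simp
  qed
  have q_P: "(\<lambda>n. p (P y n) (P z n)) \<longlonglongrightarrow> q y z" if "y \<in> hcar V" "z \<in> hcar V" for y z
    using q_lim[OF P P] that by blast
  have PL: "P y n \<in> L" if "y \<in> hcar V" for y n using P[OF that] by (rule appL)
  \<comment> \<open>The sum of the chosen sequences need not be the sequence chosen for the sum, but
    it is admissible with doubled error; \<open>q_lim\<close> then makes q additive.\<close>
  have app_add: "app (1 + 1) (hadd V y z) (\<lambda>n. hadd V (P y n) (P z n))" if y: "y \<in> hcar V" and z: "z \<in> hcar V" for y z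
    unfolding app_def
  proof (intro conjI allI ballI)
    fix n show "hadd V (P y n) (P z n) \<in> L" using y z PL Ladd by simp
    fix x assume x: "x \<in> L"
    have "f x (hadd V y z) - f x (hadd V (P y n) (P z n)) = (f x y - f x (P y n)) + (f x z - f x (P z n))"
      using y z PL LV x by (simp add: form_expand(2)[OF fh])
    then have "cmod (f x (hadd V y z) - f x (hadd V (P y n) (P z n)))
        \<le> cmod (f x y - f x (P y n)) + cmod (f x z - f x (P z n))"
      by (simp only: norm_triangle_ineq)
    then show "cmod (f x (hadd V y z) - f x (hadd V (P y n) (P z n))) \<le> (1 + 1) * e n * s x"
      using appD[OF P[OF y] x, of n] appD[OF P[OF z] x, of n] by (simp only: distrib_right)
  qed
  have app_scale: "app (cmod r) (hscale V r y) (\<lambda>n. hscale V r (P y n))" if y: "y \<in> hcar V" for r y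
    unfolding app_def
  proof (intro conjI allI ballI)
    fix n show "hscale V r (P y n) \<in> L" using y PL Lscale by simp
    fix x assume x: "x \<in> L"
    have "f x (hscale V r y) - f x (hscale V r (P y n)) = cnj r * (f x y - f x (P y n))"
      using y PL LV x by (simp add: form_expand(4)[OF fh] right_diff_distrib)
    then show "cmod (f x (hscale V r y) - f x (hscale V r (P y n))) \<le> cmod r * e n * s x"
      using mult_left_mono[OF appD[OF P[OF y] x, of n], of "cmod r"] by (simp add: norm_mult mult.assoc)
  qed
  have "positive_form V q"
  proof (rule positive_formI)
    fix x y z assume x: "x \<in> hcar V" and y: "y \<in> hcar V" and z: "z \<in> hcar V"
    have "(\<lambda>n. p (hadd V (P x n) (P y n)) (P z n)) \<longlonglongrightarrow> q (hadd V x y) z"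
      using q_lim[OF app_add[OF x y] P[OF z]] x y z by simp
    moreover have "(\<lambda>n. p (hadd V (P x n) (P y n)) (P z n)) \<longlonglongrightarrow> q x z + q y z"
      using tendsto_add[OF q_P[OF x z] q_P[OF y z]] by (simp add: p_expand(1) PL x y z)
    ultimately show "q (hadd V x y) z = q x z + q y z" by (rule LIMSEQ_unique)
  next
    fix r x y assume x: "x \<in> hcar V" and y: "y \<in> hcar V"
    have "(\<lambda>n. p (hscale V r (P x n)) (P y n)) \<longlonglongrightarrow> q (hscale V r x) y"
      using q_lim[OF app_scale[OF x] P[OF y]] x y by simp
    moreover have "(\<lambda>n. p (hscale V r (P x n)) (P y n)) \<longlonglongrightarrow> r * q x y"
    proof -
      have "p (hscale V r (P x n)) (P y n) = r * p (P x n) (P y n)" for n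
        using p_expand(3)[OF PL[OF x] PL[OF y] PL[OF y]] .
      then show ?thesis using tendsto_mult[OF tendsto_const[of r] q_P[OF x y]] by simp
    qed
    ultimately show "q (hscale V r x) y = r * q x y" by (rule LIMSEQ_unique)
  next
    fix x y assume x: "x \<in> hcar V" and y: "y \<in> hcar V"
    have "p (P y n) (P x n) = cnj (p (P x n) (P y n))" for n
      using p_expand(7)[OF PL[OF y] PL[OF x] PL[OF x]] .
    then have "(\<lambda>n. p (P y n) (P x n)) \<longlonglongrightarrow> cnj (q x y)"
      using tendsto_cnj[OF q_P[OF x y]] by simp
    with q_P[OF y x] show "q y x = cnj (q x y)" by (rule LIMSEQ_unique)
  next
    fix x assume x: "x \<in> hcar V"
    show "0 \<le> Re (q x x)"
      using p PL[OF x] by (intro LIMSEQ_le_const[OF tendsto_Re[OF q_P[OF x x]]]) (auto simp: positive_form_def)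
  qed
  moreover have "Re (q x x) \<le> Re (f x x)" if x: "x \<in> hcar V" for x
  proof -
    have "(\<lambda>n. (s x + 1 * e n) * (s x + 1 * e n)) \<longlonglongrightarrow> (s x + 1 * 0) * (s x + 1 * 0)"
      by (intro tendsto_intros e0)
    moreover have "Re (p (P x n) (P x n)) \<le> (s x + 1 * e n) * (s x + 1 * e n)" for n
    proof -
      note l = PL[OF x, of n]
      have "Re (p (P x n) (P x n)) \<le> s (P x n) * s (P x n)" using pf[OF l] s_sq[OF LV[OF l]] by simp
      also have "\<dots> \<le> (s x + 1 * e n) * (s x + 1 * e n)"
        using app_norm[OF P[OF x] x, of n] s_nonneg[OF LV[OF l]] s_nonneg[OF x] e_nonneg[of n]
        by (intro mult_mono) auto
      finally show ?thesis .
    qed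
    ultimately have "Re (q x x) \<le> (s x + 1 * 0) * (s x + 1 * 0)"
      using tendsto_Re[OF q_P[OF x x]] LIMSEQ_le by blast
    then show ?thesis using s_sq[OF x] by simp
  qed
  moreover have "q x y = p x y" if x: "x \<in> L" and y: "y \<in> L" for x y
  proof -
    \<comment> \<open>A vector of L is its own projection: the constant sequence has error 0, so q
      agrees with p there.\<close>
    have "app 0 x (\<lambda>n. x)" "app 0 y (\<lambda>n. y)" using x y by (auto simp: app_def)
    from q_lim[OF this LV[OF x] LV[OF y]] have "(\<lambda>n::nat. p x y) \<longlonglongrightarrow> q x y" .
    then show ?thesis using LIMSEQ_unique tendsto_const by blast
  qed
  ultimately show ?thesis by blast
qed

end

section \<open>Enlarging a form to one invariant under an expansive operator\<close>

context complete_space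
begin

text \<open>On the range of T, q' is forced to equal q at the preimages, so p = c - q' is known
  there. \<open>qc\<close> and expansiveness give q(x,x) \<le> c ||x||^2 \<le> c ||T x||^2, that is,
  p \<ge> 0; \<open>dec\<close> gives p \<le> c - q, the domination needed to extend p to all of
  H.\<close>

lemma form_shift_step:
  assumes T: "bop V V T" and expansive: "\<And>x. x \<in> hcar V \<Longrightarrow> hsq V x \<le> hsq V (T x)"
    and q: "positive_form V q" and c: "c \<ge> 0"
    and qc: "\<And>x. x \<in> hcar V \<Longrightarrow> Re (q x x) \<le> c * hsq V x"
    and dec: "\<And>x. x \<in> hcar V \<Longrightarrow> Re (q (T x) (T x)) \<le> Re (q x x)"
  shows "\<exists>q'. positive_form V q' \<and> (\<forall>x\<in>hcar V. Re (q x x) \<le> Re (q' x x) \<and> Re (q' x x) \<le> c * hsq V x) \<and>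
    (\<forall>x\<in>hcar V. \<forall>y\<in>hcar V. q' (T x) (T y) = q x y)"
proof -
  let ?ci = "\<lambda>x y. of_real c * hinner V x y"
  have ci: "positive_form V ?ci" using positive_form_inner c by (rule positive_form_scale)
  note qh = positive_formD(1)[OF q] and cih = positive_formD(1)[OF ci]
  note Tc = bopD(1)[OF T]
  define f where "f = (\<lambda>x y. ?ci x y - q x y)"
  have f: "positive_form V f"
    unfolding f_def using qc by (intro positive_form_diff cih qh) (simp add: hsq_def)
  \<comment> \<open>Expansiveness forces T to be injective, so p can be defined on the range through
    preimages.\<close>
  have inj: "inj_on T (hcar V)"
  proof (rule inj_onI)
    fix x y assume x: "x \<in> hcar V" and y: "y \<in> hcar V" and eq: "T x = T y"
    have "T (hsub V x y) = hsub V (T x) (T x)" using bop_sub[OF T inner_space_axioms x y] eq by simp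
    also have "\<dots> = hzero V" using Tc[OF x] by (intro vector_eqI) auto
    finally have "hsq V (T (hsub V x y)) = 0" by simp
    then have "hsq V (hsub V x y) = 0"
      using expansive[OF sub_closed[OF x y]] hsq_nonneg[OF sub_closed[OF x y]] by linarith
    then have "hsub V x y = hzero V" using x y by (intro hsq_eq_0) auto
    then have "hinner V (hsub V x y) z = 0" if "z \<in> hcar V" for z using that by simp
    then show "x = y" using x y by (intro vector_eqI) auto
  qed
  define L where "L = T ` hcar V"
  define S where "S = inv_into (hcar V) T"
  have ST: "S (T x) = x" if "x \<in> hcar V" for x using inj that by (simp add: S_def)
  have L: "linear_subspace V L"
    unfolding linear_subspace_def
  proof (intro conjI ballI allI)
    show "L \<subseteq> hcar V" using Tc by (auto simp: L_def)
    show "hzero V \<in> L"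
      unfolding L_def using bop_zero[OF T inner_space_axioms inner_space_axioms]
      by (intro image_eqI[of _ _ "hzero V"]) auto
    fix u assume "u \<in> L"
    then obtain x where x: "x \<in> hcar V" "u = T x" by (auto simp: L_def)
    show "hscale V s u \<in> L" for s
      unfolding L_def using x bopD(3)[OF T x(1)] by (intro image_eqI[of _ _ "hscale V s x"]) auto
    fix v assume "v \<in> L"
    then obtain y where y: "y \<in> hcar V" "v = T y" by (auto simp: L_def)
    show "hadd V u v \<in> L"
      unfolding L_def using x y bopD(2)[OF T x(1) y(1)] by (intro image_eqI[of _ _ "hadd V x y"]) auto
  qed
  define p where "p = (\<lambda>u v. ?ci u v - q (S u) (S v))"
  have pT: "p (T x) (T y) = ?ci (T x) (T y) - q x y" if "x \<in> hcar V" "y \<in> hcar V" for x y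
    using that by (simp add: p_def ST)
  have "positive_form (restrict_space V L) p"
  proof (rule positive_formI; simp only: restrict_space_simps)
    fix u v w assume "u \<in> L" "v \<in> L" "w \<in> L"
    then obtain x y z where xyz: "x \<in> hcar V" "y \<in> hcar V" "z \<in> hcar V" "u = T x" "v = T y" "w = T z"
      by (auto simp: L_def)
    have "p (hadd V u v) w = p (T (hadd V x y)) (T z)" using xyz bopD(2)[OF T] by simp
    also have "\<dots> = p u w + p v w"
      unfolding xyz(4-6) pT[OF add_closed[OF xyz(1,2)] xyz(3)] pT[OF xyz(1,3)] pT[OF xyz(2,3)]
      unfolding bopD(2)[OF T xyz(1,2)] hermitian_formD(1)[OF qh xyz(1-3)]
      using xyz(1-3) Tc by (simp add: algebra_simps)
    finally show "p (hadd V u v) w = p u w + p v w" .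
  next
    fix s u v assume "u \<in> L" "v \<in> L"
    then obtain x y where xy: "x \<in> hcar V" "y \<in> hcar V" "u = T x" "v = T y"
      by (auto simp: L_def)
    have "p (hscale V s u) v = p (T (hscale V s x)) (T y)" using xy bopD(3)[OF T] by simp
    also have "\<dots> = s * p u v"
      unfolding xy(3-4) pT[OF scale_closed[OF xy(1)] xy(2)] pT[OF xy(1,2)]
      unfolding bopD(3)[OF T xy(1)] hermitian_formD(2)[OF qh xy(1,2)]
      using xy(1,2) Tc by (simp add: algebra_simps)
    finally show "p (hscale V s u) v = s * p u v" .
  next
    fix u v assume "u \<in> L" "v \<in> L"
    then obtain x y where xy: "x \<in> hcar V" "y \<in> hcar V" "u = T x" "v = T y"
      by (auto simp: L_def)
    show "p v u = cnj (p u v)"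
      unfolding xy(3-4) pT[OF xy(2,1)] pT[OF xy(1,2)] hermitian_formD(3)[OF qh xy(1,2)]
        inner_cnj[OF Tc[OF xy(1)] Tc[OF xy(2)]] by simp
  next
    fix u assume "u \<in> L"
    then obtain x where x: "x \<in> hcar V" "u = T x" by (auto simp: L_def)
    have "Re (q x x) \<le> c * hsq V (T x)"
      using qc[OF x(1)] mult_left_mono[OF expansive[OF x(1)] c] by linarith
    then show "0 \<le> Re (p u u)" unfolding x(2) pT[OF x(1,1)] by (simp add: hsq_def)
  qed
  moreover have "Re (p u u) \<le> Re (f u u)" if "u \<in> L" for u
  proof -
    obtain x where x: "x \<in> hcar V" "u = T x" using \<open>u \<in> L\<close> by (auto simp: L_def)
    show ?thesis unfolding x(2) pT[OF x(1,1)] f_def using dec[OF x(1)] by simp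
  qed
  ultimately obtain p' where p': "positive_form V p'" "\<And>x. x \<in> hcar V \<Longrightarrow> Re (p' x x) \<le> Re (f x x)"
    "\<And>u v. u \<in> L \<Longrightarrow> v \<in> L \<Longrightarrow> p' u v = p u v"
    using positive_form_extension[OF f L] by blast
  define q' where "q' = (\<lambda>x y. ?ci x y - p' x y)"
  have qq': "Re (q x x) \<le> Re (q' x x)" if "x \<in> hcar V" for x
    using p'(2)[OF that] by (simp add: q'_def f_def)
  have "positive_form V q'"
    unfolding q'_def
  proof (rule positive_form_diff[OF cih positive_formD(1)[OF p'(1)]])
    fix x assume x: "x \<in> hcar V"
    show "Re (p' x x) \<le> Re (?ci x x)" using p'(2)[OF x] positive_formD(2)[OF q x] by (simp add: f_def)
  qed
  moreover have "Re (q' x x) \<le> c * hsq V x" if "x \<in> hcar V" for x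
    using positive_formD(2)[OF p'(1) that] by (simp add: q'_def hsq_def)
  moreover have "q' (T x) (T y) = q x y" if "x \<in> hcar V" "y \<in> hcar V" for x y
  proof -
    have "p' (T x) (T y) = p (T x) (T y)" using that by (intro p'(3)) (auto simp: L_def)
    then show ?thesis by (simp add: q'_def pT[OF that])
  qed
  ultimately show ?thesis using qq' by blast
qed

text \<open>Transfers convergence from the diagonal to the whole form. The imaginary part comes from
  Re a(x, \<i> y) = Im a(x,y), the form being conjugate linear in the second argument.\<close>

lemma form_polarization:
  assumes a: "hermitian_form V a" and x: "x \<in> hcar V" and y: "y \<in> hcar V"
  shows "a x y = Complex
    ((Re (a (hadd V x y) (hadd V x y)) - Re (a (hsub V x y) (hsub V x y))) / 4)
    ((Re (a (hadd V x (hscale V \<i> y)) (hadd V x (hscale V \<i> y))) -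
      Re (a (hsub V x (hscale V \<i> y)) (hsub V x (hscale V \<i> y)))) / 4)"
  using x y hermitian_formD(3)[OF a x y]
  by (simp add: form_expand(1-6)[OF a] complex_eq_iff algebra_simps)

text \<open>On the diagonal the sequence is increasing and bounded; polarization extends convergence
  to all pairs, and the form axioms pass to pointwise limits.\<close>

lemma monotone_form_limit:
  assumes Q: "\<And>n. positive_form V (Q n)"
    and mono: "\<And>n x. x \<in> hcar V \<Longrightarrow> Re (Q n x x) \<le> Re (Q (Suc n) x x)"
    and bound: "\<And>n x. x \<in> hcar V \<Longrightarrow> Re (Q n x x) \<le> c * hsq V x"
  shows "\<exists>q. positive_form V q \<and> (\<forall>x\<in>hcar V. \<forall>y\<in>hcar V. (\<lambda>n. Q n x y) \<longlonglongrightarrow> q x y)"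
proof -
  have diag: "convergent (\<lambda>n. Re (Q n x x))" if x: "x \<in> hcar V" for x
  proof -
    have "incseq (\<lambda>n. Re (Q n x x))" using mono[OF x] by (intro incseq_SucI)
    then obtain L where "(\<lambda>n. Re (Q n x x)) \<longlonglongrightarrow> L"
      using bound[OF x] incseq_convergent by blast
    then show ?thesis by (rule convergentI)
  qed
  have "convergent (\<lambda>n. Q n x y)" if x: "x \<in> hcar V" and y: "y \<in> hcar V" for x y
  proof -
    have *: "(\<lambda>n. Re (Q n z z)) \<longlonglongrightarrow> lim (\<lambda>n. Re (Q n z z))" if "z \<in> hcar V" for z
      using diag[OF that] convergent_LIMSEQ_iff by blast
    have i: "hscale V \<i> y \<in> hcar V" using y by simp
    show ?thesis
      unfolding form_polarization[OF positive_formD(1)[OF Q] x y]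
      by (rule convergentI[OF tendsto_Complex[
            OF tendsto_divide[OF tendsto_diff[OF * *] tendsto_const] tendsto_divide[OF tendsto_diff[OF * *] tendsto_const]]])
         (use x y i in auto)
  qed
  then have "\<exists>q. \<forall>x\<in>hcar V. \<forall>y\<in>hcar V. (\<lambda>n. Q n x y) \<longlonglongrightarrow> q x y"
    using convergent_LIMSEQ_iff by (intro exI[of _ "\<lambda>x y. lim (\<lambda>n. Q n x y)"]) blast
  then obtain q where lim: "\<And>x y. x \<in> hcar V \<Longrightarrow> y \<in> hcar V \<Longrightarrow> (\<lambda>n. Q n x y) \<longlonglongrightarrow> q x y"
    by blast
  have "positive_form V q"
  proof (rule positive_formI)
    fix x y z assume x: "x \<in> hcar V" and y: "y \<in> hcar V" and z: "z \<in> hcar V"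
    have "Q n (hadd V x y) z = Q n x z + Q n y z" for n
      using hermitian_formD(1)[OF positive_formD(1)[OF Q] x y z] .
    then have "(\<lambda>n. Q n (hadd V x y) z) \<longlonglongrightarrow> q x z + q y z"
      using tendsto_add[OF lim[OF x z] lim[OF y z]] by simp
    with lim[of "hadd V x y" z] x y z show "q (hadd V x y) z = q x z + q y z"
      using LIMSEQ_unique by blast
  next
    fix s x y assume x: "x \<in> hcar V" and y: "y \<in> hcar V"
    have "Q n (hscale V s x) y = s * Q n x y" for n
      using hermitian_formD(2)[OF positive_formD(1)[OF Q] x y] .
    then have "(\<lambda>n. Q n (hscale V s x) y) \<longlonglongrightarrow> s * q x y"
      using tendsto_mult[OF tendsto_const[of s] lim[OF x y]] by simp
    with lim[of "hscale V s x" y] x y show "q (hscale V s x) y = s * q x y"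
      using LIMSEQ_unique by blast
  next
    fix x y assume x: "x \<in> hcar V" and y: "y \<in> hcar V"
    have "Q n y x = cnj (Q n x y)" for n
      using hermitian_formD(3)[OF positive_formD(1)[OF Q] x y] .
    then have "(\<lambda>n. Q n y x) \<longlonglongrightarrow> cnj (q x y)" using tendsto_cnj[OF lim[OF x y]] by simp
    with lim[OF y x] show "q y x = cnj (q x y)" by (rule LIMSEQ_unique)
  next
    fix x assume x: "x \<in> hcar V"
    show "0 \<le> Re (q x x)"
      using positive_formD(2)[OF Q x] by (intro LIMSEQ_le_const[OF tendsto_Re[OF lim[OF x x]]]) auto
  qed
  then show ?thesis using lim by blast
qed

text \<open>The relation between consecutive forms, Q_{n+1}(T x, T y) = Q_n(x, y), becomes
  invariance in the limit because both sides converge to values of the same form.\<close>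

lemma invariant_form_exists:
  assumes T: "bop V V T" and expansive: "\<And>x. x \<in> hcar V \<Longrightarrow> hsq V x \<le> hsq V (T x)"
    and d: "positive_form V d" and c: "c \<ge> 0"
    and dc: "\<And>x. x \<in> hcar V \<Longrightarrow> Re (d x x) \<le> c * hsq V x"
    and dec: "\<And>x. x \<in> hcar V \<Longrightarrow> Re (d (T x) (T x)) \<le> Re (d x x)"
  shows "\<exists>q. positive_form V q \<and> (\<forall>x\<in>hcar V. Re (d x x) \<le> Re (q x x) \<and> Re (q x x) \<le> c * hsq V x) \<and>
    (\<forall>x\<in>hcar V. \<forall>y\<in>hcar V. q (T x) (T y) = q x y)"
proof -
  define ok where "ok = (\<lambda>q. positive_form V q \<and> (\<forall>x\<in>hcar V. Re (q x x) \<le> c * hsq V x) \<and>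
    (\<forall>x\<in>hcar V. Re (q (T x) (T x)) \<le> Re (q x x)))"
  define nxt where "nxt = (\<lambda>q q'. (\<forall>x\<in>hcar V. Re (q x x) \<le> Re (q' x x)) \<and>
    (\<forall>x\<in>hcar V. \<forall>y\<in>hcar V. q' (T x) (T y) = q x y))"
  \<comment> \<open>The clause for n = 0 pins the chosen sequence to start at d; without it the
    limit would not be known to lie above d.\<close>
  have "\<exists>Q. \<forall>n. (ok (Q n) \<and> (n = 0 \<longrightarrow> Q n = d)) \<and> nxt (Q n) (Q (Suc n))"
  proof (rule dependent_nat_choice)
    show "\<exists>q. ok q \<and> (0 = (0::nat) \<longrightarrow> q = d)" using d dc dec by (auto simp: ok_def)
    fix q and n :: nat assume "ok q \<and> (n = 0 \<longrightarrow> q = d)"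
    then have q: "positive_form V q" "\<And>x. x \<in> hcar V \<Longrightarrow> Re (q x x) \<le> c * hsq V x"
      "\<And>x. x \<in> hcar V \<Longrightarrow> Re (q (T x) (T x)) \<le> Re (q x x)" by (auto simp: ok_def)
    obtain q' where q': "positive_form V q'"
      "\<forall>x\<in>hcar V. Re (q x x) \<le> Re (q' x x) \<and> Re (q' x x) \<le> c * hsq V x"
      "\<forall>x\<in>hcar V. \<forall>y\<in>hcar V. q' (T x) (T y) = q x y"
      using form_shift_step[OF T expansive q(1) c q(2,3)] by blast
    \<comment> \<open>The hypotheses of the next step reproduce themselves: q' \<circ> T = q \<le>
      q'.\<close>
    have "ok q'" unfolding ok_def using q' by simp
    moreover have "nxt q q'" unfolding nxt_def using q' by simp
    ultimately show "\<exists>q'. (ok q' \<and> (Suc n = 0 \<longrightarrow> q' = d)) \<and> nxt q q'" by blast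
  qed
  then obtain Q where Q: "\<And>n. ok (Q n)" "Q 0 = d" "\<And>n. nxt (Q n) (Q (Suc n))" by blast
  have pos: "positive_form V (Q n)" for n using Q(1)[of n] by (simp add: ok_def)
  have le: "Re (Q n x x) \<le> c * hsq V x" if "x \<in> hcar V" for n x using Q(1)[of n] that by (simp add: ok_def)
  have mono: "Re (Q n x x) \<le> Re (Q (Suc n) x x)" if "x \<in> hcar V" for n x
    using Q(3)[of n] that by (simp add: nxt_def)
  obtain q where q: "positive_form V q"
    "\<And>x y. x \<in> hcar V \<Longrightarrow> y \<in> hcar V \<Longrightarrow> (\<lambda>n. Q n x y) \<longlonglongrightarrow> q x y"
    using monotone_form_limit[of Q c, OF pos mono le] by blast
  have "Re (d x x) \<le> Re (q x x)" if x: "x \<in> hcar V" for x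
  proof -
    have "Re (d x x) \<le> Re (Q n x x)" for n
    proof (induction n)
      case (Suc n)
      then show ?case using mono[OF x, of n] by linarith
    qed (simp add: Q(2))
    then show ?thesis by (intro LIMSEQ_le_const[OF tendsto_Re[OF q(2)[OF x x]]]) auto
  qed
  moreover have "Re (q x x) \<le> c * hsq V x" if x: "x \<in> hcar V" for x
    using le[OF x] by (intro LIMSEQ_le_const2[OF tendsto_Re[OF q(2)[OF x x]]]) auto
  moreover have "q (T x) (T y) = q x y" if x: "x \<in> hcar V" and y: "y \<in> hcar V" for x y
  proof -
    have "(\<lambda>n. Q (Suc n) (T x) (T y)) \<longlonglongrightarrow> q (T x) (T y)"
      by (rule LIMSEQ_Suc[OF q(2)]) (use x y bopD(1)[OF T] in auto)
    moreover have "Q (Suc n) (T x) (T y) = Q n x y" for n using Q(3)[of n] x y by (simp add: nxt_def)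
    ultimately have "(\<lambda>n. Q n x y) \<longlonglongrightarrow> q (T x) (T y)" by simp
    then show ?thesis using q(2)[OF x y] LIMSEQ_unique by blast
  qed
  ultimately show ?thesis using q(1) by blast
qed

end

section \<open>Shifts by reindexing\<close>

text \<open>For strictly increasing \<tau> this is the isometry of E sending coordinate n to
  coordinate \<tau> n. Disjoint ranges of indices give orthogonal ranges of operators, so
  orthogonality reduces to arithmetic of residues.\<close>

definition place :: "'v cips \<Rightarrow> (nat \<Rightarrow> nat) \<Rightarrow> (nat \<Rightarrow> 'v) \<Rightarrow> nat \<Rightarrow> 'v" where
  "place V \<tau> f k = (if k \<in> range \<tau> then f (inv \<tau> k) else hzero V)"

definition single :: "'v cips \<Rightarrow> nat \<Rightarrow> 'v \<Rightarrow> nat \<Rightarrow> 'v" where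
  "single V n v k = (if k = n then v else hzero V)"

lemma strict_mono_affine: "a > 0 \<Longrightarrow> strict_mono (\<lambda>n::nat. a * n + b)"
  by (simp add: strict_mono_def)

context inner_space
begin

lemma place_at [simp]: "strict_mono \<tau> \<Longrightarrow> place V \<tau> f (\<tau> n) = f n"
  by (simp add: place_def strict_mono_imp_inj_on)

lemma place_outside: "k \<notin> range \<tau> \<Longrightarrow> place V \<tau> f k = hzero V"
  by (simp add: place_def)

lemma place_in: "(\<And>n. f n \<in> hcar V) \<Longrightarrow> place V \<tau> f k \<in> hcar V"
  by (simp add: place_def)

lemma place_closed:
  assumes \<tau>: "strict_mono \<tau>" and f: "f \<in> hcar (ell2 V)"
  shows "place V \<tau> f \<in> hcar (ell2 V)"
proof -
  have "summable (\<lambda>n. hsq V (place V \<tau> f (\<tau> n)))" using \<tau> f by (simp add: mem_ell2)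
  then have "summable (\<lambda>n. hsq V (place V \<tau> f n))"
    using summable_mono_reindex[OF \<tau>, of "\<lambda>k. hsq V (place V \<tau> f k)"] by (simp add: place_outside)
  then show ?thesis using f by (simp add: mem_ell2 place_in)
qed

lemma inner_place:
  assumes \<tau>: "strict_mono \<tau>" and f: "f \<in> hcar (ell2 V)" and g: "g \<in> hcar (ell2 V)"
  shows "hinner (ell2 V) (place V \<tau> f) (place V \<tau> g) = hinner (ell2 V) f g"
proof -
  have "(\<Sum>n. hinner V (place V \<tau> f (\<tau> n)) (place V \<tau> g (\<tau> n))) = (\<Sum>k. hinner V (place V \<tau> f k) (place V \<tau> g k))"
    by (rule suminf_mono_reindex[OF \<tau>, of "\<lambda>k. hinner V (place V \<tau> f k) (place V \<tau> g k)"]) (simp add: place_outside)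
  then show ?thesis using \<tau> by (simp add: hinner_ell2)
qed

lemma inner_place_disjoint:
  assumes "range \<tau> \<inter> range \<sigma> = {}" and f: "f \<in> hcar (ell2 V)" and g: "g \<in> hcar (ell2 V)"
  shows "hinner (ell2 V) (place V \<tau> f) (place V \<sigma> g) = 0"
proof -
  have fg: "place V \<tau> f k \<in> hcar V" "place V \<sigma> g k \<in> hcar V" for k
    using f g by (auto simp: mem_ell2 intro: place_in)
  have "hinner V (place V \<tau> f k) (place V \<sigma> g k) = 0" for k
  proof (cases "k \<in> range \<tau>")
    case True
    then have "k \<notin> range \<sigma>" using assms(1) by blast
    then show ?thesis using fg[of k] by (simp add: place_outside)
  next
    case False
    then show ?thesis using fg[of k] by (simp add: place_outside)
  qed
  then show ?thesis by (simp add: hinner_ell2)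
qed

lemma bop_place:
  assumes \<tau>: "strict_mono \<tau>"
  shows "bop (ell2 V) (ell2 V) (place V \<tau>)"
proof (rule bopI[OF inner_space_ell2 inner_space_ell2, where c = 1])
  show "place V \<tau> f \<in> hcar (ell2 V)" if "f \<in> hcar (ell2 V)" for f using \<tau> that by (rule place_closed)
  show "place V \<tau> (hadd (ell2 V) f g) = hadd (ell2 V) (place V \<tau> f) (place V \<tau> g)" for f g
    by (auto simp: fun_eq_iff place_def)
  show "place V \<tau> (hscale (ell2 V) s f) = hscale (ell2 V) s (place V \<tau> f)" for s f
  proof -
    have "hscale V s (hzero V) = hzero V" by (rule vector_eqI) auto
    then show ?thesis by (auto simp: fun_eq_iff place_def)
  qed
  show "hsq (ell2 V) (place V \<tau> f) \<le> 1 * hsq (ell2 V) f" if "f \<in> hcar (ell2 V)" for f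
    using inner_place[OF \<tau> that that] by (simp add: hsq_def)
qed

lemma isometry_place:
  assumes \<tau>: "strict_mono \<tau>"
  shows "isometry (ell2 V) (ell2 V) (place V \<tau>)"
  unfolding isometry_def using bop_place[OF \<tau>] inner_place[OF \<tau>] by (simp add: hnorm_def)

section \<open>Orthogonal complements and closed spans\<close>

lemma closed_subspace_orthogonal:
  assumes "M \<subseteq> hcar V"
  shows "closed_subspace V {x \<in> hcar V. \<forall>y\<in>M. hinner V x y = 0}" (is "closed_subspace V ?L")
  unfolding closed_subspace_def
proof (intro conjI allI impI)
  have M: "y \<in> hcar V" if "y \<in> M" for y using assms that by blast
  show "?L \<subseteq> hcar V" "hzero V \<in> ?L" "\<forall>x\<in>?L. \<forall>y\<in>?L. hadd V x y \<in> ?L" using M by auto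
  show "\<forall>x\<in>?L. hscale V a x \<in> ?L" for a using M by auto
  fix f l assume *: "(\<forall>n. f n \<in> ?L) \<and> l \<in> hcar V \<and> (\<lambda>n. hnorm V (hsub V (f n) l)) \<longlonglongrightarrow> 0"
  have "hinner V l y = 0" if y: "y \<in> M" for y
  proof -
    have "(\<lambda>n. hinner V (f n) y) \<longlonglongrightarrow> hinner V l y"
      using * M[OF y] by (intro inner_tendsto_left) auto
    moreover have "hinner V (f n) y = 0" for n using * y by auto
    ultimately show ?thesis by (simp add: LIMSEQ_const_iff)
  qed
  then show "l \<in> ?L" using * by simp
qed

lemma closed_subspace_carrier: "closed_subspace V (hcar V)"
  using closed_subspace_orthogonal[of "{}"] by simp

text \<open>\<open>closed_span\<close> is an intersection that would be the whole type if no closed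
  subspace contained M; for M inside the carrier, the carrier itself is one.\<close>

lemma closed_span_subset: "M \<subseteq> hcar V \<Longrightarrow> closed_span V M \<subseteq> hcar V"
  unfolding closed_span_def using closed_subspace_carrier by blast

lemma closed_spanI: "(\<And>L. closed_subspace V L \<Longrightarrow> M \<subseteq> L \<Longrightarrow> x \<in> L) \<Longrightarrow> x \<in> closed_span V M"
  unfolding closed_span_def by blast

lemma closed_span_superset: "M \<subseteq> closed_span V M"
  unfolding closed_span_def by blast

lemma closed_span_minimal: "closed_subspace V L \<Longrightarrow> M \<subseteq> L \<Longrightarrow> closed_span V M \<subseteq> L"
  unfolding closed_span_def by blast

lemma closed_subspace_closed_span:
  assumes "M \<subseteq> hcar V"
  shows "closed_subspace V (closed_span V M)"
proof -
  have sub: "closed_span V M \<subseteq> hcar V" using assms by (rule closed_span_subset)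
  show ?thesis
    unfolding closed_subspace_def
  proof (intro conjI ballI allI impI sub)
    show "hzero V \<in> closed_span V M" by (rule closed_spanI) (simp add: closed_subspace_def)
    show "hadd V x y \<in> closed_span V M" if "x \<in> closed_span V M" "y \<in> closed_span V M" for x y
    proof (rule closed_spanI)
      fix L assume L: "closed_subspace V L" "M \<subseteq> L"
      then have "x \<in> L" "y \<in> L" using that closed_span_minimal by auto
      then show "hadd V x y \<in> L" using L(1) by (simp add: closed_subspace_def)
    qed
    show "hscale V a x \<in> closed_span V M" if "x \<in> closed_span V M" for a x
    proof (rule closed_spanI)
      fix L assume L: "closed_subspace V L" "M \<subseteq> L"
      then have "x \<in> L" using that closed_span_minimal by auto
      then show "hscale V a x \<in> L" using L(1) by (simp add: closed_subspace_def)
    qed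
    fix f l assume *: "(\<forall>n. f n \<in> closed_span V M) \<and> l \<in> hcar V \<and> (\<lambda>n. hnorm V (hsub V (f n) l)) \<longlonglongrightarrow> 0"
    show "l \<in> closed_span V M"
    proof (rule closed_spanI)
      fix L assume L: "closed_subspace V L" "M \<subseteq> L"
      then have "\<forall>n. f n \<in> L" using * closed_span_minimal by blast
      then show "l \<in> L" using L(1) * unfolding closed_subspace_def by blast
    qed
  qed
qed

lemma single_closed: "v \<in> hcar V \<Longrightarrow> single V n v \<in> hcar (ell2 V)"
proof -
  assume v: "v \<in> hcar V"
  have "summable (\<lambda>k. hsq V (single V n v k))"
    by (rule summable_finite[of "{n}"]) (auto simp: single_def)
  then show ?thesis using v by (simp add: mem_ell2 single_def)
qed

text \<open>Truncations are finite sums of single-coordinate vectors, and their squared distance to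
  f is a tail of a convergent series.\<close>

lemma closed_subspace_ell2_eq:
  assumes K: "closed_subspace (ell2 V) K" and single: "\<And>n v. v \<in> hcar V \<Longrightarrow> single V n v \<in> K"
  shows "hcar (ell2 V) \<subseteq> K"
proof
  interpret E: inner_space "ell2 V" by (rule inner_space_ell2)
  fix f assume f: "f \<in> hcar (ell2 V)"
  have fc: "f n \<in> hcar V" for n using f by (simp add: mem_ell2)
  define t where "t = (\<lambda>N k. if k < N then f k else hzero V)"
  have K': "hzero (ell2 V) \<in> K" "\<And>x y. x \<in> K \<Longrightarrow> y \<in> K \<Longrightarrow> hadd (ell2 V) x y \<in> K" "K \<subseteq> hcar (ell2 V)"
    using K unfolding closed_subspace_def by blast+
  have tK: "t N \<in> K" for N
  proof (induction N)
    case 0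
    then show ?case using K'(1) by (simp add: t_def)
  next
    case (Suc N)
    have "t (Suc N) = hadd (ell2 V) (t N) (single V N (f N))"
      using fc add_comm[of "hzero V"] by (auto simp: fun_eq_iff t_def single_def)
    then show ?case using K'(2)[OF Suc single[OF fc[of N]]] by simp
  qed
  have tE: "t N \<in> hcar (ell2 V)" for N using tK K'(3) by blast
  have sm: "summable (\<lambda>n. hsq V (f n))" using f by (simp add: mem_ell2)
  have sub0: "hsub V x x = hzero V" "hsq V (hsub V (hzero V) x) = hsq V x" if "x \<in> hcar V" for x
    using that by (auto intro!: vector_eqI simp: hsq_def)
  have "hsq (ell2 V) (hsub (ell2 V) (t N) f) = (\<Sum>n. hsq V (f (n + N)))" for N
  proof -
    have c: "hsub (ell2 V) (t N) f \<in> hcar (ell2 V)" using tE f by (rule E.sub_closed)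
    have sm': "summable (\<lambda>n. hsq V (hsub V (t N n) (f n)))" using c by (simp add: mem_ell2)
    have "hsq (ell2 V) (hsub (ell2 V) (t N) f) = (\<Sum>n. hsq V (hsub V (t N n) (f n)))"
      using hsq_ell2[OF c] by simp
    also have "\<dots> = (\<Sum>n. hsq V (hsub V (t N (n + N)) (f (n + N)))) + (\<Sum>n<N. hsq V (hsub V (t N n) (f n)))"
      by (rule suminf_split_initial_segment[OF sm'])
    also have "(\<Sum>n<N. hsq V (hsub V (t N n) (f n))) = 0"
      by (rule sum.neutral) (simp add: t_def sub0 fc)
    also have "(\<Sum>n. hsq V (hsub V (t N (n + N)) (f (n + N)))) = (\<Sum>n. hsq V (f (n + N)))"
      by (simp add: t_def sub0 fc)
    finally show ?thesis by simp
  qed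
  moreover have "(\<lambda>N. \<Sum>n. hsq V (f (n + N))) \<longlonglongrightarrow> 0"
  proof -
    have "(\<Sum>n. hsq V (f (n + N))) = (\<Sum>n. hsq V (f n)) - (\<Sum>n<N. hsq V (f n))" for N
      using suminf_minus_initial_segment[OF sm] by simp
    then show ?thesis
      using tendsto_diff[OF tendsto_const[of "\<Sum>n. hsq V (f n)"] summable_LIMSEQ[OF sm]] by simp
  qed
  ultimately have "(\<lambda>N. hsq (ell2 V) (hsub (ell2 V) (t N) f)) \<longlonglongrightarrow> 0" by simp
  then have "(\<lambda>N. hnorm (ell2 V) (hsub (ell2 V) (t N) f)) \<longlonglongrightarrow> 0"
    using E.hnorm_tendsto_0_iff[of "\<lambda>N. hsub (ell2 V) (t N) f"] E.sub_closed[OF tE f] by simp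
  then show "f \<in> K" using K tK f unfolding closed_subspace_def by blast
qed

text \<open>The map n \<mapsto> 2n + 1 strictly increases every index, so going back from n must end
  at an even index, and the vectors supported on even indices are wandering. With 2n instead, index
  0 would be fixed and the isometry would not be a pure shift.\<close>

lemma unilateral_shift_place: "unilateral_shift (ell2 V) (place V (\<lambda>n. 2 * n + 1))"
proof -
  interpret E: inner_space "ell2 V" by (rule inner_space_ell2)
  define S where "S = place V (\<lambda>n. 2 * n + 1)"
  have \<tau>: "strict_mono (\<lambda>n::nat. 2 * n + 1)" by (rule strict_mono_affine) simp
  have Sc: "S f \<in> hcar (ell2 V)" if "f \<in> hcar (ell2 V)" for f
    unfolding S_def using \<tau> that by (rule place_closed)
  have Si: "hinner (ell2 V) (S f) (S g) = hinner (ell2 V) f g" if "f \<in> hcar (ell2 V)" "g \<in> hcar (ell2 V)" for f g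
    unfolding S_def using \<tau> that by (rule inner_place)
  have Snc: "(S ^^ n) f \<in> hcar (ell2 V)" if "f \<in> hcar (ell2 V)" for n f
    by (induction n) (use that Sc in auto)
  have Sni: "hinner (ell2 V) ((S ^^ n) f) ((S ^^ n) g) = hinner (ell2 V) f g"
    if "f \<in> hcar (ell2 V)" "g \<in> hcar (ell2 V)" for n f g
    by (induction n) (use that Si Snc in auto)
  define L where "L = {x \<in> hcar (ell2 V). \<forall>y\<in>S ` hcar (ell2 V). hinner (ell2 V) x y = 0}"
  have Lc: "closed_subspace (ell2 V) L"
    unfolding L_def using Sc by (intro E.closed_subspace_orthogonal) auto
  have LE: "x \<in> hcar (ell2 V)" if "x \<in> L" for x using that by (simp add: L_def)
  \<comment> \<open>Cancelling m powers of the isometry leaves x against a vector in the range of S,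
    to which L is orthogonal by definition.\<close>
  have orth_less: "hinner (ell2 V) ((S ^^ m) x) ((S ^^ n) y) = 0" if "m < n" and x: "x \<in> L" and y: "y \<in> L" for m n x y
  proof -
    obtain k where n: "n = m + Suc k" using \<open>m < n\<close> less_imp_Suc_add by auto
    have "hinner (ell2 V) ((S ^^ m) x) ((S ^^ n) y) = hinner (ell2 V) x ((S ^^ Suc k) y)"
      unfolding n funpow_add comp_apply using LE x y Snc Sc by (intro Sni) auto
    also have "\<dots> = 0" using x Snc[OF LE[OF y], of k] by (simp add: L_def)
    finally show ?thesis .
  qed
  have "closed_span (ell2 V) (\<Union>n. (S ^^ n) ` L) = hcar (ell2 V)"
  proof
    show "closed_span (ell2 V) (\<Union>n. (S ^^ n) ` L) \<subseteq> hcar (ell2 V)"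
      by (rule E.closed_span_subset) (use LE Snc in auto)
    \<comment> \<open>Strong induction on the index: a vector at an even place lies in L, and one at
      place 2k + 1 is S of the vector at k < 2k + 1.\<close>
    have single: "single V n v \<in> (\<Union>j. (S ^^ j) ` L)" if v: "v \<in> hcar V" for n v
    proof (induction n rule: less_induct)
      case (less n)
      show ?case
      proof (cases "even n")
        case True
        have "hinner (ell2 V) (single V n v) (S g) = 0" if g: "g \<in> hcar (ell2 V)" for g
        proof -
          have "hinner V (single V n v k) (S g k) = 0" for k
          proof (cases "k = n")
            case True
            then have "k \<notin> range (\<lambda>n::nat. 2 * n + 1)" using \<open>even n\<close> by auto
            then show ?thesis using v by (simp add: S_def place_outside single_def)
          next
            case False
            then show ?thesis using Sc[OF g] by (simp add: single_def mem_ell2)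
          qed
          then show ?thesis by (simp add: hinner_ell2)
        qed
        then have "single V n v \<in> L" using v by (auto simp: L_def single_closed)
        then show ?thesis by (intro UN_I[of 0]) auto
      next
        case False
        then obtain k where n: "n = 2 * k + 1" using oddE by blast
        then obtain j f where f: "f \<in> L" "single V k v = (S ^^ j) f" using less[of k] by auto
        have "single V n v = S (single V k v)"
        proof
          fix i
          show "single V n v i = S (single V k v) i"
          proof (cases "i \<in> range (\<lambda>n::nat. 2 * n + 1)")
            case True
            then obtain m where i: "i = 2 * m + 1" by blast
            have "S (single V k v) i = single V k v m"
              unfolding S_def i using place_at[OF \<tau>, of "single V k v" m] by simp
            then show ?thesis by (simp add: i n single_def)
          next
            case False
            then show ?thesis using n by (auto simp: S_def place_outside single_def)
          qed
        qed
        then have "single V n v = (S ^^ Suc j) f" using f by simp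
        then show ?thesis using f(1) by blast
      qed
    qed
    show "hcar (ell2 V) \<subseteq> closed_span (ell2 V) (\<Union>n. (S ^^ n) ` L)"
    proof
      fix f assume f: "f \<in> hcar (ell2 V)"
      show "f \<in> closed_span (ell2 V) (\<Union>n. (S ^^ n) ` L)"
      proof (rule E.closed_spanI)
        fix K assume K: "closed_subspace (ell2 V) K" "(\<Union>n. (S ^^ n) ` L) \<subseteq> K"
        have "hcar (ell2 V) \<subseteq> K"
          using K(1) subsetD[OF K(2) single] by (rule closed_subspace_ell2_eq)
        then show "f \<in> K" using f by (rule subsetD)
      qed
    qed
  qed
  moreover have "hinner (ell2 V) ((S ^^ m) x) ((S ^^ n) y) = 0" if "m \<noteq> n" "x \<in> L" "y \<in> L" for m n x y
  proof (cases "m < n")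
    case True
    then show ?thesis using orth_less that by blast
  next
    case False
    then have "hinner (ell2 V) ((S ^^ n) y) ((S ^^ m) x) = 0" using orth_less that by simp
    then show ?thesis
      using E.inner_cnj[OF Snc[OF LE[OF that(3)]] Snc[OF LE[OF that(2)]], of m n] by simp
  qed
  ultimately show ?thesis
    unfolding unilateral_shift_def S_def[symmetric]
    using isometry_place[OF \<tau>, folded S_def] Lc by (intro conjI exI[of _ L] allI impI ballI)
qed

end

section \<open>Block operators and covariance\<close>

lemma bop_scale:
  assumes A: "bop V W A" and V: "inner_space V" and W: "inner_space W"
  shows "bop V W (\<lambda>x. hscale W s (A x))"
proof -
  interpret W: inner_space W by fact
  obtain c where c: "c \<ge> 0" "\<And>x. x \<in> hcar V \<Longrightarrow> hsq W (A x) \<le> c * hsq V x"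
    using bop_bound_sq[OF A V W] by blast
  show ?thesis
  proof (rule bopI[OF V W, where c = "(cmod s)\<^sup>2 * c"])
    fix x assume x: "x \<in> hcar V"
    show "hsq W (hscale W s (A x)) \<le> (cmod s)\<^sup>2 * c * hsq V x"
      using W.hsq_scale[OF bopD(1)[OF A x], of s] mult_left_mono[OF c(2)[OF x], of "(cmod s)\<^sup>2"]
      by (simp add: mult.assoc)
  qed (use bopD[OF A] in \<open>auto simp: W.scale_add_right W.scale_scale mult.commute\<close>)
qed

lemma bop_pair:
  assumes A: "bop U V A" and B: "bop U W B" and "inner_space U" "inner_space V" "inner_space W"
  shows "bop U (dsum V W) (\<lambda>x. (A x, B x))"
proof -
  obtain c where c: "c \<ge> 0" "\<And>x. x \<in> hcar U \<Longrightarrow> hsq V (A x) \<le> c * hsq U x"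
    using bop_bound_sq[OF A assms(3,4)] by blast
  obtain d where d: "d \<ge> 0" "\<And>x. x \<in> hcar U \<Longrightarrow> hsq W (B x) \<le> d * hsq U x"
    using bop_bound_sq[OF B assms(3,5)] by blast
  show ?thesis
  proof (rule bopI[OF assms(3) inner_space_dsum[OF assms(4,5)], where c = "c + d"])
    fix x assume x: "x \<in> hcar U"
    show "hsq (dsum V W) (A x, B x) \<le> (c + d) * hsq U x"
      using c(2)[OF x] d(2)[OF x] by (simp add: distrib_right)
  qed (use bopD[OF A] bopD[OF B] in auto)
qed

lemma bop_upper_blk:
  assumes P: "bop G G P" and Q: "bop H G Q" and R: "bop H H R" and G: "inner_space G" and H: "inner_space H"
  shows "bop (dsum G H) (dsum G H) (upper_blk G P Q R)"
proof -
  interpret G: inner_space G by fact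
  interpret H: inner_space H by fact
  obtain c where c: "c \<ge> 0" "\<And>x. x \<in> hcar G \<Longrightarrow> hsq G (P x) \<le> c * hsq G x"
    using bop_bound_sq[OF P G G] by blast
  obtain d where d: "d \<ge> 0" "\<And>x. x \<in> hcar H \<Longrightarrow> hsq G (Q x) \<le> d * hsq H x"
    using bop_bound_sq[OF Q H G] by blast
  obtain e where e: "e \<ge> 0" "\<And>x. x \<in> hcar H \<Longrightarrow> hsq H (R x) \<le> e * hsq H x"
    using bop_bound_sq[OF R H H] by blast
  show ?thesis
  proof (rule bopI[OF inner_space_dsum[OF G H] inner_space_dsum[OF G H], where c = "2 * c + 2 * d + e"])
    fix x assume "x \<in> hcar (dsum G H)"
    then obtain g h where x: "x = (g, h)" "g \<in> hcar G" "h \<in> hcar H" by auto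
    show "upper_blk G P Q R x \<in> hcar (dsum G H)"
      using x bopD(1)[OF P] bopD(1)[OF Q] bopD(1)[OF R] by (simp add: upper_blk_def)
    show "upper_blk G P Q R (hscale (dsum G H) s x) = hscale (dsum G H) s (upper_blk G P Q R x)" for s
      using x bopD[OF P] bopD[OF Q] bopD[OF R] by (simp add: upper_blk_def G.scale_add_right)
    have "hsq G (hadd G (P g) (Q h)) \<le> 2 * hsq G (P g) + 2 * hsq G (Q h)"
      using x bopD(1)[OF P] bopD(1)[OF Q] by (intro G.hsq_add_le) auto
    moreover have "2 * hsq G (P g) + 2 * hsq G (Q h) + hsq H (R h)
        \<le> (2 * c) * hsq G g + (2 * d + e) * hsq H h"
      using c(2)[OF x(2)] d(2)[OF x(3)] e(2)[OF x(3)] by (simp add: distrib_right)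
    moreover have "(2 * c) * hsq G g + (2 * d + e) * hsq H h \<le> (2 * c + 2 * d + e) * (hsq G g + hsq H h)"
      using c(1) d(1) e(1) G.hsq_nonneg[OF x(2)] H.hsq_nonneg[OF x(3)]
        mult_nonneg_nonneg[of "2 * c" "hsq H h"] mult_nonneg_nonneg[of "2 * d + e" "hsq G g"]
      by (simp add: distrib_left distrib_right)
    ultimately show "hsq (dsum G H) (upper_blk G P Q R x) \<le> (2 * c + 2 * d + e) * hsq (dsum G H) x"
      by (simp add: x(1) upper_blk_def)
  next
    fix x y assume "x \<in> hcar (dsum G H)" "y \<in> hcar (dsum G H)"
    then obtain g h g' h' where x: "x = (g, h)" "g \<in> hcar G" "h \<in> hcar H"
      and y: "y = (g', h')" "g' \<in> hcar G" "h' \<in> hcar H" by auto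
    note c = bopD(1)[OF P] bopD(1)[OF Q]
    have "hadd G (hadd G (P g) (P g')) (hadd G (Q h) (Q h')) = hadd G (hadd G (P g) (Q h)) (hadd G (P g') (Q h'))"
      using x y c by (intro G.vector_eqI) auto
    then show "upper_blk G P Q R (hadd (dsum G H) x y) =
        hadd (dsum G H) (upper_blk G P Q R x) (upper_blk G P Q R y)"
      using x y bopD(2)[OF P] bopD(2)[OF Q] bopD(2)[OF R] by (simp add: upper_blk_def)
  qed
qed

text \<open>Criterion used for both liftings. D is the form of \<Delta> of S, and the 2-isometry
  equation says precisely that D is invariant under S. The norm of \<Delta> is the least bound of D,
  which \<open>bound\<close> and \<open>least\<close> identify as M.\<close>

lemma two_isometry_cov:
  assumes V: "complete_space V" and S: "bop V V S"
    and inner_S: "\<And>x y. x \<in> hcar V \<Longrightarrow> y \<in> hcar V \<Longrightarrow> hinner V (S x) (S y) = hinner V x y + D x y"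
    and invariant: "\<And>x y. x \<in> hcar V \<Longrightarrow> y \<in> hcar V \<Longrightarrow> D (S x) (S y) = D x y"
    and pos: "\<And>x. x \<in> hcar V \<Longrightarrow> 0 \<le> Re (D x x)" and M: "M \<ge> 0"
    and bound: "\<And>x. x \<in> hcar V \<Longrightarrow> Re (D x x) \<le> M * hsq V x"
    and least: "\<And>M'. M' \<ge> 0 \<Longrightarrow> (\<And>x. x \<in> hcar V \<Longrightarrow> Re (D x x) \<le> M' * hsq V x) \<Longrightarrow> M \<le> M'"
  shows "two_isometry V S \<and> cov V S = sqrt M"
proof
  interpret V: complete_space V by fact
  note Sc = bopD(1)[OF S]
  show "two_isometry V S"
  proof (rule V.two_isometryI[OF S])
    fix x y assume x: "x \<in> hcar V" and y: "y \<in> hcar V"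
    show "hinner V (S (S x)) (S (S y)) - 2 * hinner V (S x) (S y) + hinner V x y = 0"
      unfolding inner_S[OF Sc[OF x] Sc[OF y]] inner_S[OF x y] invariant[OF x y] by simp
  qed
  \<comment> \<open>D is only a function agreeing with this expression on the carrier, so the form
    properties are read off from S.\<close>
  have a: "positive_form V (\<lambda>x y. hinner V (S x) (S y) - hinner V x y)"
  proof (rule positive_form_diff)
    show "hermitian_form V (\<lambda>x y. hinner V (S x) (S y))"
      using positive_form_compose[OF V.positive_form_inner S] by (rule positive_formD)
    show "hermitian_form V (hinner V)" using V.positive_form_inner by (rule positive_formD)
    show "Re (hinner V x x) \<le> Re (hinner V (S x) (S x))" if "x \<in> hcar V" for x
      using pos[OF that] by (simp add: inner_S[OF that that])
  qed
  have eq: "Re (hinner V (S x) (S x) - hinner V x x) = Re (D x x)" if "x \<in> hcar V" for x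
    by (simp add: inner_S[OF that that])
  note op = V.opnorm_least_bound[OF V.bop_Delta[OF S] a V.inner_Delta[OF S]]
  have "opnorm V V (Delta V S) \<le> M"
  proof (rule op(3))
    show "Re (hinner V (S x) (S x) - hinner V x x) \<le> M * hsq V x" if "x \<in> hcar V" for x
      using bound[OF that] eq[OF that] by simp
  qed (use M in auto)
  moreover have "M \<le> opnorm V V (Delta V S)"
  proof (rule least)
    show "0 \<le> opnorm V V (Delta V S)" by (rule op(1))
    show "Re (D x x) \<le> opnorm V V (Delta V S) * hsq V x" if "x \<in> hcar V" for x
      using op(2)[of x] that eq[OF that] by simp
  qed
  ultimately show "cov V S = sqrt M" by (simp add: cov_def)
qed

text \<open>The sesquilinear form of \<open>Delta V T\<close>, written without the adjoint.\<close>

definition defect_form :: "'v cips \<Rightarrow> ('v \<Rightarrow> 'v) \<Rightarrow> 'v \<Rightarrow> 'v \<Rightarrow> complex" where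
  "defect_form V T x y = hinner V (T x) (T y) - hinner V x y"

context complete_space
begin

context
  fixes T :: "'a \<Rightarrow> 'a"
  assumes concave: "concave_op V T"
begin

lemma concave_bop: "bop V V T"
  using concave by (simp add: concave_op_def)

lemma positive_defect_form: "positive_form V (defect_form V T)"
  unfolding defect_form_def
proof (rule positive_form_diff)
  show "hermitian_form V (\<lambda>x y. hinner V (T x) (T y))"
    using positive_form_compose[OF positive_form_inner concave_bop] by (rule positive_formD)
  show "hermitian_form V (hinner V)" using positive_form_inner by (rule positive_formD)
  show "Re (hinner V x x) \<le> Re (hinner V (T x) (T x))" if "x \<in> hcar V" for x
    using concave_op_expansive[OF concave that] by (simp add: hsq_def)
qed

lemma defect_form_decreasing:
  "x \<in> hcar V \<Longrightarrow> Re (defect_form V T (T x) (T x)) \<le> Re (defect_form V T x x)"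
  using concave_op_hsq[OF concave, of x] by (simp add: defect_form_def hsq_def)

lemma defect_form_opnorm:
  shows "0 \<le> opnorm V V (Delta V T)"
    and "x \<in> hcar V \<Longrightarrow> Re (defect_form V T x x) \<le> opnorm V V (Delta V T) * hsq V x"
    and "(\<And>x. x \<in> hcar V \<Longrightarrow> Re (defect_form V T x x) \<le> M * hsq V x) \<Longrightarrow> 0 \<le> M \<Longrightarrow> opnorm V V (Delta V T) \<le> M"
proof -
  have eq: "hinner V (Delta V T x) y = defect_form V T x y" if "x \<in> hcar V" "y \<in> hcar V" for x y
    using inner_Delta[OF concave_bop that] by (simp add: defect_form_def)
  note op = opnorm_least_bound[OF bop_Delta[OF concave_bop] positive_defect_form eq]
  show "0 \<le> opnorm V V (Delta V T)" by (rule op(1))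
  show "Re (defect_form V T x x) \<le> opnorm V V (Delta V T) * hsq V x" if "x \<in> hcar V"
    using op(2) that by blast
  show "opnorm V V (Delta V T) \<le> M"
    if "\<And>x. x \<in> hcar V \<Longrightarrow> Re (defect_form V T x x) \<le> M * hsq V x" "0 \<le> M"
    using op(3) that by blast
qed

end

end

text \<open>Used to reach a closed span through its generators: once for invariance of L under W,
  once for the embedding of G into the direct sum.\<close>

lemma closed_subspace_vimage:
  assumes V: "inner_space V" and W: "inner_space W" and A: "bop V W A" and L: "closed_subspace W L"
  shows "closed_subspace V {x \<in> hcar V. A x \<in> L}"
proof -
  interpret V: inner_space V by fact
  interpret W: inner_space W by fact
  have L': "hzero W \<in> L" "\<And>x y. x \<in> L \<Longrightarrow> y \<in> L \<Longrightarrow> hadd W x y \<in> L" "\<And>s x. x \<in> L \<Longrightarrow> hscale W s x \<in> L"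
    and cl: "\<And>f l. (\<And>n. f n \<in> L) \<Longrightarrow> l \<in> hcar W \<Longrightarrow> (\<lambda>n. hnorm W (hsub W (f n) l)) \<longlonglongrightarrow> 0 \<Longrightarrow> l \<in> L"
    using L unfolding closed_subspace_def by blast+
  obtain c where c: "\<And>x. x \<in> hcar V \<Longrightarrow> hnorm W (A x) \<le> c * hnorm V x"
    using bop_bound[OF A V] by blast
  show ?thesis
    unfolding closed_subspace_def
  proof (intro conjI allI impI ballI)
    show "hzero V \<in> {x \<in> hcar V. A x \<in> L}" using L' bop_zero[OF A V W] by simp
    fix f l assume *: "(\<forall>n. f n \<in> {x \<in> hcar V. A x \<in> L}) \<and> l \<in> hcar V \<and> (\<lambda>n. hnorm V (hsub V (f n) l)) \<longlonglongrightarrow> 0"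
    then have f: "f n \<in> hcar V" "A (f n) \<in> L" and l: "l \<in> hcar V" for n by auto
    have lim: "(\<lambda>n. hnorm V (hsub V (f n) l)) \<longlonglongrightarrow> 0" using * by simp
    have "(\<lambda>n. hnorm W (hsub W (A (f n)) (A l))) \<longlonglongrightarrow> 0"
    proof (rule tendsto_zero_comparison)
      fix n
      have "hsub W (A (f n)) (A l) \<in> hcar W" using bopD(1)[OF A] f(1) l by auto
      then show "norm (hnorm W (hsub W (A (f n)) (A l))) \<le> c * hnorm V (hsub V (f n) l)"
        using c[OF V.sub_closed[OF f(1)[of n] l]] bop_sub[OF A V f(1)[of n] l] by simp
      show "(\<lambda>n. c * hnorm V (hsub V (f n) l)) \<longlonglongrightarrow> 0" using tendsto_mult_right_zero[OF lim] .
    qed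
    then have "A l \<in> L" by (rule cl[OF f(2) bopD(1)[OF A l]])
    then show "l \<in> {x \<in> hcar V. A x \<in> L}" using l by simp
  qed (use L' bopD[OF A] in auto)
qed

text \<open>Closedness inside a closed subspace is closedness in the whole space. This is needed
  because the minimal space is a closed span taken in E, while the subspaces compared with it are
  found inside G.\<close>

lemma closed_subspace_of_restrict:
  assumes L: "closed_subspace V L" and K: "closed_subspace (restrict_space V L) K"
  shows "closed_subspace V K"
  unfolding closed_subspace_def
proof (intro conjI allI impI)
  have KL: "K \<subseteq> L" and K': "hzero V \<in> K" "\<forall>x\<in>K. \<forall>y\<in>K. hadd V x y \<in> K" "\<And>a. \<forall>x\<in>K. hscale V a x \<in> K"
    and clK: "\<And>f l. (\<forall>n. f n \<in> K) \<Longrightarrow> l \<in> L \<Longrightarrow> (\<lambda>n. hnorm V (hsub V (f n) l)) \<longlonglongrightarrow> 0 \<Longrightarrow> l \<in> K"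
    using K unfolding closed_subspace_def restrict_space_simps by blast+
  have LV: "L \<subseteq> hcar V"
    and clL: "\<And>f l. (\<forall>n. f n \<in> L) \<Longrightarrow> l \<in> hcar V \<Longrightarrow> (\<lambda>n. hnorm V (hsub V (f n) l)) \<longlonglongrightarrow> 0 \<Longrightarrow> l \<in> L"
    using L unfolding closed_subspace_def by blast+
  show "K \<subseteq> hcar V" using KL LV by (rule subset_trans)
  show "hzero V \<in> K" "\<forall>x\<in>K. \<forall>y\<in>K. hadd V x y \<in> K" "\<forall>x\<in>K. hscale V a x \<in> K" for a by (rule K')+
  fix f l assume *: "(\<forall>n. f n \<in> K) \<and> l \<in> hcar V \<and> (\<lambda>n. hnorm V (hsub V (f n) l)) \<longlonglongrightarrow> 0"
  then have "l \<in> L" using KL by (intro clL[of f]) auto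
  then show "l \<in> K" using * by (intro clK[of f]) auto
qed

section \<open>Liftings of concave operators\<close>

text \<open>Both \<open>G1\<close> and \<open>G0\<close> are the whole of E with the same shift, so
  the freedom lies in X. Its components are factorizations of the forms d \<circ> T and d - d
  \<circ> T, placed outside what W occupies.\<close>

lemma concave_lifting_of_covariance_sqrt_two:
  fixes H :: "'a cips" and T :: "'a \<Rightarrow> 'a"
  assumes H: "complete_space H" and T: "concave_op H T"
  shows "\<exists>(G1 :: 'a bigT cips) (G0 :: 'a bigT cips) S1 S0 E0 X W S.
            hilbert_space G1 \<and> hilbert_space G0 \<and>
            hcar G1 \<noteq> {hzero G1} \<and> hcar G0 \<noteq> {hzero G0} \<and>
            unilateral_shift G1 S1 \<and> unilateral_shift G0 S0 \<and>
            isometry G0 G1 E0 \<and> bop H (dsum G1 G0) X \<and>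
            W = upper_blk G1 S1 (\<lambda>y. hscale G1 (complex_of_real (sqrt 2)) (E0 y)) S0 \<and>
            two_isometry (dsum G1 G0) W \<and>
            (\<forall>h\<in>hcar H. hadj (dsum G1 G0) (dsum G1 G0) W (X h) = hzero (dsum G1 G0)) \<and>
            S = upper_blk (dsum G1 G0) W X T \<and>
            is_lifting (dsum G1 G0) H S T \<and>
            two_isometry (dsum (dsum G1 G0) H) S \<and>
            cov (dsum (dsum G1 G0) H) S = sqrt 2 * max 1 (sqrt (opnorm H H (Delta H T)))"
proof -
  interpret H: complete_space H by fact
  let ?D = "dsum H complex_line"
  let ?E = "ell2 ?D"
  interpret D: complete_space ?D by (intro complete_space_dsum H complete_space_complex_line)
  interpret E: complete_space ?E by (rule complete_space_ell2) (rule D.complete_space_axioms)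
  interpret EE: complete_space "dsum ?E ?E"
    by (rule complete_space_dsum) (rule E.complete_space_axioms)+
  interpret K: complete_space "dsum (dsum ?E ?E) H"
    by (rule complete_space_dsum) (rule EE.complete_space_axioms H)+
  note Hi = H.inner_space_axioms and Ei = E.inner_space_axioms and EEi = EE.inner_space_axioms
  note bT = H.concave_bop[OF T] and d = H.positive_defect_form[OF T]
    and dec = H.defect_form_decreasing[OF T] and op = H.defect_form_opnorm[OF T]
  define d where "d = defect_form H T"
  define c where "c = opnorm H H (Delta H T)"
  note d = d[folded d_def] and dec = dec[folded d_def] and op = op[folded d_def c_def]
  have dT: "positive_form H (\<lambda>x y. d (T x) (T y))" using d bT by (rule positive_form_compose)
  have d0: "positive_form H (\<lambda>x y. d x y - d (T x) (T y))"
    using positive_formD(1)[OF d] positive_formD(1)[OF dT] dec by (rule positive_form_diff)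
  have dTc: "Re (d (T x) (T x)) \<le> c * hsq H x" if "x \<in> hcar H" for x
    using dec[OF that] op(2)[OF that] by linarith
  have d0c: "Re (d x x - d (T x) (T x)) \<le> c * hsq H x" if "x \<in> hcar H" for x
    using positive_formD(2)[OF dT that] op(2)[OF that] by simp
  obtain R1 where R1: "bop H ?E R1"
    "\<And>x y. x \<in> hcar H \<Longrightarrow> y \<in> hcar H \<Longrightarrow> hinner ?E (R1 x) (R1 y) = d (T x) (T y)"
    using H.form_factorization[OF dT dTc op(1)] by blast
  obtain R0 where R0: "bop H ?E R0"
    "\<And>x y. x \<in> hcar H \<Longrightarrow> y \<in> hcar H \<Longrightarrow> hinner ?E (R0 x) (R0 y) = d x y - d (T x) (T y)"
    using H.form_factorization[OF d0 d0c op(1)] by blast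
  \<comment> \<open>The first copy of E has to hold the shift, \<open>E0\<close> and the first
    component of X with orthogonal ranges: residues 1 mod 2, 2 mod 4 and 0 mod 4. In the second copy
    the shift and the other component of X share the odd and the even indices.\<close>
  define s where "s = place ?D (\<lambda>n. 2 * n + 1)"
  define j where "j = place ?D (\<lambda>n. 4 * n + 2)"
  define a where "a = place ?D (\<lambda>n. 4 * n + 0)"
  define b where "b = place ?D (\<lambda>n. 2 * n + 0)"
  have m: "strict_mono (\<lambda>n::nat. 2 * n + 1)" "strict_mono (\<lambda>n::nat. 4 * n + 2)"
    "strict_mono (\<lambda>n::nat. 4 * n + 0)" "strict_mono (\<lambda>n::nat. 2 * n + 0)"
    by (rule strict_mono_affine; simp)+
  have bops: "bop ?E ?E s" "bop ?E ?E j" "bop ?E ?E a" "bop ?E ?E b"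
    unfolding s_def j_def a_def b_def using m by (simp_all only: D.bop_place)
  have cl: "s f \<in> hcar ?E" "j f \<in> hcar ?E" "a f \<in> hcar ?E" "b f \<in> hcar ?E" if "f \<in> hcar ?E" for f
    using bops that by (simp_all only: bopD(1))
  have pres: "hinner ?E (s f) (s g) = hinner ?E f g" "hinner ?E (j f) (j g) = hinner ?E f g"
    "hinner ?E (a f) (a g) = hinner ?E f g" "hinner ?E (b f) (b g) = hinner ?E f g"
    if "f \<in> hcar ?E" "g \<in> hcar ?E" for f g
    unfolding s_def j_def a_def b_def using m that by (simp_all only: D.inner_place)
  have disj: "range (\<lambda>n::nat. 2 * n + 1) \<inter> range (\<lambda>n::nat. 4 * n + 2) = {}"
    "range (\<lambda>n::nat. 2 * n + 1) \<inter> range (\<lambda>n::nat. 4 * n + 0) = {}"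
    "range (\<lambda>n::nat. 4 * n + 2) \<inter> range (\<lambda>n::nat. 4 * n + 0) = {}"
    "range (\<lambda>n::nat. 2 * n + 1) \<inter> range (\<lambda>n::nat. 2 * n + 0) = {}"
    by (auto, presburger+)
  have orth: "hinner ?E (s f) (j g) = 0" "hinner ?E (s f) (a g) = 0" "hinner ?E (j f) (a g) = 0"
    "hinner ?E (s f) (b g) = 0" if "f \<in> hcar ?E" "g \<in> hcar ?E" for f g
    unfolding s_def j_def a_def b_def using disj that by (simp_all only: D.inner_place_disjoint)
  have orth': "hinner ?E (j g) (s f) = 0" "hinner ?E (b g) (s f) = 0"
    if "f \<in> hcar ?E" "g \<in> hcar ?E" for f g
    using orth[OF that] E.inner_cnj[of "s f" "j g"] E.inner_cnj[of "s f" "b g"] cl that by simp_all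
  define W where "W = upper_blk ?E s (\<lambda>y. hscale ?E (complex_of_real (sqrt 2)) (j y)) s"
  have W: "W (f, g) = (hadd ?E (s f) (hscale ?E (complex_of_real (sqrt 2)) (j g)), s g)" for f g
    unfolding W_def by (simp only: upper_blk_def prod.case)
  have bW: "bop (dsum ?E ?E) (dsum ?E ?E) W"
    unfolding W_def using bops by (intro bop_upper_blk bop_scale Ei)
  have W_in: "W x \<in> hcar (dsum ?E ?E)" if "x \<in> hcar (dsum ?E ?E)" for x using bW that by (rule bopD)
  have sqrt2: "complex_of_real (sqrt 2) * complex_of_real (sqrt 2) = 2"
    by (simp flip: of_real_mult)
  \<comment> \<open>The 3 is 1 from the shift on the second copy plus 2 from sqrt 2 times the
    isometry j.\<close>
  have W_inner: "hinner (dsum ?E ?E) (W (f, g)) (W (f', g')) = hinner ?E f f' + 3 * hinner ?E g g'"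
    if f: "f \<in> hcar ?E" and g: "g \<in> hcar ?E" and f': "f' \<in> hcar ?E" and g': "g' \<in> hcar ?E" for f g f' g'
  proof -
    have "hinner ?E (hadd ?E (s f) (hscale ?E (complex_of_real (sqrt 2)) (j g)))
        (hadd ?E (s f') (hscale ?E (complex_of_real (sqrt 2)) (j g')))
      = hinner ?E f f' + (complex_of_real (sqrt 2) * complex_of_real (sqrt 2)) * hinner ?E g g'"
      using that cl pres orth orth'
      by (simp only: E.inner_add_left E.inner_add_right E.inner_scale_left E.inner_scale_right
          E.add_closed E.scale_closed complex_cnj_complex_of_real) simp
    then show ?thesis unfolding W dsum_simps pres(1)[OF g g'] sqrt2 by simp
  qed
  \<comment> \<open>The entry 1 in the complex line makes v nonzero whatever H is. It proves
    nontriviality and later forces the covariance to be at least sqrt 2.\<close>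
  obtain v where v: "v \<in> hcar ?E" "hsq ?E v > 0"
  proof
    let ?v = "single ?D 0 (hzero H, 1)"
    show vE: "?v \<in> hcar ?E" by (rule D.single_closed) simp
    have "?v 0 \<noteq> hzero ?E 0" by (simp add: single_def)
    then have "?v \<noteq> hzero ?E" by (metis (no_types))
    then show "hsq ?E ?v > 0" using E.hsq_eq_0[OF vE] E.hsq_nonneg[OF vE] by linarith
  qed
  have nontriv: "hcar ?E \<noteq> {hzero ?E}" using v E.hsq_zero by force
  have W2: "two_isometry (dsum ?E ?E) W"
  proof (rule EE.two_isometryI[OF bW])
    fix x y assume "x \<in> hcar (dsum ?E ?E)" "y \<in> hcar (dsum ?E ?E)"
    then obtain f g f' g' where xy: "x = (f, g)" "y = (f', g')"
      "f \<in> hcar ?E" "g \<in> hcar ?E" "f' \<in> hcar ?E" "g' \<in> hcar ?E" unfolding dsum_simps by blast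
    \<comment> \<open>First component of W; its form is 1 on f and 2 on g. The 2-isometry equation
      then reads 1 - 2 + 1 = 0 on f and (2 + 3) - 6 + 1 = 0 on g.\<close>
    let ?u = "\<lambda>f g. hadd ?E (s f) (hscale ?E (complex_of_real (sqrt 2)) (j g))"
    have u: "?u f g \<in> hcar ?E" "?u f' g' \<in> hcar ?E" using xy cl by (simp_all only: E.add_closed E.scale_closed)
    have WW: "hinner (dsum ?E ?E) (W (W x)) (W (W y)) = hinner ?E (?u f g) (?u f' g') + 3 * hinner ?E g g'"
      unfolding xy(1,2) W[of f g] W[of f' g'] W_inner[OF u(1) cl(1)[OF xy(4)] u(2) cl(1)[OF xy(6)]]
        pres(1)[OF xy(4,6)] ..
    have "hinner ?E (?u f g) (?u f' g') + hinner ?E g g' = hinner ?E f f' + 3 * hinner ?E g g'"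
      using W_inner[OF xy(3-6)] unfolding W dsum_simps pres(1)[OF xy(4,6)] .
    then have uu: "hinner ?E (?u f g) (?u f' g') = hinner ?E f f' + 2 * hinner ?E g g'"
      by (simp add: algebra_simps)
    show "hinner (dsum ?E ?E) (W (W x)) (W (W y)) - 2 * hinner (dsum ?E ?E) (W x) (W y) + hinner (dsum ?E ?E) x y = 0"
      unfolding WW uu unfolding xy(1,2) W_inner[OF xy(3-6)] dsum_simps by simp
  qed
  define X where "X = (\<lambda>h. (a (R1 h), b (R0 h)))"
  note R1c = bopD(1)[OF R1(1)] and R0c = bopD(1)[OF R0(1)]
  have bX: "bop H (dsum ?E ?E) X"
    unfolding X_def by (intro bop_pair bop_compose[OF R1(1) bops(3)] bop_compose[OF R0(1) bops(4)] Hi Ei)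
  have X_in: "X h \<in> hcar (dsum ?E ?E)" if "h \<in> hcar H" for h using bX that by (rule bopD)
  have XX: "hinner (dsum ?E ?E) (X h) (X h') = d h h'" if "h \<in> hcar H" "h' \<in> hcar H" for h h'
    unfolding X_def dsum_simps pres(3)[OF R1c[OF that(1)] R1c[OF that(2)]]
      pres(4)[OF R0c[OF that(1)] R0c[OF that(2)]] R1(2)[OF that] R0(2)[OF that] by simp
  have WX: "hinner (dsum ?E ?E) (W x) (X h) = 0" if x: "x \<in> hcar (dsum ?E ?E)" and h: "h \<in> hcar H" for x h
  proof -
    obtain f g where fg: "x = (f, g)" "f \<in> hcar ?E" "g \<in> hcar ?E" using x unfolding dsum_simps by blast
    note r = R1c[OF h] R0c[OF h]
    show ?thesis
      unfolding fg(1) W X_def dsum_simps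
      using fg(2,3) r cl orth
      by (simp only: E.inner_add_left E.inner_scale_left E.scale_closed) simp
  qed
  have XW: "hinner (dsum ?E ?E) (X h) (W x) = 0" if x: "x \<in> hcar (dsum ?E ?E)" and h: "h \<in> hcar H" for x h
    using EE.inner_cnj[OF W_in[OF x] X_in[OF h]] WX[OF x h] by simp
  have adj: "hadj (dsum ?E ?E) (dsum ?E ?E) W (X h) = hzero (dsum ?E ?E)" if "h \<in> hcar H" for h
    using EE.complete_space_axioms EEi bW X_in[OF that] WX[OF _ that] by (rule hadj_eq_zero)
  define S where "S = upper_blk (dsum ?E ?E) W X T"
  have S: "S (x, h) = (hadd (dsum ?E ?E) (W x) (X h), T h)" for x h
    unfolding S_def by (simp only: upper_blk_def prod.case)
  have bS: "bop (dsum (dsum ?E ?E) H) (dsum (dsum ?E ?E) H) S"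
    unfolding S_def using bW bX bT EEi Hi by (rule bop_upper_blk)
  \<comment> \<open>The form of \<Delta> of S: the first copy contributes nothing, the second the
    excess 3 - 1, and on H one d comes from T and another from X.\<close>
  define Q where "Q = (\<lambda>(x :: ('a bigT \<times> 'a bigT) \<times> 'a) (y :: ('a bigT \<times> 'a bigT) \<times> 'a). 2 * hinner ?E (snd (fst x)) (snd (fst y)) + 2 * d (snd x) (snd y))"
  have Q: "Q ((f, g), h) ((f', g'), h') = 2 * hinner ?E g g' + 2 * d h h'" for f g h f' g' h'
    by (simp add: Q_def)
  have TT: "hinner H (T h) (T h') = hinner H h h' + d h h'" for h h'
    by (simp add: d_def defect_form_def)
  have split: "\<exists>f g h. x = ((f, g), h) \<and> f \<in> hcar ?E \<and> g \<in> hcar ?E \<and> h \<in> hcar H"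
    if "x \<in> hcar (dsum (dsum ?E ?E) H)" for x
    using that unfolding dsum_simps by blast
  have Qself: "Re (Q ((f, g), h) ((f, g), h)) = 2 * hsq ?E g + 2 * Re (d h h)" for f g h
    by (simp add: Q hsq_def)
  have hsqK: "hsq (dsum (dsum ?E ?E) H) ((f, g), h) = hsq ?E f + hsq ?E g + hsq H h" for f g h
    by simp
  note main = two_isometry_cov[OF K.complete_space_axioms bS, where D = Q and M = "2 * max 1 c"]
  have "two_isometry (dsum (dsum ?E ?E) H) S \<and> cov (dsum (dsum ?E ?E) H) S = sqrt (2 * max 1 c)"
  proof (rule main)
    fix x y assume x: "x \<in> hcar (dsum (dsum ?E ?E) H)" and y: "y \<in> hcar (dsum (dsum ?E ?E) H)"
    obtain f g h where x: "x = ((f, g), h)" "f \<in> hcar ?E" "g \<in> hcar ?E" "h \<in> hcar H"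
      using split[OF x] by blast
    obtain f' g' h' where y: "y = ((f', g'), h')" "f' \<in> hcar ?E" "g' \<in> hcar ?E" "h' \<in> hcar H"
      using split[OF y] by blast
    have fg: "(f, g) \<in> hcar (dsum ?E ?E)" "(f', g') \<in> hcar (dsum ?E ?E)" using x y by auto
    have "hinner (dsum ?E ?E) (hadd (dsum ?E ?E) (W (f, g)) (X h)) (hadd (dsum ?E ?E) (W (f', g')) (X h'))
      = hinner (dsum ?E ?E) (W (f, g)) (W (f', g')) + hinner (dsum ?E ?E) (X h) (X h')"
      using fg x(4) y(4) W_in X_in WX XW
      by (simp only: EE.inner_add_left EE.inner_add_right EE.add_closed) simp
    then have 1: "hinner (dsum ?E ?E) (hadd (dsum ?E ?E) (W (f, g)) (X h)) (hadd (dsum ?E ?E) (W (f', g')) (X h'))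
      = hinner ?E f f' + 3 * hinner ?E g g' + d h h'"
      using W_inner[OF x(2,3) y(2,3)] XX[OF x(4) y(4)] by simp
    show "hinner (dsum (dsum ?E ?E) H) (S x) (S y) = hinner (dsum (dsum ?E ?E) H) x y + Q x y"
      unfolding x(1) y(1) S Q dsum_simps(5)[of "dsum ?E ?E"] 1 TT unfolding dsum_simps by simp
    \<comment> \<open>The second component gains d - d \<circ> T from X, which compensates the loss
      when d is evaluated at T h; this is the whole invariance of Q.\<close>
    have 2: "hinner ?E (hadd ?E (s g) (b (R0 h))) (hadd ?E (s g') (b (R0 h'))) = hinner ?E g g' + (d h h' - d (T h) (T h'))"
    proof -
      note r = R0c[OF x(4)] R0c[OF y(4)]
      have "hinner ?E (hadd ?E (s g) (b (R0 h))) (hadd ?E (s g') (b (R0 h')))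
        = hinner ?E g g' + hinner ?E (R0 h) (R0 h')"
        using x(3) y(3) r cl orth orth' pres
        by (simp only: E.inner_add_left E.inner_add_right E.add_closed) simp
      then show ?thesis unfolding R0(2)[OF x(4) y(4)] .
    qed
    show "Q (S x) (S y) = Q x y"
      unfolding x(1) y(1) S W X_def dsum_simps(2) Q 2 by (simp add: algebra_simps)
  next
    fix x assume x: "x \<in> hcar (dsum (dsum ?E ?E) H)"
    obtain f g h where x: "x = ((f, g), h)" "f \<in> hcar ?E" "g \<in> hcar ?E" "h \<in> hcar H"
      using split[OF x] by blast
    show "0 \<le> Re (Q x x)"
      unfolding x(1) Qself using E.hsq_nonneg[OF x(3)] positive_formD(2)[OF d x(4)] by simp
    have "hsq ?E g \<le> max 1 c * hsq ?E g" "0 \<le> max 1 c * hsq ?E f"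
      using mult_right_mono[of 1 "max 1 c", OF _ E.hsq_nonneg[OF x(3)]] E.hsq_nonneg[OF x(2)] by auto
    moreover have "Re (d h h) \<le> max 1 c * hsq H h"
      using op(2)[OF x(4)] mult_right_mono[of c "max 1 c", OF _ H.hsq_nonneg[OF x(4)]] by auto
    ultimately show "Re (Q x x) \<le> 2 * max 1 c * hsq (dsum (dsum ?E ?E) H) x"
      unfolding x(1) Qself hsqK by (simp only: distrib_left mult.assoc)
  next
    fix M' assume M': "0 \<le> M'"
      and le: "\<And>x. x \<in> hcar (dsum (dsum ?E ?E) H) \<Longrightarrow> Re (Q x x) \<le> M' * hsq (dsum (dsum ?E ?E) H) x"
    \<comment> \<open>Two families of test vectors show that the bound is sharp: v in the second
      copy gives M' \<ge> 2, and vectors of H give M' \<ge> 2c.\<close>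
    have "((hzero ?E, v), hzero H) \<in> hcar (dsum (dsum ?E ?E) H)"
      unfolding dsum_simps(1) using v(1) E.zero_closed H.zero_closed by blast
    from le[OF this] have "Re (Q ((hzero ?E, v), hzero H) ((hzero ?E, v), hzero H)) \<le> M' * hsq ?E v"
      unfolding hsqK E.hsq_zero H.hsq_zero by (simp only: add_0 add_0_right)
    then have "2 * hsq ?E v \<le> M' * hsq ?E v"
      using positive_formD(2)[OF d H.zero_closed] unfolding Qself by linarith
    then have "2 \<le> M'" using v(2) by (rule mult_right_le_imp_le)
    moreover have "c \<le> M' / 2"
    proof (rule op(3))
      fix h assume h: "h \<in> hcar H"
      have "((hzero ?E, hzero ?E), h) \<in> hcar (dsum (dsum ?E ?E) H)"
        unfolding dsum_simps(1) using E.zero_closed h by blast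
      from le[OF this] have "Re (Q ((hzero ?E, hzero ?E), h) ((hzero ?E, hzero ?E), h)) \<le> M' * hsq H h"
        unfolding hsqK E.hsq_zero by (simp only: add_0)
      then show "Re (d h h) \<le> M' / 2 * hsq H h"
        unfolding Qself E.hsq_zero by simp
    qed (use M' in simp)
    ultimately show "2 * max 1 c \<le> M'" by simp
  qed simp_all
  moreover have "sqrt (2 * max 1 c) = sqrt 2 * max 1 (sqrt c)"
    by (simp add: real_sqrt_mult max_def)
  ultimately have S2: "two_isometry (dsum (dsum ?E ?E) H) S"
    "cov (dsum (dsum ?E ?E) H) S = sqrt 2 * max 1 (sqrt c)" by auto
  have hilb: "hilbert_space ?E" unfolding hilbert_space_iff by (rule E.complete_space_axioms)
  have shift: "unilateral_shift ?E s" unfolding s_def by (rule D.unilateral_shift_place)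
  have iso: "isometry ?E ?E j" unfolding j_def using m(2) by (rule D.isometry_place)
  have lift: "is_lifting (dsum ?E ?E) H S T" unfolding is_lifting_def S by simp
  show ?thesis
    unfolding c_def[symmetric]
    by (intro exI[of _ ?E] exI[of _ s] exI[of _ j] exI[of _ X] exI[of _ W] exI[of _ S] conjI ballI
        hilb nontriv shift iso bX W_def W2 adj S_def lift S2)
qed

text \<open>S is additive and acts as W on the vectors (g, 0), so the part starting in G evolves
  separately. For minimality this isolates W^n X h inside the orbit of H.\<close>

lemma funpow_block_decomposition:
  assumes "inner_space G" "inner_space H" "bop (dsum G H) (dsum G H) S" "bop G G W"
    and SW: "\<And>g. g \<in> hcar G \<Longrightarrow> S (g, hzero H) = (W g, hzero H)"
    and g: "g \<in> hcar G" and h: "h \<in> hcar H"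
  shows "(S ^^ n) (g, h) = hadd (dsum G H) ((W ^^ n) g, hzero H) ((S ^^ n) (hzero G, h))"
    and "(W ^^ n) g \<in> hcar G" and "(S ^^ n) (g, h) \<in> hcar (dsum G H)"
proof -
  interpret G: inner_space G by fact
  interpret H: inner_space H by fact
  have Wn: "(W ^^ n) g \<in> hcar G" for n by (induction n) (use g bopD(1)[OF assms(4)] in auto)
  have Sn: "(S ^^ n) x \<in> hcar (dsum G H)" if "x \<in> hcar (dsum G H)" for n x
    by (induction n) (use that bopD(1)[OF assms(3)] in \<open>auto simp del: dsum_simps\<close>)
  show "(W ^^ n) g \<in> hcar G" by (rule Wn)
  show "(S ^^ n) (g, h) \<in> hcar (dsum G H)" by (rule Sn) (use g h in simp)
  have z: "(hzero G, h) \<in> hcar (dsum G H)" using h by simp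
  show "(S ^^ n) (g, h) = hadd (dsum G H) ((W ^^ n) g, hzero H) ((S ^^ n) (hzero G, h))"
  proof (induction n)
    case 0
    show ?case using g h H.add_comm[of "hzero H" h] by simp
  next
    case (Suc n)
    have w: "((W ^^ n) g, hzero H) \<in> hcar (dsum G H)" using Wn by simp
    have "(S ^^ Suc n) (g, h) = S (hadd (dsum G H) ((W ^^ n) g, hzero H) ((S ^^ n) (hzero G, h)))"
      using Suc by simp
    also have "\<dots> = hadd (dsum G H) (S ((W ^^ n) g, hzero H)) (S ((S ^^ n) (hzero G, h)))"
      using assms(3) w Sn[OF z] by (rule bopD(2))
    finally show ?case using SW[OF Wn] by simp
  qed
qed

text \<open>With the invariant form q at hand, any X whose form is q - d and whose range is
  orthogonal to that of W gives the covariance. Minimality is then obtained by shrinking E to the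
  part reached from H.\<close>

lemma concave_minimal_lifting:
  fixes H :: "'a cips" and T :: "'a \<Rightarrow> 'a"
  assumes H: "complete_space H" and T: "concave_op H T"
  shows "\<exists>(G :: 'a bigT cips) W X S.
            hilbert_space G \<and> isometry G G W \<and> bop H G X \<and>
            S = upper_blk G W X T \<and>
            (\<forall>g\<in>hcar G. S (g, hzero H) = (W g, hzero H)) \<and>
            (\<forall>h\<in>hcar H. hadj G G W (X h) = hzero G) \<and>
            minimal_lifting G H S T \<and>
            two_isometry (dsum G H) S \<and>
            cov (dsum G H) S = sqrt (opnorm H H (Delta H T))"
proof -
  interpret H: complete_space H by fact
  let ?D = "dsum H complex_line"
  let ?E = "ell2 ?D"
  interpret D: complete_space ?D by (intro complete_space_dsum H complete_space_complex_line)
  interpret E: complete_space ?E by (rule complete_space_ell2) (rule D.complete_space_axioms)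
  note Hi = H.inner_space_axioms and Ei = E.inner_space_axioms
  note bT = H.concave_bop[OF T]
  define d where "d = defect_form H T"
  define c where "c = opnorm H H (Delta H T)"
  note d = H.positive_defect_form[OF T, folded d_def] and dec = H.defect_form_decreasing[OF T, folded d_def]
    and op = H.defect_form_opnorm[OF T, folded d_def c_def]
  obtain q where q: "positive_form H q"
    "\<And>x. x \<in> hcar H \<Longrightarrow> Re (d x x) \<le> Re (q x x)" "\<And>x. x \<in> hcar H \<Longrightarrow> Re (q x x) \<le> c * hsq H x"
    "\<And>x y. x \<in> hcar H \<Longrightarrow> y \<in> hcar H \<Longrightarrow> q (T x) (T y) = q x y"
    using H.invariant_form_exists[OF bT H.concave_op_expansive[OF T] d op(1,2) dec] by blast
  have qd: "positive_form H (\<lambda>x y. q x y - d x y)"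
    using positive_formD(1)[OF q(1)] positive_formD(1)[OF d] q(2) by (rule positive_form_diff)
  have qdc: "Re (q x x - d x x) \<le> c * hsq H x" if "x \<in> hcar H" for x
    using positive_formD(2)[OF d that] q(3)[OF that] by simp
  obtain R where R: "bop H ?E R"
    "\<And>x y. x \<in> hcar H \<Longrightarrow> y \<in> hcar H \<Longrightarrow> hinner ?E (R x) (R y) = q x y - d x y"
    using H.form_factorization[OF qd qdc op(1)] by blast
  note Rc = bopD(1)[OF R(1)]
  define W where "W = place ?D (\<lambda>n. 2 * n + 1)"
  define b where "b = place ?D (\<lambda>n. 2 * n + 0)"
  have m: "strict_mono (\<lambda>n::nat. 2 * n + 1)" "strict_mono (\<lambda>n::nat. 2 * n + 0)"
    by (rule strict_mono_affine; simp)+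
  have bops: "bop ?E ?E W" "bop ?E ?E b" unfolding W_def b_def using m by (simp_all only: D.bop_place)
  have pres: "hinner ?E (W f) (W g) = hinner ?E f g" "hinner ?E (b f) (b g) = hinner ?E f g"
    if "f \<in> hcar ?E" "g \<in> hcar ?E" for f g
    unfolding W_def b_def using m that by (simp_all only: D.inner_place)
  have disj: "range (\<lambda>n::nat. 2 * n + 1) \<inter> range (\<lambda>n::nat. 2 * n + 0) = {}" by (auto, presburger)
  have orth: "hinner ?E (W f) (b g) = 0" if "f \<in> hcar ?E" "g \<in> hcar ?E" for f g
    unfolding W_def b_def using disj that by (rule D.inner_place_disjoint)
  define X where "X = (\<lambda>h. b (R h))"
  have bXE: "bop H ?E X" unfolding X_def by (intro bop_compose[OF R(1) bops(2)] Hi Ei)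
  note XE = bopD(1)[OF bXE] and WE = bopD(1)[OF bops(1)]
  have XX: "hinner ?E (X h) (X h') = q h h' - d h h'" if "h \<in> hcar H" "h' \<in> hcar H" for h h'
    unfolding X_def pres(2)[OF Rc[OF that(1)] Rc[OF that(2)]] by (rule R(2)[OF that])
  have WX: "hinner ?E (W g) (X h) = 0" if "g \<in> hcar ?E" "h \<in> hcar H" for g h
    unfolding X_def using that(1) Rc[OF that(2)] by (rule orth)
  have XW: "hinner ?E (X h) (W g) = 0" if "g \<in> hcar ?E" "h \<in> hcar H" for g h
    using E.inner_cnj[OF WE[OF that(1)] XE[OF that(2)]] WX[OF that] by simp
  define M where "M = (\<Union>n. (W ^^ n) ` X ` hcar H)"
  have WnE: "(W ^^ n) f \<in> hcar ?E" if "f \<in> hcar ?E" for n f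
    by (induction n) (use that WE in auto)
  have ME: "M \<subseteq> hcar ?E" unfolding M_def using WnE XE by blast
  \<comment> \<open>S maps (0, h) to (X h, T h), so the first components produced from H are built
    from the vectors W^n X h. Their closed span is the least closed W-invariant subspace containing
    the range of X.\<close>
  define L where "L = closed_span ?E M"
  have Lc: "closed_subspace ?E L" unfolding L_def using ME by (rule E.closed_subspace_closed_span)
  have span: "M \<subseteq> L" unfolding L_def by (rule E.closed_span_superset)
  have LE: "f \<in> hcar ?E" if "f \<in> L" for f using Lc that unfolding closed_subspace_def by blast
  define G where "G = restrict_space ?E L"
  have G [simp]: "hcar G = L" "hadd G = hadd ?E" "hscale G = hscale ?E" "hzero G = hzero ?E"
    "hinner G = hinner ?E" "hsq G = hsq ?E" "hnorm G = hnorm ?E" "hsub G = hsub ?E"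
    unfolding G_def by (simp_all only: restrict_space_simps)
  interpret G: complete_space G
    unfolding G_def using E.complete_space_axioms Lc by (rule complete_space_restrict)
  note Gi = G.inner_space_axioms
  interpret K: complete_space "dsum G H" by (rule complete_space_dsum) (rule G.complete_space_axioms H)+
  have WL: "W g \<in> L" if "g \<in> L" for g
  proof -
    have "closed_subspace ?E {x \<in> hcar ?E. W x \<in> L}"
      using Ei Ei bops(1) Lc by (rule closed_subspace_vimage)
    moreover have "M \<subseteq> {x \<in> hcar ?E. W x \<in> L}"
    proof
      fix f assume f: "f \<in> M"
      then obtain n h where "h \<in> hcar H" "f = (W ^^ n) (X h)" unfolding M_def by blast
      then have "W f = (W ^^ Suc n) (X h)" "h \<in> hcar H" by simp_all
      then have "W f \<in> M" unfolding M_def by blast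
      then show "f \<in> {x \<in> hcar ?E. W x \<in> L}" using f ME span by blast
    qed
    ultimately have "L \<subseteq> {x \<in> hcar ?E. W x \<in> L}" unfolding L_def[symmetric] using E.closed_span_minimal L_def by blast
    then show ?thesis using that by blast
  qed
  have XL: "X h \<in> L" if "h \<in> hcar H" for h
  proof -
    have "(W ^^ 0) (X h) \<in> M" unfolding M_def using that by blast
    then show ?thesis using span by auto
  qed
  have W_hsq: "hsq ?E (W g) = hsq ?E g" if "g \<in> L" for g
    using pres(1)[OF LE[OF that] LE[OF that]] by (simp add: hsq_def)
  have bW: "bop G G W"
  proof (rule bopI[OF Gi Gi, where c = 1]; unfold G)
    show "W x \<in> L" if "x \<in> L" for x using that by (rule WL)
    show "W (hadd ?E x y) = hadd ?E (W x) (W y)" if "x \<in> L" "y \<in> L" for x y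
      using bops(1) LE[OF that(1)] LE[OF that(2)] by (rule bopD)
    show "W (hscale ?E s x) = hscale ?E s (W x)" if "x \<in> L" for s x
      using bops(1) LE[OF that] by (rule bopD)
    show "hsq ?E (W x) \<le> 1 * hsq ?E x" if "x \<in> L" for x using W_hsq[OF that] by simp
  qed
  have isoW: "isometry G G W"
    unfolding isometry_def
  proof (intro conjI ballI bW)
    fix g assume "g \<in> hcar G"
    then show "hnorm G (W g) = hnorm G g" using W_hsq[of g] by (simp add: hnorm_def hsq_def)
  qed
  have bX: "bop H G X"
  proof -
    obtain k where k: "\<And>x. x \<in> hcar H \<Longrightarrow> hsq ?E (X x) \<le> k * hsq H x"
      using bop_bound_sq[OF bXE Hi Ei] by blast
    show ?thesis
    proof (rule bopI[OF Hi Gi]; unfold G)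
      show "X x \<in> L" if "x \<in> hcar H" for x using that by (rule XL)
      show "X (hadd H x y) = hadd ?E (X x) (X y)" if "x \<in> hcar H" "y \<in> hcar H" for x y
        using bXE that by (rule bopD)
      show "X (hscale H s x) = hscale ?E s (X x)" if "x \<in> hcar H" for s x
        using bXE that by (rule bopD)
      show "hsq ?E (X x) \<le> k * hsq H x" if "x \<in> hcar H" for x using that by (rule k)
    qed
  qed
  \<comment> \<open>The adjoint is now the one of W on G, not on E; orthogonality of the ranges is
    inherited, and that is all that is used.\<close>
  have adj: "hadj G G W (X h) = hzero G" if "h \<in> hcar H" for h
    using G.complete_space_axioms Gi bW
  proof (rule hadj_eq_zero; unfold G)
    show "X h \<in> L" using that by (rule XL)
    show "hinner ?E (W x) (X h) = 0" if "x \<in> L" for x using LE[OF that] \<open>h \<in> hcar H\<close> by (rule WX)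
  qed
  define S where "S = upper_blk G W X T"
  have S: "S (g, h) = (hadd ?E (W g) (X h), T h)" for g h
    unfolding S_def by (simp only: upper_blk_def prod.case G)
  have bS: "bop (dsum G H) (dsum G H) S"
    unfolding S_def using bW bX bT Gi Hi by (rule bop_upper_blk)
  have SW: "S (g, hzero H) = (W g, hzero H)" if "g \<in> hcar G" for g
    unfolding S bop_zero[OF bT Hi Hi] bop_zero[OF bXE Hi Ei]
    using E.add_zero[OF WE[OF LE]] that by (simp only: G)
  have S0: "S (hzero G, h) = (X h, T h)" if h: "h \<in> hcar H" for h
    unfolding S G(4) bop_zero[OF bops(1) Ei Ei]
    using E.add_comm[OF E.zero_closed XE[OF h]] E.add_zero[OF XE[OF h]] by (simp only:)
  have TT: "hinner H (T h) (T h') = hinner H h h' + d h h'" for h h'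
    by (simp add: d_def defect_form_def)
  \<comment> \<open>W is isometric and orthogonal to X, so \<Delta> of S sees only the H-component,
    with value (q - d) + d = q. Invariance of q under T is then the 2-isometry condition.\<close>
  have "two_isometry (dsum G H) S \<and> cov (dsum G H) S = sqrt c"
  proof (rule two_isometry_cov[OF K.complete_space_axioms bS, where D = "\<lambda>x y. q (snd x) (snd y)" and M = c])
    fix x y assume "x \<in> hcar (dsum G H)" "y \<in> hcar (dsum G H)"
    then obtain g h g' h' where xy: "x = (g, h)" "y = (g', h')" "g \<in> L" "h \<in> hcar H" "g' \<in> L" "h' \<in> hcar H"
      unfolding dsum_simps G by blast
    have "hinner ?E (hadd ?E (W g) (X h)) (hadd ?E (W g') (X h')) = hinner ?E g g' + (q h h' - d h h')"
      using WE[OF LE[OF xy(3)]] WE[OF LE[OF xy(5)]] XE[OF xy(4)] XE[OF xy(6)]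
        WX[OF LE[OF xy(3)] xy(6)] XW[OF LE[OF xy(5)] xy(4)] XX[OF xy(4,6)] pres(1)[OF LE[OF xy(3)] LE[OF xy(5)]]
      by (simp only: E.inner_add_left E.inner_add_right E.add_closed) simp
    then show "hinner (dsum G H) (S x) (S y) = hinner (dsum G H) x y + q (snd x) (snd y)"
      unfolding xy(1,2) S dsum_simps G TT by simp
    show "q (snd (S x)) (snd (S y)) = q (snd x) (snd y)"
      unfolding xy(1,2) S snd_conv by (rule q(4)[OF xy(4,6)])
  next
    fix x assume "x \<in> hcar (dsum G H)"
    then obtain g h where x: "x = (g, h)" "g \<in> L" "h \<in> hcar H" unfolding dsum_simps G by blast
    show "0 \<le> Re (q (snd x) (snd x))" unfolding x(1) snd_conv using q(1) x(3) by (rule positive_formD)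
    have "0 \<le> c * hsq ?E g" using op(1) E.hsq_nonneg[OF LE[OF x(2)]] by simp
    then show "Re (q (snd x) (snd x)) \<le> c * hsq (dsum G H) x"
      unfolding x(1) snd_conv hsq_dsum G distrib_left using q(3)[OF x(3)] by linarith
  next
    fix M' assume M': "0 \<le> M'"
      and le: "\<And>x. x \<in> hcar (dsum G H) \<Longrightarrow> Re (q (snd x) (snd x)) \<le> M' * hsq (dsum G H) x"
    \<comment> \<open>Since d \<le> q, a bound for q also bounds d, and c is the least bound of
      d.\<close>
    show "c \<le> M'"
    proof (rule op(3)[OF _ M'])
      fix h assume h: "h \<in> hcar H"
      have "(hzero G, h) \<in> hcar (dsum G H)" using h G.zero_closed by simp
      from le[OF this] have "Re (q h h) \<le> M' * hsq H h"
        unfolding snd_conv hsq_dsum G.hsq_zero by simp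
      then show "Re (d h h) \<le> M' * hsq H h" using q(2)[OF h] by linarith
    qed
  qed (rule op(1))+
  then have S2: "two_isometry (dsum G H) S" "cov (dsum G H) S = sqrt c" by auto
  have lift: "is_lifting G H S T" unfolding is_lifting_def S by simp
  have "closed_span (dsum G H) (\<Union>n. (S ^^ n) ` ({hzero G} \<times> hcar H)) = hcar (dsum G H)" (is "closed_span _ ?O = _")
  proof
    note power = funpow_block_decomposition[OF Gi Hi bS bW SW]
    show "closed_span (dsum G H) ?O \<subseteq> hcar (dsum G H)"
    proof (rule K.closed_span_subset)
      show "?O \<subseteq> hcar (dsum G H)" using power(3)[OF _ G.zero_closed] by blast
    qed
    show "hcar (dsum G H) \<subseteq> closed_span (dsum G H) ?O"
    proof
      fix x assume x: "x \<in> hcar (dsum G H)"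
      show "x \<in> closed_span (dsum G H) ?O"
      proof (rule K.closed_spanI)
        fix N assume N: "closed_subspace (dsum G H) N" "?O \<subseteq> N"
        have N_add: "u \<in> N \<Longrightarrow> v \<in> N \<Longrightarrow> hadd (dsum G H) u v \<in> N"
          and N_scale: "u \<in> N \<Longrightarrow> hscale (dsum G H) s u \<in> N" for u v s
          using N(1) unfolding closed_subspace_def by blast+
        have N_sub: "u \<in> N \<Longrightarrow> v \<in> N \<Longrightarrow> hsub (dsum G H) u v \<in> N" for u v
          unfolding hsub_def using N_add N_scale by blast
        have orbit: "(S ^^ n) (hzero G, h) \<in> N" if "h \<in> hcar H" for n h using N(2) that by blast
        have bJ: "bop G (dsum G H) (\<lambda>g. (g, hzero H))"
        proof (rule bopI[OF Gi K.inner_space_axioms, where c = 1])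
          have "hadd H (hzero H) (hzero H) = hzero H" by simp
          then show "(hadd G u v, hzero H) = hadd (dsum G H) (u, hzero H) (v, hzero H)" for u v
            unfolding dsum_simps by simp
          have "hscale H s (hzero H) = hzero H" for s by (rule H.vector_eqI) auto
          then show "(hscale G s u, hzero H) = hscale (dsum G H) s (u, hzero H)" for s u
            unfolding dsum_simps by simp
          show "hsq (dsum G H) (u, hzero H) \<le> 1 * hsq G u" for u unfolding hsq_dsum by simp
        qed simp
        have cN: "closed_subspace ?E {g \<in> hcar G. (g, hzero H) \<in> N}"
          by (rule closed_subspace_of_restrict[OF Lc], fold G_def)
             (rule closed_subspace_vimage[OF Gi K.inner_space_axioms bJ N(1)])
        have "M \<subseteq> {g \<in> hcar G. (g, hzero H) \<in> N}"
        proof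
          fix f assume f: "f \<in> M"
          then obtain n h where h: "h \<in> hcar H" and fn: "f = (W ^^ n) (X h)" unfolding M_def by blast
          have Th: "T h \<in> hcar H" using bT h by (rule bopD)
          have Xh: "X h \<in> hcar G" using XL[OF h] by simp
          have fG: "f \<in> hcar G" using f span by auto
          let ?u = "(S ^^ n) (hzero G, T h)"
          have u: "?u \<in> hcar (dsum G H)" using power(3)[OF _ G.zero_closed Th] by blast
          \<comment> \<open>After one step the orbit of h splits as (W^n X h, 0) plus the n-th orbit
            vector of T h. Both orbit vectors lie in N, hence so does their difference (W^n X h,
            0).\<close>
          have "(S ^^ Suc n) (hzero G, h) = (S ^^ n) (X h, T h)"
            using S0[OF h] by (simp only: funpow_Suc_right comp_apply)
          also have "\<dots> = hadd (dsum G H) (f, hzero H) ?u"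
            unfolding fn using power(1)[OF _ Xh Th] by blast
          finally have eq: "(S ^^ Suc n) (hzero G, h) = hadd (dsum G H) (f, hzero H) ?u" .
          have fK: "(f, hzero H) \<in> hcar (dsum G H)" using fG by simp
          have "(f, hzero H) = hsub (dsum G H) (hadd (dsum G H) (f, hzero H) ?u) ?u"
            by (rule K.vector_eqI[OF fK])
               (use fK u in \<open>simp_all only: K.sub_closed K.add_closed K.inner_sub_left K.inner_add_left add_diff_cancel_right'\<close>)
          also have "\<dots> \<in> N" using N_sub[OF orbit[OF h, of "Suc n"] orbit[OF Th, of n]] unfolding eq .
          finally show "f \<in> {g \<in> hcar G. (g, hzero H) \<in> N}" using fG by blast
        qed
        with cN have "L \<subseteq> {g \<in> hcar G. (g, hzero H) \<in> N}" unfolding L_def by (rule E.closed_span_minimal)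
        then have gN: "(g, hzero H) \<in> N" if "g \<in> L" for g using that by blast
        obtain g h where gh: "x = (g, h)" "g \<in> L" "h \<in> hcar H" using x unfolding dsum_simps G by blast
        have "x = hadd (dsum G H) (g, hzero H) (hzero G, h)"
          using gh H.add_comm[of "hzero H" h] E.add_zero[OF LE[OF gh(2)]] unfolding dsum_simps G by simp
        also have "\<dots> \<in> N" using orbit[OF gh(3), of 0] by (intro N_add gN gh) simp
        finally show "x \<in> N" .
      qed
    qed
  qed
  then have minimal: "minimal_lifting G H S T" unfolding minimal_lifting_def using lift by blast
  have hilb: "hilbert_space G" unfolding hilbert_space_iff by (rule G.complete_space_axioms)
  show ?thesis
    unfolding c_def[symmetric]
    by (intro exI[of _ G] exI[of _ W] exI[of _ X] exI[of _ S] conjI ballI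
        hilb isoW bX S_def SW adj minimal S2)
qed

theorem theorem2p1:
  fixes H :: "'a cips" and T :: "'a \<Rightarrow> 'a"
  assumes "hilbert_space H" and "bop H H T" and "concave_op H T"
  shows "(\<exists>(G1 :: 'a bigT cips) (G0 :: 'a bigT cips) S1 S0 E0 X W S.
            hilbert_space G1 \<and> hilbert_space G0 \<and>
            hcar G1 \<noteq> {hzero G1} \<and> hcar G0 \<noteq> {hzero G0} \<and>
            unilateral_shift G1 S1 \<and> unilateral_shift G0 S0 \<and>
            isometry G0 G1 E0 \<and> bop H (dsum G1 G0) X \<and>
            W = upper_blk G1 S1 (\<lambda>y. hscale G1 (complex_of_real (sqrt 2)) (E0 y)) S0 \<and>
            two_isometry (dsum G1 G0) W \<and>
            (\<forall>h\<in>hcar H. hadj (dsum G1 G0) (dsum G1 G0) W (X h) = hzero (dsum G1 G0)) \<and>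
            S = upper_blk (dsum G1 G0) W X T \<and>
            is_lifting (dsum G1 G0) H S T \<and>
            two_isometry (dsum (dsum G1 G0) H) S \<and>
            cov (dsum (dsum G1 G0) H) S = sqrt 2 * max 1 (sqrt (opnorm H H (Delta H T))))
       \<and> (\<exists>(G :: 'a bigT cips) W X S.
            hilbert_space G \<and> isometry G G W \<and> bop H G X \<and>
            S = upper_blk G W X T \<and>
            (\<forall>g\<in>hcar G. S (g, hzero H) = (W g, hzero H)) \<and>
            (\<forall>h\<in>hcar H. hadj G G W (X h) = hzero G) \<and>
            minimal_lifting G H S T \<and>
            two_isometry (dsum G H) S \<and>
            cov (dsum G H) S = sqrt (opnorm H H (Delta H T)))"
proof (rule conjI)
  have H: "complete_space H" using assms(1) by (simp only: hilbert_space_iff)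
  show "\<exists>(G1 :: 'a bigT cips) (G0 :: 'a bigT cips) S1 S0 E0 X W S.
            hilbert_space G1 \<and> hilbert_space G0 \<and>
            hcar G1 \<noteq> {hzero G1} \<and> hcar G0 \<noteq> {hzero G0} \<and>
            unilateral_shift G1 S1 \<and> unilateral_shift G0 S0 \<and>
            isometry G0 G1 E0 \<and> bop H (dsum G1 G0) X \<and>
            W = upper_blk G1 S1 (\<lambda>y. hscale G1 (complex_of_real (sqrt 2)) (E0 y)) S0 \<and>
            two_isometry (dsum G1 G0) W \<and>
            (\<forall>h\<in>hcar H. hadj (dsum G1 G0) (dsum G1 G0) W (X h) = hzero (dsum G1 G0)) \<and>
            S = upper_blk (dsum G1 G0) W X T \<and>
            is_lifting (dsum G1 G0) H S T \<and>
            two_isometry (dsum (dsum G1 G0) H) S \<and>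
            cov (dsum (dsum G1 G0) H) S = sqrt 2 * max 1 (sqrt (opnorm H H (Delta H T)))"
    using H assms(3) by (rule concave_lifting_of_covariance_sqrt_two)
  show "\<exists>(G :: 'a bigT cips) W X S.
            hilbert_space G \<and> isometry G G W \<and> bop H G X \<and>
            S = upper_blk G W X T \<and>
            (\<forall>g\<in>hcar G. S (g, hzero H) = (W g, hzero H)) \<and>
            (\<forall>h\<in>hcar H. hadj G G W (X h) = hzero G) \<and>
            minimal_lifting G H S T \<and>
            two_isometry (dsum G H) S \<and>
            cov (dsum G H) S = sqrt (opnorm H H (Delta H T))"
    using H assms(3) by (rule concave_minimal_lifting)
qed

end
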